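(* Consider the center-unstable Hénon-like family of endomorphisms of $\mathbb{R}^3$ $$G_{(\xi,\mu,\kappa,\eta)}(x,y,z)=(y,\ \mu+y^2+\kappa\,y\,z+\eta\,z^2,\ \xi\,z+y),\qquad \xi>1.$$ Then there is $\varepsilon>0$ such that for every $$\bar\nu=(\xi,\mu,\kappa,\eta)\in\mathcal{O}_\varepsilon=(1.18,1.19)\times(-10,-9)\times(-\varepsilon,\varepsilon)^2$$ the endomorphism $G_{\bar\nu}$ has a blender-horseshoe in the cube $\Delta=[-4,4]^2\times[-40,22]$. As a consequence, every diffeomorphism or endomorphism sufficiently $C^1$-close to $G_{\bar\nu}$ has a blender-horseshoe in $\Delta$.
   Context: An endomorphism is a $C^1$ map, not necessarily invertible. **Cube and boundary.** Let $\mathrm I_x=[x^-,x^+]$, $\mathrm I_y=[y^-,y^+]$, $\mathrm I_z=[z^-,z^+]$ be compact intervals with $0$ in their interiors and $\Delta=\mathrm I_x\times\mathrm I_y\times\mathrm I_z$. Put $\partial^{\mathrm s}\Delta=\partial\mathrm I_x\times\mathrm I_y\times\mathrm I_z$, $\partial^{\mathrm{uu}}\Delta=\mathrm I_x\times\partial\mathrm I_y\times\mathrm I_z$, $\partial^{\mathrm u}\Delta=\mathrm I_x\times\partial(\mathrm I_y\times\mathrm I_z)$. **Cones.** For $\theta>0$ and $p\in\mathbb{R}^3$: $\mathcal C^{\mathrm s}_\theta(p)=\{(u,v,w)\in\mathbb{R}^3:\sqrt{v^2+w^2}<\theta|u|\}$, $\mathcal C^{\mathrm{uu}}_\theta(p)=\{(u,v,w)\in\mathbb{R}^3:\sqrt{u^2+w^2}<\theta|v|\}$,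 $\mathcal C^{\mathrm u}_\theta(p)=\{(u,v,w)\in\mathbb{R}^3:|u|<\theta\sqrt{v^2+w^2}\}$. **Discs.** A regular curve $L$ is an $\mathrm s_\vartheta$-disc if $L\subset\Delta$, $T_pL\subset\mathcal C^{\mathrm s}_\vartheta(p)$ for each $p\in L$, and its end-points are contained in different connected components of $\partial^{\mathrm s}\Delta$. It is a $\mathrm{uu}_\theta$-disc if $L\subset\mathbb{R}\times\mathrm I_y\times\mathbb{R}$, $T_pL\subset\mathcal C^{\mathrm{uu}}_\theta(p)$ for each $p\in L$, and its end-points are contained in different connected components of $\mathbb{R}\times\partial\mathrm I_y\times\mathbb{R}$. Below, $\theta,\vartheta>0$ are fixed (those of (BH2)) and omitted from the notation. **Right and left classes.** Every $\mathrm s$-disc $W$ such that $W\setminus\partial W$ is contained in the interior of $\Delta$ defines two different (free) homotopy classes of $\mathrm{uu}$-discs disjoint from $W$. The right class $\mathcal U^r_W$ is the class containing the $\mathrm{uu}$-disc $\{0\}\times\mathrm I_y\times\{z^+\}$ and the left class $\mathcal U^\ell_W$ is the class containing $\{0\}\times\mathrm I_y\times\{z^-\}$. With a slight abuse of notation, $\mathcal U^i_W$ ($i=r,\ell$) also denotes the union of the $\mathrm{uu}$-discs in the class. **Blender-horseshoe.** Let $F$ be a (local) diffeomorphism $F:\Delta\to F(\Delta)\subset\mathbb{R}^3$ or an endomorphism $F:\Delta\to\mathbb{R}^3$; preimages $F^{-1}(\cdot)$ are taken in $\Delta$. $F$ has a blender-horseshoe in $\Delta$ if its maximal invariant set $\Lambda_F=\bigcap_{i\in\mathbb{Z}}F^i(\Delta)$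 is contained in $\mathrm{int}(\Delta)$ and conditions (BH1)–(BH6) hold (the same conditions are required for diffeomorphisms and for endomorphisms); then $\Lambda_F$ is called a blender-horseshoe. (BH1) There are connected subsets $\mathcal A,\mathcal B$ of $\Delta$ with $\mathcal A\cap\mathcal B=\emptyset$ and $(\mathcal A\cup\mathcal B)\cap\partial^{\mathrm{uu}}\Delta=\emptyset$ such that $F(\Delta)\cap(\mathbb{R}\times\mathrm I_y\times\mathbb{R})=F(\mathcal A)\cup F(\mathcal B)\subset(x^-,x^+)\times\mathrm I_y\times\mathbb{R}$. The sets $F(\mathcal A)$ and $F(\mathcal B)$ are the connected components of $F(\Delta)\cap(\mathbb{R}\times\mathrm I_y\times\mathbb{R})$. (BH2) There exist $\theta,\vartheta>0$, $\ell\in\mathbb{N}$, $c>1$ and cone fields $\mathcal C^{\mathrm s}_\vartheta$, $\mathcal C^{\mathrm u}_\theta$, $\mathcal C^{\mathrm{uu}}_\theta$ such that: (i) for every $p\in\mathcal A\cup\mathcal B$, $DF^\ell_p(\mathcal C^{\mathrm s}_\vartheta(p))\supset\mathcal C^{\mathrm s}_\vartheta(F^\ell(p))$, $DF^\ell_p(\mathcal C^{\mathrm u}_\theta(p))\subset\mathcal C^{\mathrm u}_\theta(F^\ell(p))$ and $DF^\ell_p(\mathcal C^{\mathrm{uu}}_\theta(p))\subset\mathcal C^{\mathrm{uu}}_\theta(F^\ell(p))$; (ii) for every $v\in\mathcal C^{\mathrm s}_\vartheta(p)$ and every $w\in\mathcal C^{\mathrm u}_\theta(p)$, $|DF^\ell_pv|\le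 c^{-1}|v|$ and $|DF^\ell_pw|\ge c|w|$. Conditions (BH1) and (BH2) imply the existence of two fixed saddles $P\in\mathcal A$ and $Q\in\mathcal B$ (the reference saddles). For $R=P,Q$, let $W^{\mathrm s}_{\mathrm{loc}}(R)$ be the connected component of $W^{\mathrm s}(R)\cap\Delta$ containing $R$, where $W^{\mathrm s}(R)$ is the stable manifold of $R$; these are $\mathrm s$-discs. Write $W_P=W^{\mathrm s}_{\mathrm{loc}}(P)$, $W_Q=W^{\mathrm s}_{\mathrm{loc}}(Q)$. Either $\mathcal U^\ell_{W_P}\cap\mathcal U^r_{W_Q}\ne\emptyset$ or $\mathcal U^r_{W_P}\cap\mathcal U^\ell_{W_Q}\ne\emptyset$; it is assumed that the first case holds, and $\mathcal U^b:=\mathcal U^\ell_{W_P}\cap\mathcal U^r_{W_Q}$ (the superposition region). (BH3) The connected components of $F^{-1}(\Delta)\cap\Delta$ are the sets $\mathbb A=F^{-1}(F(\mathcal A)\cap\Delta)$ and $\mathbb B=F^{-1}(F(\mathcal B)\cap\Delta)$, which satisfy $\mathbb A\cup\mathbb B\subset\mathrm I_x\times(y^-,y^+)\times(z^-,z^+)$ and $F(\mathbb A)\cup F(\mathbb B)\subset(x^-,x^+)\times\mathrm I_y\times\mathbb{R}$. (BH4) If $L$ and $L'$ are $\mathrm{uu}$-discs such that $L\cap W_P\ne\emptyset$ and $L'\cap W_Q\ne\emptyset$, then $L\cap\overline{(\partial^{\mathrm u}\Delta\setminus\partial^{\mathrm{uu}}\Delta)}=\emptyset$ and $L'\cap\overline{(\partial^{\mathrm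 u}\Delta\setminus\partial^{\mathrm{uu}}\Delta)}=\emptyset$. (BH5) For a $\mathrm{uu}$-disc $L$ in $\Delta$ put $L_{\mathcal A}=L\cap\mathcal A$ and $L_{\mathcal B}=L\cap\mathcal B$ (by (BH1) and (BH2), $F(L_{\mathcal A})$ and $F(L_{\mathcal B})$ are $\mathrm{uu}$-discs in $\mathrm I_x\times\mathrm I_y\times\mathbb{R}$). Then: (1) if $L\in\mathcal U^r_{W_P}$ then $F(L_{\mathcal A})\in\mathcal U^r_{W_P}$; (2) if $L\in\mathcal U^\ell_{W_P}$ then $F(L_{\mathcal A})\in\mathcal U^\ell_{W_P}$; (3) if $L\in\mathcal U^r_{W_Q}$ then $F(L_{\mathcal B})\in\mathcal U^r_{W_Q}$; (4) if $L\in\mathcal U^\ell_{W_Q}$ then $F(L_{\mathcal B})\in\mathcal U^\ell_{W_Q}$; (5) if $L\in\mathcal U^r_{W_P}$ or $L\cap W_P\ne\emptyset$ then $F(L_{\mathcal B})\in\mathcal U^r_{W_P}$; (6) if $L\in\mathcal U^\ell_{W_Q}$ or $L\cap W_Q\ne\emptyset$ then $F(L_{\mathcal A})\in\mathcal U^\ell_{W_Q}$. (BH6) If $L$ is a $\mathrm{uu}$-disc in $\Delta$ such that $L\in\mathcal U^b$, then either $F(L_{\mathcal A})$ or $F(L_{\mathcal B})$ is contained in $\mathcal U^b$.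
   Formalization: In (BH2) the stable-cone inclusion DF^l(C^s) ⊃ C^s, impossible since DG has rank at most 2, is replaced by (DF^l)^{-1}(C^s) ⊂ C^s (equivalent when DF^l is invertible); homotopies of uu-discs are taken in I_x × I_y × R so that the right and left classes differ. *)

theory Defs
  imports "HOL-Analysis.Analysis"
begin

section \<open>Cubes, boundaries and cones\<close>

type_synonym r3 = "real \<times> real \<times> real"

record cube =
  xlo :: real  xhi :: real
  ylo :: real  yhi :: real
  zlo :: real  zhi :: real

definition zero_inside :: "cube \<Rightarrow> bool" where
  "zero_inside K \<longleftrightarrow> xlo K < 0 \<and> 0 < xhi K \<and> ylo K < 0 \<and> 0 < yhi K \<and> zlo K < 0 \<and> 0 < zhi K"

definition Ix :: "cube \<Rightarrow> real set" where "Ix K = {xlo K..xhi K}"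
definition Iy :: "cube \<Rightarrow> real set" where "Iy K = {ylo K..yhi K}"
definition Iz :: "cube \<Rightarrow> real set" where "Iz K = {zlo K..zhi K}"

definition Delta :: "cube \<Rightarrow> r3 set" where
  "Delta K = Ix K \<times> Iy K \<times> Iz K"

definition bd_s :: "cube \<Rightarrow> r3 set" where
  "bd_s K = frontier (Ix K) \<times> Iy K \<times> Iz K"

definition bd_uu :: "cube \<Rightarrow> r3 set" where
  "bd_uu K = Ix K \<times> frontier (Iy K) \<times> Iz K"

definition bd_u :: "cube \<Rightarrow> r3 set" where
  "bd_u K = Ix K \<times> frontier (Iy K \<times> Iz K)"

definition strip :: "cube \<Rightarrow> r3 set" where
  "strip K = UNIV \<times> Iy K \<times> UNIV"

text \<open>The cone fields do not depend on the base point. The inequalities are strict, so none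
  of the cones contains the zero vector.\<close>

definition cone_s :: "real \<Rightarrow> r3 set" where
  "cone_s \<theta> = {(u, v, w). sqrt (v\<^sup>2 + w\<^sup>2) < \<theta> * \<bar>u\<bar>}"

definition cone_uu :: "real \<Rightarrow> r3 set" where
  "cone_uu \<theta> = {(u, v, w). sqrt (u\<^sup>2 + w\<^sup>2) < \<theta> * \<bar>v\<bar>}"

definition cone_u :: "real \<Rightarrow> r3 set" where
  "cone_u \<theta> = {(u, v, w). \<bar>u\<bar> < \<theta> * sqrt (v\<^sup>2 + w\<^sup>2)}"


section \<open>Discs\<close>

text \<open>A regular \<open>C\<^sup>1\<close> arc, parametrised over the unit interval with one-sided derivatives at the
  end-points, all of whose (nonzero) tangent vectors lie in the cone \<open>C\<close>. The cones
  used are invariant under multiplication by nonzero scalars, so this depends only on the tangent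
  lines.\<close>

definition regular_arc_tangent :: "r3 set \<Rightarrow> (real \<Rightarrow> r3) \<Rightarrow> bool" where
  "regular_arc_tangent C \<gamma> \<longleftrightarrow> arc \<gamma> \<and>
     (\<exists>\<gamma>'. continuous_on {0..1} \<gamma>' \<and>
        (\<forall>t\<in>{0..1}. (\<gamma> has_vector_derivative \<gamma>' t) (at t within {0..1}) \<and>
                     \<gamma>' t \<noteq> 0 \<and> \<gamma>' t \<in> C))"

definition joins_components :: "r3 set \<Rightarrow> (real \<Rightarrow> r3) \<Rightarrow> bool" where
  "joins_components S \<gamma> \<longleftrightarrow>
     (\<exists>C\<in>components S. \<exists>C'\<in>components S. C \<noteq> C' \<and> pathstart \<gamma> \<in> C \<and> pathfinish \<gamma> \<in> C')"

definition s_arc :: "cube \<Rightarrow> real \<Rightarrow> (real \<Rightarrow> r3) \<Rightarrow> bool" where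
  "s_arc K \<theta> \<gamma> \<longleftrightarrow> regular_arc_tangent (cone_s \<theta>) \<gamma> \<and> path_image \<gamma> \<subseteq> Delta K \<and>
     joins_components (bd_s K) \<gamma>"

definition uu_arc :: "cube \<Rightarrow> real \<Rightarrow> (real \<Rightarrow> r3) \<Rightarrow> bool" where
  "uu_arc K \<theta> \<gamma> \<longleftrightarrow> regular_arc_tangent (cone_uu \<theta>) \<gamma> \<and> path_image \<gamma> \<subseteq> strip K \<and>
     joins_components (UNIV \<times> frontier (Iy K) \<times> UNIV) \<gamma>"

definition uu_disc :: "cube \<Rightarrow> real \<Rightarrow> r3 set \<Rightarrow> bool" where
  "uu_disc K \<theta> L \<longleftrightarrow> (\<exists>\<gamma>. uu_arc K \<theta> \<gamma> \<and> path_image \<gamma> = L)"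

text \<open>An s-disc which, apart from its two end-points, lies in the interior of the cube; these are
  the s-discs for which right and left classes are defined.\<close>

definition inner_s_disc :: "cube \<Rightarrow> real \<Rightarrow> r3 set \<Rightarrow> bool" where
  "inner_s_disc K \<theta> W \<longleftrightarrow>
     (\<exists>\<gamma>. s_arc K \<theta> \<gamma> \<and> path_image \<gamma> = W \<and>
          W - {pathstart \<gamma>, pathfinish \<gamma>} \<subseteq> interior (Delta K))"

text \<open>Free homotopy through uu-discs disjoint from \<open>W\<close>. The homotopy takes place in
  \<open>Ix \<times> Iy \<times> \<real>\<close>: in the whole strip \<open>\<real> \<times> Iy \<times> \<real>\<close> a disc could be moved around the
  end-points of \<open>W\<close>, and there would not be two different classes.\<close>

definition uu_homotopic :: "cube \<Rightarrow> real \<Rightarrow> r3 set \<Rightarrow> r3 set \<Rightarrow> r3 set \<Rightarrow> bool" where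
  "uu_homotopic K \<theta> W L L' \<longleftrightarrow>
     (\<exists>\<gamma> \<gamma>'. path_image \<gamma> = L \<and> path_image \<gamma>' = L' \<and>
        homotopic_with_canon (\<lambda>\<delta>. uu_arc K \<theta> \<delta> \<and> path_image \<delta> \<inter> W = {})
          {0..1} (Ix K \<times> Iy K \<times> UNIV) \<gamma> \<gamma>')"

definition right_class :: "cube \<Rightarrow> real \<Rightarrow> r3 set \<Rightarrow> r3 set set" where
  "right_class K \<theta> W = {L. uu_homotopic K \<theta> W ({0} \<times> Iy K \<times> {zhi K}) L}"

definition left_class :: "cube \<Rightarrow> real \<Rightarrow> r3 set \<Rightarrow> r3 set set" where
  "left_class K \<theta> W = {L. uu_homotopic K \<theta> W ({0} \<times> Iy K \<times> {zlo K}) L}"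


section \<open>Maps defined on the cube\<close>

text \<open>A map from the cube to \<open>\<real>\<^sup>3\<close> is a total function of which only the values on \<open>Delta K\<close>
  matter.\<close>

definition C1_on :: "r3 set \<Rightarrow> (r3 \<Rightarrow> r3) \<Rightarrow> bool" where
  "C1_on S F \<longleftrightarrow>
     (\<exists>D :: r3 \<Rightarrow> r3 \<Rightarrow>\<^sub>L r3. continuous_on S D \<and>
        (\<forall>p\<in>S. (F has_derivative blinfun_apply (D p)) (at p within S)))"

definition DF :: "cube \<Rightarrow> (r3 \<Rightarrow> r3) \<Rightarrow> r3 \<Rightarrow> r3 \<Rightarrow> r3" where
  "DF K F p = frechet_derivative F (at p within Delta K)"

definition C1_close :: "cube \<Rightarrow> real \<Rightarrow> (r3 \<Rightarrow> r3) \<Rightarrow> (r3 \<Rightarrow> r3) \<Rightarrow> bool" where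
  "C1_close K \<delta> F G \<longleftrightarrow>
     (\<forall>p\<in>Delta K. norm (F p - G p) < \<delta> \<and> onorm (\<lambda>v. DF K F p v - DF K G p v) < \<delta>)"

text \<open>The domain of the \<open>n\<close>-th iterate.\<close>

definition dom_iter :: "cube \<Rightarrow> (r3 \<Rightarrow> r3) \<Rightarrow> nat \<Rightarrow> r3 set" where
  "dom_iter K F n = {p \<in> Delta K. \<forall>i<n. (F ^^ i) p \<in> Delta K}"

text \<open>The derivative of the \<open>n\<close>-th iterate at a point of its domain, by the chain rule.\<close>

primrec DF_iter :: "cube \<Rightarrow> (r3 \<Rightarrow> r3) \<Rightarrow> nat \<Rightarrow> r3 \<Rightarrow> r3 \<Rightarrow> r3" where
  "DF_iter K F 0 p = id"
| "DF_iter K F (Suc n) p = DF K F ((F ^^ n) p) \<circ> DF_iter K F n p"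

text \<open>The intersection of all forward images and all preimages of the cube.\<close>

definition max_invariant :: "cube \<Rightarrow> (r3 \<Rightarrow> r3) \<Rightarrow> r3 set" where
  "max_invariant K F =
     (\<Inter>n. (F ^^ n) ` dom_iter K F n) \<inter> (\<Inter>n. {p \<in> dom_iter K F n. (F ^^ n) p \<in> Delta K})"

text \<open>Hyperbolic fixed point with nontrivial stable and unstable spaces. On \<open>Eu\<close> the estimate
  makes the derivative injective, hence an isomorphism of \<open>Eu\<close>; on \<open>Es\<close> it may be singular.\<close>

definition fixed_saddle :: "cube \<Rightarrow> (r3 \<Rightarrow> r3) \<Rightarrow> r3 \<Rightarrow> bool" where
  "fixed_saddle K F R \<longleftrightarrow> R \<in> Delta K \<and> F R = R \<and>
     (\<exists>Es Eu. subspace Es \<and> subspace Eu \<and> Es \<noteq> {0} \<and> Eu \<noteq> {0} \<and>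
        Es \<inter> Eu = {0} \<and> {a + b | a b. a \<in> Es \<and> b \<in> Eu} = UNIV \<and>
        DF K F R ` Es \<subseteq> Es \<and> DF K F R ` Eu \<subseteq> Eu \<and>
        (\<exists>C>0. \<exists>r. 0 < r \<and> r < 1 \<and>
           (\<forall>n. \<forall>v\<in>Es. norm ((DF K F R ^^ n) v) \<le> C * r ^ n * norm v) \<and>
           (\<forall>n. \<forall>v\<in>Eu. norm v \<le> C * r ^ n * norm ((DF K F R ^^ n) v))))"

definition stable_set :: "cube \<Rightarrow> (r3 \<Rightarrow> r3) \<Rightarrow> r3 \<Rightarrow> r3 set" where
  "stable_set K F R = {p. (\<forall>n. (F ^^ n) p \<in> Delta K) \<and> (\<lambda>n. (F ^^ n) p) \<longlonglongrightarrow> R}"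

definition Ws_loc :: "cube \<Rightarrow> (r3 \<Rightarrow> r3) \<Rightarrow> r3 \<Rightarrow> r3 set" where
  "Ws_loc K F R = connected_component_set (stable_set K F R \<inter> Delta K) R"


section \<open>Blender-horseshoes\<close>

definition BH1 :: "cube \<Rightarrow> (r3 \<Rightarrow> r3) \<Rightarrow> r3 set \<Rightarrow> r3 set \<Rightarrow> bool" where
  "BH1 K F A B \<longleftrightarrow>
     A \<subseteq> Delta K \<and> B \<subseteq> Delta K \<and> connected A \<and> connected B \<and>
     A \<inter> B = {} \<and> (A \<union> B) \<inter> bd_uu K = {} \<and>
     F ` Delta K \<inter> strip K = F ` A \<union> F ` B \<and>
     F ` A \<union> F ` B \<subseteq> {xlo K<..<xhi K} \<times> Iy K \<times> UNIV \<and>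
     F ` A \<noteq> F ` B \<and> components (F ` Delta K \<inter> strip K) = {F ` A, F ` B}"

text \<open>The stable condition, usually written \<open>C' \<subseteq> T ` C\<close>, is stated as \<open>T -` C' \<subseteq> C\<close>.
  The two agree for invertible \<open>T\<close> (see the next lemma); for singular \<open>T\<close> the first form
  can never hold, since the open cone \<open>C'\<close> is not contained in a proper subspace.\<close>

lemma image_cone_iff_vimage_cone:
  assumes "bij T"
  shows "C' \<subseteq> T ` C \<longleftrightarrow> T -` C' \<subseteq> C"
proof
  assume "C' \<subseteq> T ` C"
  then show "T -` C' \<subseteq> C"
    using assms by (auto simp: bij_def inj_eq dest!: subsetD)
next
  assume *: "T -` C' \<subseteq> C"
  show "C' \<subseteq> T ` C"
  proof
    fix y assume "y \<in> C'"
    moreover obtain x where "y = T x"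
      using assms by (metis bij_pointE)
    ultimately show "y \<in> T ` C" using * by auto
  qed
qed

definition BH2 :: "cube \<Rightarrow> (r3 \<Rightarrow> r3) \<Rightarrow> r3 set \<Rightarrow> r3 set \<Rightarrow> real \<Rightarrow> real \<Rightarrow> nat \<Rightarrow> real \<Rightarrow> bool" where
  "BH2 K F A B \<theta> \<theta>s l c \<longleftrightarrow>
     \<theta> > 0 \<and> \<theta>s > 0 \<and> l \<ge> 1 \<and> c > 1 \<and>
     (\<forall>p \<in> (A \<union> B) \<inter> dom_iter K F l.
        DF_iter K F l p -` cone_s \<theta>s \<subseteq> cone_s \<theta>s \<and>
        DF_iter K F l p ` cone_u \<theta> \<subseteq> cone_u \<theta> \<and>
        DF_iter K F l p ` cone_uu \<theta> \<subseteq> cone_uu \<theta> \<and>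
        (\<forall>v\<in>cone_s \<theta>s. norm (DF_iter K F l p v) \<le> inverse c * norm v) \<and>
        (\<forall>w\<in>cone_u \<theta>. norm (DF_iter K F l p w) \<ge> c * norm w))"

definition BH3 :: "cube \<Rightarrow> (r3 \<Rightarrow> r3) \<Rightarrow> r3 set \<Rightarrow> r3 set \<Rightarrow> bool" where
  "BH3 K F A B \<longleftrightarrow>
     (let AA = {p \<in> Delta K. F p \<in> F ` A \<inter> Delta K};
          BB = {p \<in> Delta K. F p \<in> F ` B \<inter> Delta K}
      in components {p \<in> Delta K. F p \<in> Delta K} = {AA, BB} \<and>
         AA \<union> BB \<subseteq> Ix K \<times> {ylo K<..<yhi K} \<times> {zlo K<..<zhi K} \<and>
         F ` AA \<union> F ` BB \<subseteq> {xlo K<..<xhi K} \<times> Iy K \<times> UNIV)"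

definition BH4 :: "cube \<Rightarrow> real \<Rightarrow> r3 set \<Rightarrow> r3 set \<Rightarrow> bool" where
  "BH4 K \<theta> WP WQ \<longleftrightarrow>
     (\<forall>L L'. uu_disc K \<theta> L \<and> uu_disc K \<theta> L' \<and> L \<inter> WP \<noteq> {} \<and> L' \<inter> WQ \<noteq> {} \<longrightarrow>
        L \<inter> closure (bd_u K - bd_uu K) = {} \<and> L' \<inter> closure (bd_u K - bd_uu K) = {})"

definition BH5 :: "cube \<Rightarrow> (r3 \<Rightarrow> r3) \<Rightarrow> r3 set \<Rightarrow> r3 set \<Rightarrow> real \<Rightarrow> r3 set \<Rightarrow> r3 set \<Rightarrow> bool" where
  "BH5 K F A B \<theta> WP WQ \<longleftrightarrow>
     (\<forall>L. uu_disc K \<theta> L \<and> L \<subseteq> Delta K \<longrightarrow>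
        (L \<in> right_class K \<theta> WP \<longrightarrow> F ` (L \<inter> A) \<in> right_class K \<theta> WP) \<and>
        (L \<in> left_class K \<theta> WP \<longrightarrow> F ` (L \<inter> A) \<in> left_class K \<theta> WP) \<and>
        (L \<in> right_class K \<theta> WQ \<longrightarrow> F ` (L \<inter> B) \<in> right_class K \<theta> WQ) \<and>
        (L \<in> left_class K \<theta> WQ \<longrightarrow> F ` (L \<inter> B) \<in> left_class K \<theta> WQ) \<and>
        (L \<in> right_class K \<theta> WP \<or> L \<inter> WP \<noteq> {} \<longrightarrow> F ` (L \<inter> B) \<in> right_class K \<theta> WP) \<and>
        (L \<in> left_class K \<theta> WQ \<or> L \<inter> WQ \<noteq> {} \<longrightarrow> F ` (L \<inter> A) \<in> left_class K \<theta> WQ))"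

text \<open>The superposition region, as a set of uu-discs.\<close>

definition superposition :: "cube \<Rightarrow> real \<Rightarrow> r3 set \<Rightarrow> r3 set \<Rightarrow> r3 set set" where
  "superposition K \<theta> WP WQ = left_class K \<theta> WP \<inter> right_class K \<theta> WQ"

definition BH6 :: "cube \<Rightarrow> (r3 \<Rightarrow> r3) \<Rightarrow> r3 set \<Rightarrow> r3 set \<Rightarrow> real \<Rightarrow> r3 set \<Rightarrow> r3 set \<Rightarrow> bool" where
  "BH6 K F A B \<theta> WP WQ \<longleftrightarrow>
     (\<forall>L. uu_disc K \<theta> L \<and> L \<subseteq> Delta K \<and> L \<in> superposition K \<theta> WP WQ \<longrightarrow>
        F ` (L \<inter> A) \<in> superposition K \<theta> WP WQ \<or> F ` (L \<inter> B) \<in> superposition K \<theta> WP WQ)"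

definition blender_horseshoe :: "cube \<Rightarrow> (r3 \<Rightarrow> r3) \<Rightarrow> bool" where
  "blender_horseshoe K F \<longleftrightarrow>
     zero_inside K \<and> C1_on (Delta K) F \<and> max_invariant K F \<subseteq> interior (Delta K) \<and>
     (\<exists>A B \<theta> \<theta>s l c P Q.
        BH1 K F A B \<and> BH2 K F A B \<theta> \<theta>s l c \<and>
        P \<in> A \<and> fixed_saddle K F P \<and> Q \<in> B \<and> fixed_saddle K F Q \<and>
        inner_s_disc K \<theta>s (Ws_loc K F P) \<and> inner_s_disc K \<theta>s (Ws_loc K F Q) \<and>
        superposition K \<theta> (Ws_loc K F P) (Ws_loc K F Q) \<noteq> {} \<and>
        BH3 K F A B \<and>
        BH4 K \<theta> (Ws_loc K F P) (Ws_loc K F Q) \<and>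
        BH5 K F A B \<theta> (Ws_loc K F P) (Ws_loc K F Q) \<and>
        BH6 K F A B \<theta> (Ws_loc K F P) (Ws_loc K F Q))"


section \<open>The center-unstable Henon-like family\<close>

definition henon_cu :: "real \<Rightarrow> real \<Rightarrow> real \<Rightarrow> real \<Rightarrow> r3 \<Rightarrow> r3" where
  "henon_cu \<xi> \<mu> \<kappa> \<eta> = (\<lambda>(x, y, z). (y, \<mu> + y\<^sup>2 + \<kappa> * y * z + \<eta> * z\<^sup>2, \<xi> * z + y))"

definition henon_cube :: cube where
  "henon_cube = \<lparr>xlo = -4, xhi = 4, ylo = -4, yhi = 4, zlo = -40, zhi = 22\<rparr>"

end

theory Submission
  imports Defs
begin

text \<open>
  For \<open>\<kappa> = \<eta> = 0\<close> the map is \<open>H (x, y, z) = (y, \<mu> + y\<^sup>2, \<xi> z + y)\<close>. It forgets \<open>x\<close>, folds \<open>y\<close> and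
  expands \<open>z\<close> by the weak factor \<open>\<xi>\<close>. The points of the cube whose image lies in the strip have
  \<open>2.2 < \<bar>y\<bar> < 3.75\<close>, so they form two branches, \<open>y < 0\<close> and \<open>y > 0\<close>, on which \<open>y\<close> is expanded by
  more than \<open>4\<close>. Each branch contains one fixed point: \<open>P\<close> with \<open>y \<approx> -2.6\<close> and \<open>z \<approx> 14\<close>, and \<open>Q\<close>
  with \<open>y \<approx> 3.6\<close> and \<open>z \<approx> -20\<close>. Their local stable sets are segments parallel to the \<open>x\<close>-axis, and
  a uu-disc, being a graph over \<open>y\<close> of slope at most \<open>1/2\<close>, passes above, below or through each of them.
  All this survives small \<open>C\<^sup>1\<close> perturbations with uniform bounds. So one theorem about every \<open>F\<close>
  that is \<open>C\<^sup>1\<close>-close to \<open>H\<close> (\<open>blender_horseshoe_near_henon\<close>) covers the family with small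
  \<open>\<kappa>, \<eta>\<close> and its neighbours; \<open>near_henon_if_C1_close\<close> supplies the constants.

  The map \<open>F\<close> enters almost only through \<open>near_step\<close>: derivatives \<open>DF\<^sub>p v\<close> and differences
  \<open>F p - F q\<close> on a branch both agree, up to a relative error \<open>1/10000\<close>, with \<open>v \<mapsto> (v\<^sub>2, m v\<^sub>2, \<xi> v\<^sub>3 + v\<^sub>2)\<close> where
  \<open>4 \<le> \<bar>m\<bar> \<le> 8\<close>. This gives (BH2) for the first iterate with \<open>\<theta> = 1/2\<close> and \<open>\<theta>\<^sub>s = 1/20\<close>, and the same
  estimates for differences give the stable curves. A perturbation of \<open>H\<close> need not be invertible, so
  the curves are constructed directly: pulling back graphs over \<open>x\<close> produces points whose orbit
  stays in one branch, vertical expansion makes them a Lipschitz graph on which \<open>F\<close> contracts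
  (\<open>trapped_flat\<close>, \<open>trapped_exists\<close>), and the graph is \<open>C\<^sup>1\<close> because the oscillation of its
  difference quotients halves under pull-back (\<open>osc_le_half\<close>). The tangent at the fixed point is the
  stable eigenvector from which the hyperbolic splitting is obtained (\<open>saddle_fixed_saddle\<close>).

  Let \<open>x \<mapsto> (x, Y x, Z x)\<close> be a stable curve. A uu-disc meets the wall \<open>y = Y x\<close> in exactly one point,
  and it avoids the curve iff this crossing has nonzero height over the curve. The sign of
  the height is invariant under homotopy, and discs of the same sign are homotopic; so right and
  left classes are described by this sign (\<open>class_iff_on_side\<close>). Then (BH5) and (BH6) are statements
  about the heights of two points of \<open>L\<close>, its crossing with the wall and the point that \<open>F\<close> maps to the
  wall. For the invariant branch they are almost equal (\<open>height_of_image_same_sign\<close>). For the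
  other branch of a fixed point with coordinates \<open>y\<^sub>R, z\<^sub>R\<close> the second point has
  \<open>y \<approx> -y\<^sub>R\<close>, the disc changes its height by at most \<open>\<bar>y\<^sub>R\<bar>\<close> in between, and \<open>(\<xi> - 1) \<bar>z\<^sub>R\<bar> = \<bar>y\<^sub>R\<bar>\<close> leaves a gain of \<open>(2 - \<xi>) \<bar>y\<^sub>R\<bar> > 0\<close>
  (\<open>height_of_image_across\<close>). For (BH6) the two fixed points are more than \<open>20\<close> apart in \<open>z\<close>, and a
  disc that fails for both branches would have to cover a good part of this distance, while its
  \<open>z\<close>-variation is at most \<open>4\<close>.
\<close>

section \<open>Nearly linear steps and the cones\<close>

abbreviation xc :: "r3 \<Rightarrow> real" where "xc p \<equiv> fst p"
abbreviation yc :: "r3 \<Rightarrow> real" where "yc p \<equiv> fst (snd p)"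
abbreviation zc :: "r3 \<Rightarrow> real" where "zc p \<equiv> snd (snd p)"

definition l1 :: "r3 \<Rightarrow> real" where "l1 v = \<bar>xc v\<bar> + \<bar>yc v\<bar> + \<bar>zc v\<bar>"

definition vert :: "r3 \<Rightarrow> real" where "vert v = \<bar>yc v\<bar> + \<bar>zc v\<bar>"

abbreviation tol :: real where "tol \<equiv> 1/10000"

lemma norm_r3: "norm v = sqrt ((xc v)\<^sup>2 + (yc v)\<^sup>2 + (zc v)\<^sup>2)" for v :: r3
  by (cases v; cases "snd v") (simp add: norm_Pair)

lemma norm_le_l1: "norm v \<le> l1 v" for v :: r3
proof -
  have "(xc v)\<^sup>2 + (yc v)\<^sup>2 + (zc v)\<^sup>2 \<le> (l1 v)\<^sup>2"
    unfolding l1_def by (simp add: power2_eq_square algebra_simps flip: abs_mult)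
  then show ?thesis unfolding norm_r3 by (simp add: real_le_lsqrt l1_def)
qed

lemma comp_le_norm:
  fixes v :: r3
  shows "\<bar>xc v\<bar> \<le> norm v" "\<bar>yc v\<bar> \<le> norm v" "\<bar>zc v\<bar> \<le> norm v"
  unfolding norm_r3 by (rule real_le_rsqrt, simp)+

lemma l1_le_norm: "l1 v \<le> 3 * norm v"
  using comp_le_norm[of v] unfolding l1_def by linarith

text \<open>Derivatives \<open>DF\<^sub>p v\<close> (with \<open>m = 2 y\<close>) and differences \<open>F p - F q\<close> (with \<open>m = y + y'\<close>, because
  \<open>y\<^sup>2 - y'\<^sup>2 = (y + y') (y - y')\<close>) of maps close to \<open>H\<close> have this form. So each estimate of this
  section is used twice, infinitesimally and for pairs of points.\<close>

definition near_step :: "real \<Rightarrow> real \<Rightarrow> r3 \<Rightarrow> r3 \<Rightarrow> bool" where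
  "near_step \<xi> m v v' \<longleftrightarrow>
     \<bar>xc v' - yc v\<bar> \<le> tol * l1 v \<and> \<bar>yc v' - m * yc v\<bar> \<le> tol * l1 v \<and>
     \<bar>zc v' - (\<xi> * zc v + yc v)\<bar> \<le> tol * l1 v"

lemma near_step_bounds:
  assumes "near_step \<xi> m v v'" "4 \<le> \<bar>m\<bar>" "\<bar>m\<bar> \<le> 8" "(59/50) < \<xi>" "\<xi> < (119/100)"
  shows "\<bar>xc v'\<bar> \<le> \<bar>yc v\<bar> + tol * l1 v"
    "4 * \<bar>yc v\<bar> - tol * l1 v \<le> \<bar>yc v'\<bar>" "\<bar>yc v'\<bar> \<le> 8 * \<bar>yc v\<bar> + tol * l1 v"
    "(59/50) * \<bar>zc v\<bar> - \<bar>yc v\<bar> - tol * l1 v \<le> \<bar>zc v'\<bar>"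
    "\<bar>zc v'\<bar> \<le> (119/100) * \<bar>zc v\<bar> + \<bar>yc v\<bar> + tol * l1 v"
proof -
  have tri: "\<bar>a\<bar> \<le> \<bar>b\<bar> + t \<and> \<bar>b\<bar> - t \<le> \<bar>a\<bar>" if "\<bar>a - b\<bar> \<le> t" for a b t :: real
    using that by linarith
  have m: "4 * \<bar>yc v\<bar> \<le> \<bar>m * yc v\<bar>" "\<bar>m * yc v\<bar> \<le> 8 * \<bar>yc v\<bar>"
    using assms by (auto simp: abs_mult intro: mult_right_mono)
  have "(59/50) * \<bar>zc v\<bar> \<le> \<xi> * \<bar>zc v\<bar>" "\<xi> * \<bar>zc v\<bar> \<le> (119/100) * \<bar>zc v\<bar>"
    using assms by (intro mult_right_mono; simp)+
  then have x: "(59/50) * \<bar>zc v\<bar> \<le> \<bar>\<xi> * zc v\<bar>" "\<bar>\<xi> * zc v\<bar> \<le> (119/100) * \<bar>zc v\<bar>"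
    using assms by (auto simp: abs_mult)
  have z: "\<bar>\<xi> * zc v\<bar> - \<bar>yc v\<bar> \<le> \<bar>\<xi> * zc v + yc v\<bar>" "\<bar>\<xi> * zc v + yc v\<bar> \<le> \<bar>\<xi> * zc v\<bar> + \<bar>yc v\<bar>"
    by linarith+
  have t: "\<bar>xc v'\<bar> \<le> \<bar>yc v\<bar> + tol * l1 v \<and> \<bar>yc v\<bar> - tol * l1 v \<le> \<bar>xc v'\<bar>"
     "\<bar>yc v'\<bar> \<le> \<bar>m * yc v\<bar> + tol * l1 v \<and> \<bar>m * yc v\<bar> - tol * l1 v \<le> \<bar>yc v'\<bar>"
     "\<bar>zc v'\<bar> \<le> \<bar>\<xi> * zc v + yc v\<bar> + tol * l1 v \<and> \<bar>\<xi> * zc v + yc v\<bar> - tol * l1 v \<le> \<bar>zc v'\<bar>"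
    using assms(1) unfolding near_step_def by (auto intro!: tri simp del: abs_le_iff)
  have ineq: "p \<le> q \<Longrightarrow> q - t \<le> r \<Longrightarrow> p - t \<le> r" "q \<le> p \<Longrightarrow> r \<le> q + t \<Longrightarrow> r \<le> p + t"
    "p \<le> q \<Longrightarrow> q - s \<le> r' \<Longrightarrow> r' - t \<le> r \<Longrightarrow> p - s - t \<le> r"
    "q \<le> p \<Longrightarrow> r' \<le> q + s \<Longrightarrow> r \<le> r' + t \<Longrightarrow> r \<le> p + s + t" for p q r r' s t :: real
    by linarith+
  have "4 * \<bar>yc v\<bar> - tol * l1 v \<le> \<bar>yc v'\<bar>" "\<bar>yc v'\<bar> \<le> 8 * \<bar>yc v\<bar> + tol * l1 v"
    using ineq(1)[OF m(1)] ineq(2)[OF m(2)] t(2) by blast+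
  moreover have "(59/50) * \<bar>zc v\<bar> - \<bar>yc v\<bar> - tol * l1 v \<le> \<bar>zc v'\<bar>"
    "\<bar>zc v'\<bar> \<le> (119/100) * \<bar>zc v\<bar> + \<bar>yc v\<bar> + tol * l1 v"
    using ineq(3)[OF x(1) z(1)] ineq(4)[OF x(2) z(2)] t(3) by blast+
  ultimately show "\<bar>xc v'\<bar> \<le> \<bar>yc v\<bar> + tol * l1 v"
    "4 * \<bar>yc v\<bar> - tol * l1 v \<le> \<bar>yc v'\<bar>" "\<bar>yc v'\<bar> \<le> 8 * \<bar>yc v\<bar> + tol * l1 v"
    "(59/50) * \<bar>zc v\<bar> - \<bar>yc v\<bar> - tol * l1 v \<le> \<bar>zc v'\<bar>"
    "\<bar>zc v'\<bar> \<le> (119/100) * \<bar>zc v\<bar> + \<bar>yc v\<bar> + tol * l1 v"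
    using t(1) by blast+
qed

text \<open>The form in which the bounds are used: six free nonnegative numbers in place of the absolute
  values leave plain linear inequalities.\<close>

lemma near_step_cases:
  assumes "near_step \<xi> m v v'" "4 \<le> \<bar>m\<bar>" "\<bar>m\<bar> \<le> 8" "(59/50) < \<xi>" "\<xi> < (119/100)"
    and "\<And>a b c a' b' c' t. \<lbrakk>0 \<le> a; 0 \<le> b; 0 \<le> c; 0 \<le> a'; 0 \<le> b'; 0 \<le> c'; 10000 * t = a + b + c;
      a' \<le> b + t; 4 * b - t \<le> b'; b' \<le> 8 * b + t; 59 * c - 50 * b - 50 * t \<le> 50 * c';
      100 * c' \<le> 119 * c + 100 * b + 100 * t\<rbrakk>
      \<Longrightarrow> \<Phi> a b c a' b' c'"
  shows "\<Phi> \<bar>xc v\<bar> \<bar>yc v\<bar> \<bar>zc v\<bar> \<bar>xc v'\<bar> \<bar>yc v'\<bar> \<bar>zc v'\<bar>"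
proof -
  define t where t: "t = tol * l1 v"
  then have "10000 * t = \<bar>xc v\<bar> + \<bar>yc v\<bar> + \<bar>zc v\<bar>" by (simp add: l1_def)
  then show ?thesis
    using near_step_bounds[OF assms(1-5), folded t]
    by (intro assms(6)[where t = t] abs_ge_zero; (assumption | linarith))
qed

text \<open>For vectors that are not nearly parallel to the \<open>x\<close>-axis: \<open>\<bar>y\<bar>\<close> is multiplied by at least \<open>4\<close> and \<open>\<bar>z\<bar>\<close>
  by \<open>1.18\<close>, and the shear \<open>z + y\<close> costs at most \<open>\<bar>y\<bar>\<close> of this, so the sum \<open>\<bar>y\<bar> + \<bar>z\<bar>\<close> still grows.\<close>

lemma vert_grows:
  assumes "near_step \<xi> m v v'" "4 \<le> \<bar>m\<bar>" "\<bar>m\<bar> \<le> 8" "(59/50) < \<xi>" "\<xi> < (119/100)"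
    and "\<bar>xc v\<bar> \<le> 100 * vert v"
  shows "(11/10) * vert v \<le> vert v'" "\<bar>xc v'\<bar> \<le> 2 * vert v"
proof -
  have "\<bar>xc v\<bar> \<le> 100 * (\<bar>yc v\<bar> + \<bar>zc v\<bar>) \<longrightarrow>
      11 * (\<bar>yc v\<bar> + \<bar>zc v\<bar>) \<le> 10 * (\<bar>yc v'\<bar> + \<bar>zc v'\<bar>) \<and> \<bar>xc v'\<bar> \<le> 2 * (\<bar>yc v\<bar> + \<bar>zc v\<bar>)"
    by (rule near_step_cases[OF assms(1-5), where \<Phi> =
          "\<lambda>a b c a' b' c'. a \<le> 100 * (b + c) \<longrightarrow> 11 * (b + c) \<le> 10 * (b' + c') \<and> a' \<le> 2 * (b + c)"]) ((unfold distrib_left)?, safe; linarith)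
  then show "(11/10) * vert v \<le> vert v'" "\<bar>xc v'\<bar> \<le> 2 * vert v"
    using assms(6) by (simp_all add: vert_def)
qed

text \<open>The image of a vector with vertical part is steep, since \<open>x\<close> becomes \<open>y\<close> while \<open>y\<close> grows by \<open>4\<close>. A flat
  image can only come from the error term, which is proportional to \<open>x\<close>.\<close>

lemma vert_le_if_image_flat:
  assumes "near_step \<xi> m v v'" "4 \<le> \<bar>m\<bar>" "\<bar>m\<bar> \<le> 8" "(59/50) < \<xi>" "\<xi> < (119/100)"
    and "vert v' \<le> \<bar>xc v'\<bar> / 9"
  shows "vert v \<le> \<bar>xc v\<bar> / 1000"
proof -
  have "\<bar>yc v'\<bar> + \<bar>zc v'\<bar> \<le> \<bar>xc v'\<bar> / 9 \<longrightarrow> \<bar>yc v\<bar> + \<bar>zc v\<bar> \<le> \<bar>xc v\<bar> / 1000"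
    by (rule near_step_cases[OF assms(1-5), where \<Phi> =
          "\<lambda>a b c a' b' c'. b' + c' \<le> a' / 9 \<longrightarrow> b + c \<le> a / 1000"]) ((unfold distrib_left)?, safe; linarith)
  then show ?thesis using assms(6) by (simp add: vert_def)
qed

lemma near_step_contracts:
  assumes "near_step \<xi> m v v'" "4 \<le> \<bar>m\<bar>" "\<bar>m\<bar> \<le> 8" "(59/50) < \<xi>" "\<xi> < (119/100)"
    and "\<bar>yc v\<bar> \<le> \<bar>xc v\<bar> / 20" "\<bar>zc v\<bar> \<le> \<bar>xc v\<bar> / 20"
  shows "l1 v' \<le> 3/4 * \<bar>xc v\<bar>"
proof -
  have "\<bar>yc v\<bar> \<le> \<bar>xc v\<bar> / 20 \<and> \<bar>zc v\<bar> \<le> \<bar>xc v\<bar> / 20 \<longrightarrow>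
      \<bar>xc v'\<bar> + \<bar>yc v'\<bar> + \<bar>zc v'\<bar> \<le> 3/4 * \<bar>xc v\<bar>"
    by (rule near_step_cases[OF assms(1-5), where \<Phi> =
          "\<lambda>a b c a' b' c'. b \<le> a / 20 \<and> c \<le> a / 20 \<longrightarrow> a' + b' + c' \<le> 3/4 * a"]) ((unfold distrib_left)?, safe; linarith)
  then show ?thesis using assms(6-) by (simp add: l1_def)
qed

lemma cone_s_bounds:
  assumes "v \<in> cone_s \<theta>"
  shows "\<bar>yc v\<bar> \<le> \<theta> * \<bar>xc v\<bar>" "\<bar>zc v\<bar> \<le> \<theta> * \<bar>xc v\<bar>"
proof -
  have "sqrt ((yc v)\<^sup>2 + (zc v)\<^sup>2) < \<theta> * \<bar>xc v\<bar>"
    using assms by (auto simp: cone_s_def)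
  moreover have "\<bar>yc v\<bar> \<le> sqrt ((yc v)\<^sup>2 + (zc v)\<^sup>2)" "\<bar>zc v\<bar> \<le> sqrt ((yc v)\<^sup>2 + (zc v)\<^sup>2)"
    by (auto intro!: real_le_rsqrt)
  ultimately show "\<bar>yc v\<bar> \<le> \<theta> * \<bar>xc v\<bar>" "\<bar>zc v\<bar> \<le> \<theta> * \<bar>xc v\<bar>" by linarith+
qed

lemma cone_sI:
  assumes "vert v < \<theta> * \<bar>xc v\<bar>"
  shows "v \<in> cone_s \<theta>"
proof -
  have "sqrt ((yc v)\<^sup>2 + (zc v)\<^sup>2) \<le> vert v"
    unfolding vert_def by (rule sqrt_sum_squares_le_sum_abs)
  then show ?thesis using assms by (cases v; cases "snd v") (auto simp: cone_s_def)
qed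

lemma near_step_cone_s:
  assumes "near_step \<xi> m v v'" "4 \<le> \<bar>m\<bar>" "\<bar>m\<bar> \<le> 8" "(59/50) < \<xi>" "\<xi> < (119/100)"
  shows "v' \<in> cone_s (1/20) \<Longrightarrow> v \<in> cone_s (1/20)"
    and "v \<in> cone_s (1/20) \<Longrightarrow> norm v' \<le> inverse (101/100) * norm v"
proof -
  assume *: "v' \<in> cone_s (1/20)"
  then have "0 < \<bar>xc v'\<bar>"
  proof -
    have "0 \<le> sqrt ((yc v')\<^sup>2 + (zc v')\<^sup>2)" by simp
    also have "\<dots> < 1/20 * \<bar>xc v'\<bar>" using * by (auto simp: cone_s_def)
    finally show ?thesis by simp
  qed
  have "vert v' \<le> \<bar>xc v'\<bar> / 9"
  proof -
    have "\<bar>yc v'\<bar> \<le> t \<Longrightarrow> \<bar>zc v'\<bar> \<le> t \<Longrightarrow> vert v' \<le> 2 * t" for t by (simp add: vert_def)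
    from this[OF cone_s_bounds[OF *]] \<open>0 < \<bar>xc v'\<bar>\<close> show ?thesis by linarith
  qed
  then have flat: "vert v \<le> \<bar>xc v\<bar> / 1000" by (rule vert_le_if_image_flat[OF assms])
  have "xc v \<noteq> 0"
  proof
    assume "xc v = 0"
    moreover have "\<bar>xc v\<bar> = 0 \<and> \<bar>yc v\<bar> + \<bar>zc v\<bar> \<le> 0 \<longrightarrow> \<bar>xc v'\<bar> \<le> 0"
    by (rule near_step_cases[OF assms(1-5), where \<Phi> =
          "\<lambda>a b c a' b' c'. a = 0 \<and> b + c \<le> 0 \<longrightarrow> a' \<le> 0"]) ((unfold distrib_left)?, safe; linarith)
    moreover have "\<bar>yc v\<bar> + \<bar>zc v\<bar> \<le> 0" using flat \<open>xc v = 0\<close> unfolding vert_def by simp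
    ultimately have "\<bar>xc v'\<bar> \<le> 0" by simp
    with \<open>0 < \<bar>xc v'\<bar>\<close> show False by simp
  qed
  then have "0 < \<bar>xc v\<bar>" by simp
  with flat have "vert v < 1/20 * \<bar>xc v\<bar>" by linarith
  then show "v \<in> cone_s (1/20)" by (rule cone_sI)
next
  assume "v \<in> cone_s (1/20)"
  then have "l1 v' \<le> 3/4 * \<bar>xc v\<bar>"
    using near_step_contracts[OF assms] cone_s_bounds[OF \<open>v \<in> _\<close>] by simp
  then show "norm v' \<le> inverse (101/100) * norm v"
    using norm_le_l1[of v'] comp_le_norm(1)[of v] by simp
qed

text \<open>In the image, \<open>\<bar>x'\<bar> \<approx> \<bar>y\<bar>\<close> and \<open>\<bar>z'\<bar> \<le> (1 + 1.19 \<theta>) \<bar>y\<bar>\<close> compete with \<open>\<theta> \<bar>y'\<bar> \<ge> 4 \<theta> \<bar>y\<bar>\<close>. This forces an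
  aperture \<open>\<theta>\<close> not much smaller than \<open>1/2\<close>.\<close>

lemma near_step_cone_uu:
  assumes "near_step \<xi> m v v'" "4 \<le> \<bar>m\<bar>" "\<bar>m\<bar> \<le> 8" "(59/50) < \<xi>" "\<xi> < (119/100)"
    and "v \<in> cone_uu (1/2)"
  shows "v' \<in> cone_uu (1/2)"
proof -
  have c: "sqrt ((xc v)\<^sup>2 + (zc v)\<^sup>2) < 1/2 * \<bar>yc v\<bar>" using assms(6) by (auto simp: cone_uu_def)
  moreover have "\<bar>xc v\<bar> \<le> sqrt ((xc v)\<^sup>2 + (zc v)\<^sup>2)" "\<bar>zc v\<bar> \<le> sqrt ((xc v)\<^sup>2 + (zc v)\<^sup>2)"
    by (auto intro!: real_le_rsqrt)
  moreover have "0 \<le> sqrt ((xc v)\<^sup>2 + (zc v)\<^sup>2)" by simp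
  ultimately have h: "\<bar>xc v\<bar> < 1/2 * \<bar>yc v\<bar>" "\<bar>zc v\<bar> < 1/2 * \<bar>yc v\<bar>" "0 < \<bar>yc v\<bar>" by linarith+
  have "\<bar>xc v\<bar> < 1/2 * \<bar>yc v\<bar> \<and> \<bar>zc v\<bar> < 1/2 * \<bar>yc v\<bar> \<longrightarrow>
    \<bar>xc v'\<bar> \<le> (11/10) * \<bar>yc v\<bar> \<and> \<bar>zc v'\<bar> \<le> (8/5) * \<bar>yc v\<bar> \<and> (39/10) * \<bar>yc v\<bar> \<le> \<bar>yc v'\<bar>"
    by (rule near_step_cases[OF assms(1-5), where \<Phi> =
          "\<lambda>a b c a' b' c'. a < 1/2 * b \<and> c < 1/2 * b \<longrightarrow> a' \<le> (11/10) * b \<and> c' \<le> (8/5) * b \<and> (39/10) * b \<le> b'"]) ((unfold distrib_left)?, safe; linarith)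
  then have b: "\<bar>xc v'\<bar> \<le> (11/10) * \<bar>yc v\<bar>" "\<bar>zc v'\<bar> \<le> (8/5) * \<bar>yc v\<bar>"
      "(39/10) * \<bar>yc v\<bar> \<le> \<bar>yc v'\<bar>" "0 < \<bar>yc v\<bar>"
    using h by blast+
  have "(xc v')\<^sup>2 \<le> ((11/10) * \<bar>yc v\<bar>)\<^sup>2" "(zc v')\<^sup>2 \<le> ((8/5) * \<bar>yc v\<bar>)\<^sup>2"
    "((39/10) * \<bar>yc v\<bar>)\<^sup>2 \<le> (yc v')\<^sup>2"
    using b by (auto simp: abs_le_square_iff[symmetric])
  then have "(xc v')\<^sup>2 \<le> (121/100) * (yc v)\<^sup>2" "(zc v')\<^sup>2 \<le> (64/25) * (yc v)\<^sup>2"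
    "(1521/100) * (yc v)\<^sup>2 \<le> (yc v')\<^sup>2"
    using zero_le_power2[of "yc v"] by (simp_all add: power_mult_distrib power_divide)
  moreover have "0 < (yc v)\<^sup>2" using b by auto
  ultimately have "(xc v')\<^sup>2 + (zc v')\<^sup>2 < 1/4 * (yc v')\<^sup>2"
    by linarith
  then have "(xc v')\<^sup>2 + (zc v')\<^sup>2 < (1/2 * \<bar>yc v'\<bar>)\<^sup>2"
    by (simp add: power_mult_distrib power_divide)
  then have "sqrt ((xc v')\<^sup>2 + (zc v')\<^sup>2) < 1/2 * \<bar>yc v'\<bar>"
    by (intro real_less_lsqrt) auto
  then show ?thesis by (cases v'; cases "snd v'") (auto simp: cone_uu_def)
qed

text \<open>In terms of \<open>r\<^sup>2 = y\<^sup>2 + z\<^sup>2\<close> the image has \<open>y'\<^sup>2 + z'\<^sup>2 \<ge> 16 y\<^sup>2 + (max 0 (1.18 \<bar>z\<bar> - \<bar>y\<bar>))\<^sup>2\<close> up to the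
  errors; this is at least \<open>1.28 r\<^sup>2\<close>, and the cone condition bounds \<open>x\<^sup>2 + y\<^sup>2 + z\<^sup>2\<close> by \<open>1.25 r\<^sup>2\<close>. The expansion factor
  \<open>c = 1.01\<close> fits because \<open>1.01\<^sup>2 * 1.25 < 1.28\<close>. This is what prevents a larger aperture.\<close>

lemma near_step_cone_u:
  assumes "near_step \<xi> m v v'" "4 \<le> \<bar>m\<bar>" "\<bar>m\<bar> \<le> 8" "(59/50) < \<xi>" "\<xi> < (119/100)"
    and "v \<in> cone_u (1/2)"
  shows "v' \<in> cone_u (1/2)" "(101/100) * norm v \<le> norm v'"
proof -
  define a b r where "a = \<bar>yc v\<bar>" and "b = \<bar>zc v\<bar>" and "r = sqrt (a\<^sup>2 + b\<^sup>2)"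
  have c: "\<bar>xc v\<bar> < 1/2 * r" using assms(6) by (auto simp: cone_u_def r_def a_def b_def)
  have ab: "0 \<le> a" "0 \<le> b" "a \<le> r" "b \<le> r"
    by (auto simp: a_def b_def r_def intro!: real_le_rsqrt)
  have r2: "r\<^sup>2 = a\<^sup>2 + b\<^sup>2" by (simp add: r_def)
  have r: "0 < r" using c by linarith
  have t: "tol * l1 v \<le> 3 * tol * r"
    using ab c by (simp add: l1_def flip: a_def b_def)
  have st: "\<bar>xc v'\<bar> \<le> a + 3 * tol * r" "4 * a - 3 * tol * r \<le> \<bar>yc v'\<bar>"
    "(59/50) * b - a - 3 * tol * r \<le> \<bar>zc v'\<bar>"
    using near_step_bounds[OF assms(1-5)] t by (simp_all flip: a_def b_def)
  have asq: "(a + 3 * tol * r)\<^sup>2 \<le> a\<^sup>2 + (1/1000) * r\<^sup>2"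
  proof -
    have "(a + 3 * tol * r)\<^sup>2 = a\<^sup>2 + (6/10000) * (a * r) + (9/100000000) * r\<^sup>2"
      by (simp add: power2_eq_square field_simps)
    moreover have "a * r \<le> r\<^sup>2" using ab r by (auto simp: power2_eq_square intro: mult_right_mono)
    ultimately show ?thesis using zero_le_power2[of r] by linarith
  qed
  have y2: "16 * a\<^sup>2 - (3/1250) * r\<^sup>2 \<le> (yc v')\<^sup>2"
  proof (cases "4 * a - 3 * tol * r \<ge> 0")
    case True
    then have "(4 * a - 3 * tol * r)\<^sup>2 \<le> (yc v')\<^sup>2" using st by (auto simp: abs_le_square_iff[symmetric])
    moreover have "(4 * a - 3 * tol * r)\<^sup>2 \<ge> 16 * a\<^sup>2 - (3/1250) * (a * r)"
      by (simp add: power2_eq_square algebra_simps)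
    moreover have "a * r \<le> r\<^sup>2" using ab r by (auto simp: power2_eq_square intro: mult_right_mono)
    ultimately show ?thesis by linarith
  next
    case False
    then have "4 * a \<le> 3 * tol * r" by linarith
    then have "(4*a) * a \<le> (3 * tol * r) * r"
      by (rule mult_mono) (use ab r in simp_all)
    then have "16 * a\<^sup>2 \<le> 12 * tol * r\<^sup>2" by (simp add: power2_eq_square)
    moreover have "0 \<le> r\<^sup>2" "0 \<le> (yc v')\<^sup>2" by auto
    ultimately show ?thesis by linarith
  qed
  have z2: "(3481/2500) * b\<^sup>2 - (59/25) * (a * b) + a\<^sup>2 - (3/2000) * r\<^sup>2 \<le> (zc v')\<^sup>2 \<or> 7 * r\<^sup>2 \<le> (yc v')\<^sup>2"
  proof (cases "(59/50) * b - a - 3 * tol * r \<ge> 0")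
    case True
    then have "((59/50) * b - a - 3 * tol * r)\<^sup>2 \<le> (zc v')\<^sup>2" using st by (auto simp: abs_le_square_iff[symmetric])
    moreover have "((59/50) * b - a - 3 * tol * r)\<^sup>2 \<ge> (3481/2500) * b\<^sup>2 - (59/25) * (a * b) + a\<^sup>2 - (177/250000) * (b * r)"
    proof -
      have "((59/50) * b - a - 3 * tol * r)\<^sup>2 = (3481/2500) * b\<^sup>2 - (59/25) * (a * b) + a\<^sup>2 - (177/250000) * (b * r)
        + (6 * tol * (a * r) + (3 * tol * r)\<^sup>2)"
        by (simp add: power2_eq_square field_simps)
      moreover have "0 \<le> a * r" using ab r by simp
      ultimately show ?thesis using zero_le_power2[of "3 * tol * r"] by linarith
    qed
    moreover have "b * r \<le> r\<^sup>2" using ab r by (auto simp: power2_eq_square intro: mult_right_mono)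
    ultimately have "(3481/2500) * b\<^sup>2 - (59/25) * (a * b) + a\<^sup>2 - (3/2000) * r\<^sup>2 \<le> (zc v')\<^sup>2"
      using zero_le_power2[of r] by linarith
    then show ?thesis by blast
  next
    case False
    then have "(59/50) * b \<le> a + 3 * tol * r" by simp
    then have "((59/50) * b)\<^sup>2 \<le> (a + 3 * tol * r)\<^sup>2" using ab r by (intro power_mono) auto
    moreover have "(a + 3 * tol * r)\<^sup>2 \<le> a\<^sup>2 + (1/1000) * r\<^sup>2" by (rule asq)
    ultimately have "(3481/2500) * b\<^sup>2 \<le> a\<^sup>2 + (1/1000) * r\<^sup>2" by (simp add: power2_eq_square)
    then have "(71/10) * r\<^sup>2 \<le> 16 * a\<^sup>2"
      using r2 zero_le_power2[of a] zero_le_power2[of b] by linarith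
    then have "7 * r\<^sup>2 \<le> (yc v')\<^sup>2" using y2 zero_le_power2[of r] by linarith
    then show ?thesis by simp
  qed
  have ab2: "(59/25) * (a * b) \<le> 14 * a\<^sup>2 + (1/10) * b\<^sup>2"
  proof -
    have "0 \<le> ((59/5) * a - b)\<^sup>2" by simp
    then have "(118/5) * (a*b) \<le> (3481/25) * a\<^sup>2 + b\<^sup>2" by (simp add: power2_eq_square algebra_simps)
    then show ?thesis using zero_le_power2[of a] by linarith
  qed
  have "(32/25) * r\<^sup>2 \<le> (yc v')\<^sup>2 + (zc v')\<^sup>2"
  proof (cases "7 * r\<^sup>2 \<le> (yc v')\<^sup>2")
    case True then show ?thesis using zero_le_power2[of r] zero_le_power2[of "zc v'"] by linarith
  next
    case False
    then have "(3481/2500) * b\<^sup>2 - (59/25) * (a * b) + a\<^sup>2 - (3/2000) * r\<^sup>2 \<le> (zc v')\<^sup>2" using z2 by blast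
    then show ?thesis using y2 ab2 r2 zero_le_power2[of a] zero_le_power2[of b] by linarith
  qed
  moreover have "(xc v)\<^sup>2 \<le> 1/4 * r\<^sup>2"
  proof -
    have "(xc v)\<^sup>2 \<le> (1/2*r)\<^sup>2" using c r by (auto simp: abs_le_square_iff[symmetric])
    then show ?thesis by (simp add: power_divide)
  qed
  moreover have "((101/100) * norm v)\<^sup>2 = (10201/10000) * (xc v)\<^sup>2 + (10201/10000) * r\<^sup>2"
    unfolding norm_r3 r2 a_def b_def power_mult_distrib by (simp add: power_divide distrib_left)
  moreover have "(norm v')\<^sup>2 = (xc v')\<^sup>2 + (yc v')\<^sup>2 + (zc v')\<^sup>2" unfolding norm_r3 by simp
  ultimately have "((101/100) * norm v)\<^sup>2 \<le> (norm v')\<^sup>2"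
    using zero_le_power2[of "xc v'"] zero_le_power2[of r] by linarith
  then show "(101/100) * norm v \<le> norm v'" by (rule power2_le_imp_le) simp
  have "(xc v')\<^sup>2 < 1/4 * (yc v')\<^sup>2 + 1/4 * (zc v')\<^sup>2"
  proof -
    have "(xc v')\<^sup>2 \<le> (a + 3 * tol * r)\<^sup>2" using st ab r by (auto simp: abs_le_square_iff[symmetric])
    also have "\<dots> \<le> a\<^sup>2 + (1/1000) * r\<^sup>2" by (rule asq)
    finally have x2: "(xc v')\<^sup>2 \<le> a\<^sup>2 + (1/1000) * r\<^sup>2" .
    have rp: "0 < r\<^sup>2" using r by simp
    show ?thesis
    proof (cases "7 * r\<^sup>2 \<le> (yc v')\<^sup>2")
      case True
      moreover have "a\<^sup>2 \<le> r\<^sup>2" using r2 by simp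
      ultimately show ?thesis using x2 zero_le_power2[of "zc v'"] rp by linarith
    next
      case False
      then have "(3481/2500) * b\<^sup>2 - (59/25) * (a * b) + a\<^sup>2 - (3/2000) * r\<^sup>2 \<le> (zc v')\<^sup>2" using z2 by blast
      moreover have "(59/25) * (a * b) \<le> 12 * a\<^sup>2 + (1/5) * b\<^sup>2"
      proof -
        have "0 \<le> ((59/10) * a - b)\<^sup>2" by simp
        then have "(59/5) * (a*b) \<le> (3481/100) * a\<^sup>2 + b\<^sup>2" by (simp add: power2_eq_square algebra_simps)
        then show ?thesis using zero_le_power2[of a] by linarith
      qed
      ultimately show ?thesis using y2 x2 r2 rp zero_le_power2[of a] zero_le_power2[of b] by linarith
    qed
  qed
  then have "\<bar>xc v'\<bar> < sqrt (1/4 * ((yc v')\<^sup>2 + (zc v')\<^sup>2))"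
    by (intro real_less_rsqrt) simp
  also have "\<dots> = 1/2 * sqrt ((yc v')\<^sup>2 + (zc v')\<^sup>2)"
    by (simp add: real_sqrt_divide)
  finally show "v' \<in> cone_u (1/2)" by (cases v'; cases "snd v'") (auto simp: cone_u_def)
qed

section \<open>Perturbations of the model map on the cube\<close>

abbreviation \<Delta> :: "r3 set" where "\<Delta> \<equiv> Delta henon_cube"

lemma henon_cube_intervals:
  "Ix henon_cube = {-4..4}" "Iy henon_cube = {-4..4}" "Iz henon_cube = {-40..22}"
  by (auto simp: Ix_def Iy_def Iz_def henon_cube_def)

lemma Delta_iff:
  "p \<in> \<Delta> \<longleftrightarrow> -4 \<le> xc p \<and> xc p \<le> 4 \<and> -4 \<le> yc p \<and> yc p \<le> 4 \<and> -40 \<le> zc p \<and> zc p \<le> 22"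
  by (cases p; cases "snd p") (auto simp: Delta_def henon_cube_intervals)

lemma Delta_cbox: "\<Delta> = cbox (-4, -4, -40) (4, 4, 22)"
  by (simp add: Delta_def henon_cube_intervals cbox_Pair_eq)

lemma convex_Delta: "convex \<Delta>" and compact_Delta: "compact \<Delta>"
  unfolding Delta_cbox by auto

lemma interior_Delta:
  "p \<in> interior \<Delta> \<longleftrightarrow> -4 < xc p \<and> xc p < 4 \<and> -4 < yc p \<and> yc p < 4 \<and> -40 < zc p \<and> zc p < 22"
  by (cases p; cases "snd p") (auto simp: Delta_def henon_cube_intervals interior_Times)

lemma DF_unique:
  assumes "p \<in> \<Delta>" "(F has_derivative D) (at p within \<Delta>)"
  shows "DF henon_cube F p = D"
proof -
  have "F differentiable (at p within \<Delta>)" using assms(2) by (auto simp: differentiable_def)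
  then have "(F has_derivative DF henon_cube F p) (at p within \<Delta>)"
    unfolding DF_def by (simp add: frechet_derivative_works)
  then show ?thesis
    using assms unfolding Delta_cbox
    by (rule_tac frechet_derivative_unique_within_closed_interval
          [of "(-4, -4, -40) :: r3" "(4, 4, 22) :: r3" p F])
       (auto simp: Basis_prod_def)
qed

lemma henon_cu_coords:
  "henon_cu \<xi> \<mu> \<kappa> \<eta> p =
     (yc p, \<mu> + (yc p)\<^sup>2 + \<kappa> * yc p * zc p + \<eta> * (zc p)\<^sup>2, \<xi> * zc p + yc p)"
  by (cases p; cases "snd p") (simp add: henon_cu_def)

lemma henon_cu_has_derivative:
  "(henon_cu \<xi> \<mu> \<kappa> \<eta> has_derivative
     (\<lambda>v. (yc v, 2 * yc p * yc v + \<kappa> * (yc v * zc p + yc p * zc v) + 2 * \<eta> * zc p * zc v,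
           \<xi> * zc v + yc v))) (at p within S)"
  unfolding henon_cu_coords[abs_def]
  by (auto intro!: derivative_eq_intros simp: algebra_simps)

lemma DF_henon:
  assumes "p \<in> \<Delta>"
  shows "DF henon_cube (henon_cu \<xi> \<mu> \<kappa> \<eta>) p =
     (\<lambda>v. (yc v, 2 * yc p * yc v + \<kappa> * (yc v * zc p + yc p * zc v) + 2 * \<eta> * zc p * zc v,
           \<xi> * zc v + yc v))"
  using DF_unique[OF assms henon_cu_has_derivative] .

text \<open>The curves \<open>x \<mapsto> (x, Y x, Z x)\<close> among which the local stable curves are found. The slope \<open>1/100\<close> is
  well below the aperture \<open>1/20\<close> of the stable cone, so the tangents will lie in the open cone.\<close>

definition s_graph :: "(real \<Rightarrow> real) \<Rightarrow> (real \<Rightarrow> real) \<Rightarrow> bool" where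
  "s_graph Y Z \<longleftrightarrow>
     (\<forall>a\<in>{-4..4}. Y a \<in> {-4..4} \<and> Z a \<in> {-40..22}) \<and>
     (\<forall>a\<in>{-4..4}. \<forall>b\<in>{-4..4}. \<bar>Y a - Y b\<bar> + \<bar>Z a - Z b\<bar> \<le> \<bar>a - b\<bar> / 100)"

lemma s_graphD:
  assumes "s_graph Y Z" "a \<in> {-4..4}"
  shows "Y a \<in> {-4..4}" "Z a \<in> {-40..22}"
    "b \<in> {-4..4} \<Longrightarrow> \<bar>Y a - Y b\<bar> + \<bar>Z a - Z b\<bar> \<le> \<bar>a - b\<bar> / 100"
    "b \<in> {-4..4} \<Longrightarrow> \<bar>Y a - Y b\<bar> \<le> \<bar>a - b\<bar> / 100"
    "b \<in> {-4..4} \<Longrightarrow> \<bar>Z a - Z b\<bar> \<le> \<bar>a - b\<bar> / 100"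
proof -
  show "Y a \<in> {-4..4}" "Z a \<in> {-40..22}" using assms unfolding s_graph_def by blast+
  assume b: "b \<in> {-4..4}"
  show 1: "\<bar>Y a - Y b\<bar> + \<bar>Z a - Z b\<bar> \<le> \<bar>a - b\<bar> / 100"
    using assms b unfolding s_graph_def by blast
  show "\<bar>Y a - Y b\<bar> \<le> \<bar>a - b\<bar> / 100" "\<bar>Z a - Z b\<bar> \<le> \<bar>a - b\<bar> / 100"
    using 1 abs_ge_zero[of "Y a - Y b"] abs_ge_zero[of "Z a - Z b"] by (metis add_increasing add_increasing2 order_trans le_add_same_cancel1 le_add_same_cancel2)+
qed

lemma continuous_on_if_lipschitz:
  fixes f :: "real \<Rightarrow> real"
  assumes "\<And>a b. a \<in> S \<Longrightarrow> b \<in> S \<Longrightarrow> \<bar>f a - f b\<bar> \<le> \<bar>a - b\<bar> / 100"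
  shows "continuous_on S f"
proof -
  have "(1/100)-lipschitz_on S f"
    using assms by (auto simp: lipschitz_on_def dist_real_def)
  then show ?thesis by (rule lipschitz_on_continuous_on)
qed

lemma s_graph_continuous:
  assumes "s_graph Y Z"
  shows "continuous_on {-4..4} Y" "continuous_on {-4..4} Z"
  using s_graphD(4,5)[OF assms] by (auto intro!: continuous_on_if_lipschitz)

text \<open>The maps for which all conditions will be verified: \<open>C\<^sup>1\<close>-perturbations of the member
  \<open>\<kappa> = \<eta> = 0\<close> of the family.\<close>

locale near_henon =
  fixes F :: "r3 \<Rightarrow> r3" and \<xi> \<mu> :: real
  assumes C1: "C1_on \<Delta> F"
    and \<xi>: "59/50 < \<xi>" "\<xi> < 119/100"
    and \<mu>: "-10 < \<mu>" "\<mu> < -9"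
    and close0: "\<And>p. p \<in> \<Delta> \<Longrightarrow> norm (F p - henon_cu \<xi> \<mu> 0 0 p) \<le> tol"
    and close1: "\<And>p v. p \<in> \<Delta> \<Longrightarrow>
      norm (DF henon_cube F p v - DF henon_cube (henon_cu \<xi> \<mu> 0 0) p v) \<le> tol * norm v"
begin

lemma DF_blinfun:
  obtains D :: "r3 \<Rightarrow> r3 \<Rightarrow>\<^sub>L r3" where "continuous_on \<Delta> D"
    "\<And>p. p \<in> \<Delta> \<Longrightarrow> DF henon_cube F p = blinfun_apply (D p)"
  using C1 DF_unique unfolding C1_on_def by metis

lemma has_DF:
  assumes "p \<in> \<Delta>"
  shows "(F has_derivative DF henon_cube F p) (at p within \<Delta>)"
  using C1 DF_unique[OF assms] assms unfolding C1_on_def by metis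

lemma continuous_F: "continuous_on \<Delta> F"
  using has_DF by (rule has_derivative_continuous_on)

lemma F_approx:
  assumes "p \<in> \<Delta>"
  shows "\<bar>xc (F p) - yc p\<bar> \<le> tol" "\<bar>yc (F p) - (\<mu> + (yc p)\<^sup>2)\<bar> \<le> tol"
    "\<bar>zc (F p) - (\<xi> * zc p + yc p)\<bar> \<le> tol"
proof -
  have "F p - henon_cu \<xi> \<mu> 0 0 p =
     (xc (F p) - yc p, yc (F p) - (\<mu> + (yc p)\<^sup>2), zc (F p) - (\<xi> * zc p + yc p))"
    unfolding henon_cu_coords by (simp add: prod_eq_iff)
  then show "\<bar>xc (F p) - yc p\<bar> \<le> tol" "\<bar>yc (F p) - (\<mu> + (yc p)\<^sup>2)\<bar> \<le> tol"
    "\<bar>zc (F p) - (\<xi> * zc p + yc p)\<bar> \<le> tol"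
    using close0[OF assms] comp_le_norm[of "F p - henon_cu \<xi> \<mu> 0 0 p"] by auto
qed

lemma F_approx_bounds:
  assumes "p \<in> \<Delta>"
  shows "yc p - tol \<le> xc (F p)" "xc (F p) \<le> yc p + tol"
    "\<mu> + (yc p)\<^sup>2 - tol \<le> yc (F p)" "yc (F p) \<le> \<mu> + (yc p)\<^sup>2 + tol"
    "\<xi> * zc p + yc p - tol \<le> zc (F p)" "zc (F p) \<le> \<xi> * zc p + yc p + tol"
  using F_approx[OF assms] by linarith+

lemma near_step_of_norm:
  assumes "norm (v' - (yc v, m * yc v, \<xi> * zc v + yc v)) \<le> tol * norm v"
  shows "near_step \<xi> m v v'"
proof -
  have "tol * norm v \<le> tol * l1 v" using norm_le_l1[of v] by simp
  then show ?thesis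
    using assms comp_le_norm[of "v' - (yc v, m * yc v, \<xi> * zc v + yc v)"]
    unfolding near_step_def by auto
qed

lemma DF_near_step:
  assumes "p \<in> \<Delta>"
  shows "near_step \<xi> (2 * yc p) v (DF henon_cube F p v)"
  using close1[OF assms, of v] by (intro near_step_of_norm) (simp add: DF_henon[OF assms])

text \<open>The mean value inequality for \<open>F - H\<close> on the convex cube; the differences of \<open>H\<close> are computed exactly.\<close>

lemma difference_near_step:
  assumes "p \<in> \<Delta>" "q \<in> \<Delta>"
  shows "near_step \<xi> (yc p + yc q) (p - q) (F p - F q)"
proof (rule near_step_of_norm)
  let ?H = "henon_cu \<xi> \<mu> 0 0"
  have "norm ((F p - ?H p) - (F q - ?H q)) \<le> tol * norm (p - q)"
  proof (rule differentiable_bound[OF convex_Delta _ _ assms])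
    fix x assume x: "x \<in> \<Delta>"
    have "(?H has_derivative DF henon_cube ?H x) (at x within \<Delta>)"
      using henon_cu_has_derivative unfolding DF_henon[OF x] .
    then show "((\<lambda>x. F x - ?H x) has_derivative
        (\<lambda>v. DF henon_cube F x v - DF henon_cube ?H x v)) (at x within \<Delta>)"
      using has_DF[OF x] by (intro has_derivative_diff)
    show "onorm (\<lambda>v. DF henon_cube F x v - DF henon_cube ?H x v) \<le> tol"
      using close1[OF x] by (intro onorm_le)
  qed
  moreover have "(F p - ?H p) - (F q - ?H q) =
      F p - F q - (yc (p - q), (yc p + yc q) * yc (p - q), \<xi> * zc (p - q) + yc (p - q))"
    unfolding henon_cu_coords by (simp add: prod_eq_iff power2_eq_square algebra_simps)
  ultimately show "norm (F p - F q - (yc (p - q), (yc p + yc q) * yc (p - q), \<xi> * zc (p - q) + yc (p - q)))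
      \<le> tol * norm (p - q)" by simp
qed

definition band :: "real \<Rightarrow> r3 set" where
  "band s = {p \<in> \<Delta>. 2 \<le> s * yc p}"

lemma band_slope:
  assumes "s = 1 \<or> s = -1" "p \<in> band s" "q \<in> band s"
  shows "4 \<le> \<bar>yc p + yc q\<bar>" "\<bar>yc p + yc q\<bar> \<le> 8"
  using assms by (auto simp: band_def Delta_iff)

lemma band_DeltaD: "p \<in> band s \<Longrightarrow> p \<in> \<Delta>"
  by (simp add: band_def)

lemma band_difference_grows:
  assumes "s = 1 \<or> s = -1" "p \<in> band s" "q \<in> band s" "\<bar>xc (p - q)\<bar> \<le> 100 * vert (p - q)"
  shows "(11/10) * vert (p - q) \<le> vert (F p - F q)" "\<bar>xc (F p - F q)\<bar> \<le> 2 * vert (p - q)"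
  using vert_grows[OF difference_near_step band_slope \<xi>] assms band_DeltaD by auto

text \<open>For \<open>s = -1\<close> and \<open>s = 1\<close> these are the sets \<open>\<A>\<close> and \<open>\<B>\<close> of (BH1). The sign \<open>s\<close> is carried
  along so that both are treated at once.\<close>

definition branch :: "real \<Rightarrow> r3 set" where
  "branch s = {p \<in> \<Delta>. 0 < s * yc p \<and> yc (F p) \<in> {-4..4}}"

text \<open>The condition says that \<open>\<mu> + y\<^sup>2\<close> lies within \<open>tol\<close> of \<open>[-4, 4]\<close>, so \<open>y\<^sup>2\<close> is between \<open>4.84 = 2.2\<^sup>2\<close> and
  \<open>225/16 = 3.75\<^sup>2\<close>.\<close>

lemma branch_bounds:
  assumes "s = 1 \<or> s = -1" "p \<in> branch s"
  shows "22/10 < s * yc p" "s * yc p < 15/4"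
proof -
  have p: "p \<in> \<Delta>" "0 < s * yc p" "-4 \<le> yc (F p)" "yc (F p) \<le> 4" using assms by (auto simp: branch_def)
  have sq: "(yc p)\<^sup>2 = (s * yc p)\<^sup>2" using assms(1) by (auto simp: power_mult_distrib)
  have *: "484/100 < (s * yc p)\<^sup>2" "(s * yc p)\<^sup>2 < 225/16"
    using F_approx_bounds(3,4)[OF p(1)] p(3,4) \<mu> unfolding sq power_divide by linarith+
  show "22/10 < s * yc p" by (rule power2_less_imp_less[of "22/10"]) (use * p(2) in \<open>simp_all add: power_divide\<close>)
  show "s * yc p < 15/4" by (rule power2_less_imp_less) (use * in \<open>simp_all add: power_divide\<close>)
qed

lemma branch_band:
  assumes "s = 1 \<or> s = -1"
  shows "branch s \<subseteq> band s"
  using branch_bounds[OF assms] by (fastforce simp: band_def branch_def)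

text \<open>The intermediate value theorem in \<open>y\<close>: the second coordinate of the image is below \<open>-4\<close> at
  \<open>\<bar>y\<bar> = 2\<close> and above \<open>4\<close> at \<open>\<bar>y\<bar> = 3.9\<close>, and up to \<open>3.9\<close> the first coordinate of the image, which is
  close to \<open>y\<close>, stays in the domain of \<open>Y\<close>.\<close>

lemma preimage_of_wall_in_column:
  assumes s: "s = 1 \<or> s = -1" and g: "s_graph Y Z" and x: "x \<in> {-4..4}" and z: "z \<in> {-40..22}"
  obtains y where "2 \<le> y" "y \<le> 39/10" "(x, s * y, z) \<in> \<Delta>" "xc (F (x, s * y, z)) \<in> {-4..4}"
    "yc (F (x, s * y, z)) = Y (xc (F (x, s * y, z)))"
proof -
  let ?p = "\<lambda>y. (x, s * y, z) :: r3"
  have D: "?p y \<in> \<Delta>" if "y \<in> {2..39/10}" for y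
    using that s x z by (auto simp: Delta_iff)
  have X: "xc (F (?p y)) \<in> {-4..4}" if "y \<in> {2..39/10}" for y
    using F_approx_bounds(1,2)[OF D[OF that]] s that by auto
  have "continuous_on {2..39/10} (\<lambda>y. F (?p y))"
    by (rule continuous_on_compose2[OF continuous_F]) (use D in \<open>auto intro!: continuous_intros\<close>)
  moreover from this have "continuous_on {2..39/10} (\<lambda>y. Y (xc (F (?p y))))"
    using X by (intro continuous_on_compose2[OF s_graph_continuous(1)[OF g]]) (auto intro!: continuous_intros)
  ultimately have c: "continuous_on {2..39/10} (\<lambda>y. yc (F (?p y)) - Y (xc (F (?p y))))"
    by (intro continuous_intros)
  have sq: "(s * y)\<^sup>2 = y\<^sup>2" for y using s by (auto simp: power_mult_distrib)
  have "yc (F (?p 2)) \<le> -4"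
    using F_approx_bounds(4)[OF D[of 2]] \<mu> unfolding fst_conv snd_conv sq by simp
  then have lo: "yc (F (?p 2)) - Y (xc (F (?p 2))) \<le> 0"
    using s_graphD(1)[OF g X[of 2]] by simp
  have "4 \<le> yc (F (?p (39/10)))"
    using F_approx_bounds(3)[OF D[of "39/10"]] \<mu> unfolding fst_conv snd_conv sq by (simp add: power_divide)
  then have hi: "0 \<le> yc (F (?p (39/10))) - Y (xc (F (?p (39/10))))"
    using s_graphD(1)[OF g X[of "39/10"]] by simp
  obtain y where "2 \<le> y" "y \<le> 39/10" "yc (F (?p y)) - Y (xc (F (?p y))) = 0"
    using IVT'[of "\<lambda>y. yc (F (?p y)) - Y (xc (F (?p y)))" 2 0 "39/10", OF lo hi _ c] by auto
  then show thesis using that[of y] D[of y] X[of y] by auto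
qed

text \<open>Within a column \<open>x = const\<close>, the points mapped to a wall \<open>y = Y x\<close> form a nearly vertical curve,
  because \<open>y\<close> is expanded by \<open>4\<close> while the wall is nearly orthogonal to the \<open>y\<close>-axis. Along it \<open>F\<close> just
  multiplies \<open>z\<close>-distances by \<open>\<xi>\<close>. This is used to construct the stable curves and, later, to
  compare heights over them.\<close>

lemma wall_preimage_nearly_vertical:
  assumes s: "s = 1 \<or> s = -1" and g: "s_graph Y Z" and pq: "p \<in> band s" "q \<in> band s"
    and x: "xc p = xc q" "xc (F p) \<in> {-4..4}" "xc (F q) \<in> {-4..4}"
    and w: "yc (F p) = Y (xc (F p))" "yc (F q) = Y (xc (F q))"
  shows "\<bar>yc p - yc q\<bar> \<le> \<bar>zc p - zc q\<bar> / 1000"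
    "\<bar>xc (F p) - xc (F q)\<bar> \<le> \<bar>zc p - zc q\<bar> / 500"
    "\<bar>zc (F p) - zc (F q) - \<xi> * (zc p - zc q)\<bar> \<le> \<bar>zc p - zc q\<bar> / 500"
proof -
  note st = difference_near_step[OF band_DeltaD[OF pq(1)] band_DeltaD[OF pq(2)]]
  have Y: "\<bar>yc (F p) - yc (F q)\<bar> \<le> \<bar>xc (F p) - xc (F q)\<bar> / 100"
    unfolding w by (rule s_graphD(4)[OF g x(2,3)])
  have "\<bar>xc (p - q)\<bar> = 0 \<and> 100 * \<bar>yc (F p - F q)\<bar> \<le> \<bar>xc (F p - F q)\<bar> \<longrightarrow>
      1000 * \<bar>yc (p - q)\<bar> \<le> \<bar>zc (p - q)\<bar> \<and> 500 * \<bar>xc (F p - F q)\<bar> \<le> \<bar>zc (p - q)\<bar>"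
    by (rule near_step_cases[OF st band_slope[OF s pq] \<xi>, where \<Phi> =
      "\<lambda>a b c a' b' c'. a = 0 \<and> 100 * b' \<le> a' \<longrightarrow> 1000 * b \<le> c \<and> 500 * a' \<le> c"]) (safe; linarith)
  then show 1: "\<bar>yc p - yc q\<bar> \<le> \<bar>zc p - zc q\<bar> / 1000"
    "\<bar>xc (F p) - xc (F q)\<bar> \<le> \<bar>zc p - zc q\<bar> / 500"
    using Y x(1) by simp_all
  have l: "l1 (p - q) = \<bar>yc p - yc q\<bar> + \<bar>zc p - zc q\<bar>" using x(1) by (simp add: l1_def)
  have e: "\<bar>zc (F p) - zc (F q) - (\<xi> * (zc p - zc q) + (yc p - yc q))\<bar> \<le> tol * l1 (p - q)"
    using st by (simp add: near_step_def)
  have "\<bar>zc (F p) - zc (F q) - (\<xi> * (zc p - zc q) + (yc p - yc q))\<bar> \<le> \<bar>zc p - zc q\<bar> / 1000"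
  proof -
    have "t \<le> tol * l \<Longrightarrow> l = a + b \<Longrightarrow> a \<le> b / 1000 \<Longrightarrow> 0 \<le> b \<Longrightarrow> t \<le> b / 1000" for t l a b :: real
      by linarith
    then show ?thesis using e l 1(1) abs_ge_zero[of "zc p - zc q"] by blast
  qed
  then show "\<bar>zc (F p) - zc (F q) - \<xi> * (zc p - zc q)\<bar> \<le> \<bar>zc p - zc q\<bar> / 500"
    using 1(1) by linarith
qed

text \<open>The intermediate value theorem in \<open>z\<close> along the nearly vertical preimage of the wall: because
  \<open>1.18 * 22 - 3.9 > 22\<close>, the image overshoots the \<open>z\<close>-range of the cube at both ends.\<close>

lemma preimage_of_s_graph:
  assumes s: "s = 1 \<or> s = -1" and g: "s_graph Y Z" and x: "x \<in> {-4..4}"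
  obtains p where "p \<in> branch s" "xc p = x" "xc (F p) \<in> {-4..4}"
    "yc (F p) = Y (xc (F p))" "zc (F p) = Z (xc (F p))"
proof -
  let ?ok = "\<lambda>z y. 2 \<le> y \<and> y \<le> 39/10 \<and> (x, s * y, z) \<in> \<Delta> \<and> xc (F (x, s * y, z)) \<in> {-4..4} \<and>
     yc (F (x, s * y, z)) = Y (xc (F (x, s * y, z)))"
  have "\<forall>z\<in>{-40..22}. \<exists>y. ?ok z y"
    using preimage_of_wall_in_column[OF s g x] by metis
  then obtain y where y: "\<And>z. z \<in> {-40..22} \<Longrightarrow> ?ok z (y z)" by metis
  let ?p = "\<lambda>z. (x, s * y z, z) :: r3"
  have ss: "s * (s * t) = t" for t using s by auto
  have band: "?p z \<in> band s" if "z \<in> {-40..22}" for z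
    using y[OF that] by (auto simp: band_def ss)
  note vert = wall_preimage_nearly_vertical[OF s g band band]
  have "\<bar>s * y a - s * y b\<bar> \<le> \<bar>a - b\<bar> / 100" if "a \<in> {-40..22}" "b \<in> {-40..22}" for a b
    using vert(1)[OF that] y[OF that(1)] y[OF that(2)] by (auto simp: field_simps)
  then have "continuous_on {-40..22} (\<lambda>z. s * y z)" by (rule continuous_on_if_lipschitz)
  then have "continuous_on {-40..22} (\<lambda>z. F (?p z))"
    using y by (intro continuous_on_compose2[OF continuous_F]) (auto intro!: continuous_intros)
  moreover from this have "continuous_on {-40..22} (\<lambda>z. Z (xc (F (?p z))))"
    using y by (intro continuous_on_compose2[OF s_graph_continuous(2)[OF g]]) (auto intro!: continuous_intros)
  ultimately have c: "continuous_on {-40..22} (\<lambda>z. zc (F (?p z)) - Z (xc (F (?p z))))"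
    by (intro continuous_intros)
  have y1: "\<bar>s * y z\<bar> \<le> 39/10" if "z \<in> {-40..22}" for z
    using y[OF that] s by auto
  have "zc (F (?p (-40))) \<le> -40"
  proof -
    have "s * y (-40) \<le> 39/10" using y1[of "-40"] by (simp add: abs_le_iff)
    moreover have "?p (-40) \<in> \<Delta>" using y[of "-40"] by simp
    ultimately show ?thesis using F_approx_bounds(6)[of "?p (-40)"] \<xi> by simp
  qed
  then have lo: "zc (F (?p (-40))) - Z (xc (F (?p (-40)))) \<le> 0"
    using s_graphD(2)[OF g, of "xc (F (?p (-40)))"] y[of "-40"] by auto
  have "22 \<le> zc (F (?p 22))"
  proof -
    have "- (39/10) \<le> s * y 22" using y1[of 22] by (simp add: abs_le_iff)
    moreover have "?p 22 \<in> \<Delta>" using y[of 22] by simp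
    ultimately show ?thesis using F_approx_bounds(5)[of "?p 22"] \<xi> by simp
  qed
  then have hi: "0 \<le> zc (F (?p 22)) - Z (xc (F (?p 22)))"
    using s_graphD(2)[OF g, of "xc (F (?p 22))"] y[of 22] by auto
  obtain z where z: "-40 \<le> z" "z \<le> 22" "zc (F (?p z)) - Z (xc (F (?p z))) = 0"
    using IVT'[of "\<lambda>z. zc (F (?p z)) - Z (xc (F (?p z)))" "-40" 0 22, OF lo hi _ c] by auto
  then have "?p z \<in> branch s"
    using y[of z] s_graphD(1)[OF g, of "xc (F (?p z))"] by (auto simp: branch_def ss)
  then show thesis using that[of "?p z"] y[of z] z by auto
qed

end

section \<open>Local stable curves as Lipschitz graphs\<close>

lemma r3_eqI: "xc p = xc q \<Longrightarrow> yc p = yc q \<Longrightarrow> zc p = zc q \<Longrightarrow> p = q"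
  by (simp add: prod_eq_iff)

lemma vert_nonneg: "0 \<le> vert v" by (simp add: vert_def)

context near_henon
begin

lemma in_branch_if_image_in_strip:
  assumes "p \<in> \<Delta>" "yc (F p) \<in> {-4..4}"
  shows "p \<in> branch 1 \<or> p \<in> branch (-1)"
proof -
  have "yc p \<noteq> 0" using F_approx_bounds(3,4)[OF assms(1)] assms(2) \<mu> by auto
  then show ?thesis using assms by (auto simp: branch_def)
qed

lemma branch_disjoint: "branch 1 \<inter> branch (-1) = {}"
  by (auto simp: branch_def)

lemma closed_branch:
  assumes s: "s = 1 \<or> s = -1"
  shows "closed (branch s)"
proof -
  have "branch s = (\<Delta> \<inter> F -` {p. yc p \<in> {-4..4}}) \<inter> {p. 2 \<le> s * yc p}"
    using branch_band[OF s] by (auto simp: branch_def band_def)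
  moreover have "closed {p :: r3. yc p \<in> {-4..4}}" "closed {p :: r3. 2 \<le> s * yc p}"
    by (auto intro!: closed_Collect_conj closed_Collect_le continuous_intros)
  ultimately show ?thesis
    using continuous_closed_preimage[OF continuous_F compact_imp_closed[OF compact_Delta]]
    by (metis closed_Int)
qed

text \<open>The tightest face is \<open>z = 22\<close>: returning to the cube needs \<open>\<xi> z + y \<le> 22\<close> with \<open>y > -3.75\<close>, and
  \<open>1.18 * 22 = 25.96\<close> exceeds \<open>25.76\<close>.\<close>

lemma return_interior:
  assumes "p \<in> \<Delta>" "F p \<in> \<Delta>"
  shows "-4 < yc p" "yc p < 4" "-40 < zc p" "zc p < 22"
proof -
  obtain s where s: "s = 1 \<or> s = -1" "p \<in> branch s"
    using in_branch_if_image_in_strip[OF assms(1)] assms(2) by (auto simp: Delta_iff)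
  have y: "- (15/4) < yc p" "yc p < 15/4" using branch_bounds[OF s] s(1) by auto
  then show "-4 < yc p" "yc p < 4" by simp_all
  have z: "-40 \<le> zc (F p)" "zc (F p) \<le> 22" using assms(2) by (auto simp: Delta_iff)
  have *: "-44 < \<xi> * zc p" "\<xi> * zc p < 2576/100"
    using F_approx_bounds(5,6)[OF assms(1)] y z by linarith+
  show "zc p < 22"
  proof (rule ccontr)
    assume "\<not> zc p < 22"
    then have "59/50 * 22 \<le> \<xi> * zc p" using \<xi> by (intro mult_mono) auto
    with * show False by simp
  qed
  show "-40 < zc p"
  proof (rule ccontr)
    assume "\<not> -40 < zc p"
    then have "59/50 * 40 \<le> \<xi> * (- zc p)" using \<xi> by (intro mult_mono) auto
    with * show False by simp
  qed
qed

lemma branch_image_x: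
  assumes "s = 1 \<or> s = -1" "p \<in> branch s"
  shows "-4 < xc (F p)" "xc (F p) < 4" "2 < s * xc (F p)"
proof -
  have "p \<in> \<Delta>" using assms by (simp add: branch_def)
  then show "-4 < xc (F p)" "xc (F p) < 4" "2 < s * xc (F p)"
    using F_approx_bounds(1,2)[of p] branch_bounds[OF assms] assms(1) by auto
qed

text \<open>The points whose orbit never leaves the branch; \<open>Ws_loc_saddle\<close> identifies this set with the local
  stable set of the fixed point in the branch.\<close>

definition trapped :: "real \<Rightarrow> r3 set" where
  "trapped s = {p. \<forall>n. (F ^^ n) p \<in> branch s}"

lemma trapped_branch: "p \<in> trapped s \<Longrightarrow> p \<in> branch s"
  unfolding trapped_def by (auto dest!: spec[of _ 0])

lemma trapped_image: "p \<in> trapped s \<Longrightarrow> F p \<in> trapped s"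
  unfolding trapped_def mem_Collect_eq by (metis funpow_swap1 funpow.simps(2) o_apply)

lemma trapped_iter: "p \<in> trapped s \<Longrightarrow> (F ^^ n) p \<in> trapped s"
  by (induction n) (auto intro: trapped_image)

text \<open>A steep difference stays steep and grows by \<open>11/10\<close> in each step, while both orbits stay in the
  bounded cube.\<close>

lemma trapped_flat:
  assumes s: "s = 1 \<or> s = -1" and pq: "p \<in> trapped s" "q \<in> trapped s"
  shows "vert (p - q) \<le> \<bar>xc p - xc q\<bar> / 100"
proof (rule ccontr)
  assume steep: "\<not> ?thesis"
  let ?d = "\<lambda>n. (F ^^ n) p - (F ^^ n) q"
  have b: "(F ^^ n) p \<in> band s" "(F ^^ n) q \<in> band s" for n
    using pq branch_band[OF s] unfolding trapped_def by blast+
  have "\<bar>xc (?d n)\<bar> \<le> 100 * vert (?d n) \<and> (11/10) ^ n * vert (p - q) \<le> vert (?d n)" for n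
  proof (induction n)
    case 0
    then show ?case using steep by simp
  next
    case (Suc n)
    have "(11/10) * vert (?d n) \<le> vert (?d (Suc n))" "\<bar>xc (?d (Suc n))\<bar> \<le> 2 * vert (?d n)"
      using band_difference_grows[OF s b[of n] conjunct1[OF Suc]] by simp_all
    moreover have "0 \<le> vert (?d n)" by (rule vert_nonneg)
    ultimately show ?case using Suc by auto
  qed
  moreover have "vert (?d n) \<le> 70" for n
    using band_DeltaD[OF b(1)[of n]] band_DeltaD[OF b(2)[of n]] by (auto simp: vert_def Delta_iff)
  ultimately have bd: "(11/10) ^ n * vert (p - q) \<le> 70" for n
    using order_trans by blast
  have "\<bar>xc p - xc q\<bar> / 100 < vert (p - q)" using steep by simp
  moreover have "0 \<le> \<bar>xc p - xc q\<bar> / 100" by simp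
  ultimately have pos: "0 < vert (p - q)" by (rule order.strict_trans1[rotated])
  obtain n where "70 / vert (p - q) < (11/10) ^ n"
    using real_arch_pow[of "11/10" "70 / vert (p - q)"] by auto
  then show False using bd[of n] pos by (simp add: field_simps)
qed

text \<open>The graph transform. The slope bound is reproduced: if the difference of two preimages were steep,
  their images would have vertical distance at least \<open>1.1\<close> and horizontal distance at most \<open>2\<close> times
  the vertical distance of the preimages, contradicting the slope \<open>1/100\<close> of the given graph.\<close>

lemma s_graph_pullback:
  assumes s: "s = 1 \<or> s = -1" and g: "s_graph Y Z"
  obtains Y' Z' where "s_graph Y' Z'" "\<And>a. a \<in> {-4..4} \<Longrightarrow> (a, Y' a, Z' a) \<in> branch s"
    "\<And>a. a \<in> {-4..4} \<Longrightarrow> \<exists>b\<in>{-4..4}. F (a, Y' a, Z' a) = (b, Y b, Z b)"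
proof -
  have "\<forall>a\<in>{-4..4}. \<exists>p. p \<in> branch s \<and> xc p = a \<and> xc (F p) \<in> {-4..4} \<and>
      yc (F p) = Y (xc (F p)) \<and> zc (F p) = Z (xc (F p))"
    using preimage_of_s_graph[OF s g] by metis
  then obtain p where p: "\<And>a. a \<in> {-4..4} \<Longrightarrow> p a \<in> branch s \<and> xc (p a) = a \<and>
      xc (F (p a)) \<in> {-4..4} \<and> yc (F (p a)) = Y (xc (F (p a))) \<and> zc (F (p a)) = Z (xc (F (p a)))"
    by metis
  have eq: "(a, yc (p a), zc (p a)) = p a" if "a \<in> {-4..4}" for a
    using p[OF that] by (auto intro!: r3_eqI)
  have flat: "vert (p a - p b) \<le> \<bar>a - b\<bar> / 100" if ab: "a \<in> {-4..4}" "b \<in> {-4..4}" for a b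
  proof (rule ccontr)
    assume "\<not> ?thesis"
    then have steep: "\<bar>a - b\<bar> < 100 * vert (p a - p b)" by simp
    have bd: "p a \<in> band s" "p b \<in> band s" using p ab branch_band[OF s] by blast+
    have "\<bar>xc (p a - p b)\<bar> \<le> 100 * vert (p a - p b)" using p ab steep by simp
    note gr = band_difference_grows[OF s bd this]
    have "vert (F (p a) - F (p b)) \<le> \<bar>xc (F (p a) - F (p b))\<bar> / 100"
      using s_graphD(3)[OF g, of "xc (F (p a))" "xc (F (p b))"] p[OF ab(1)] p[OF ab(2)]
      by (simp add: vert_def)
    with gr steep show False by linarith
  qed
  show thesis
  proof (rule that[of "\<lambda>a. yc (p a)" "\<lambda>a. zc (p a)"])
    show "s_graph (\<lambda>a. yc (p a)) (\<lambda>a. zc (p a))"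
      using flat p unfolding s_graph_def by (auto simp: vert_def branch_def Delta_iff)
    fix a :: real assume a: "a \<in> {-4..4}"
    show "(a, yc (p a), zc (p a)) \<in> branch s" using p[OF a] eq[OF a] by simp
    show "\<exists>b\<in>{-4..4}. F (a, yc (p a), zc (p a)) = (b, Y b, Z b)"
      unfolding eq[OF a] using p[OF a] by (intro bexI[of _ "xc (F (p a))"]) (auto intro: r3_eqI)
  qed
qed

lemma long_orbits_in_branch:
  assumes s: "s = 1 \<or> s = -1"
  shows "\<exists>Y Z. s_graph Y Z \<and> (\<forall>a\<in>{-4..4}. \<forall>i\<le>n. (F ^^ i) (a, Y a, Z a) \<in> branch s)"
proof (induction n)
  case 0
  have "s_graph (\<lambda>_. 0) (\<lambda>_. 0)" by (simp add: s_graph_def)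
  from s_graph_pullback[OF s this] obtain Y Z where
    "s_graph Y Z" "\<And>a. a \<in> {-4..4} \<Longrightarrow> (a, Y a, Z a) \<in> branch s" by metis
  then show ?case by (intro exI[of _ Y] exI[of _ Z]) simp
next
  case (Suc n)
  then obtain Y Z where g: "s_graph Y Z"
    and orb: "\<And>a i. a \<in> {-4..4} \<Longrightarrow> i \<le> n \<Longrightarrow> (F ^^ i) (a, Y a, Z a) \<in> branch s" by blast
  obtain Y' Z' where g': "s_graph Y' Z'" "\<And>a. a \<in> {-4..4} \<Longrightarrow> (a, Y' a, Z' a) \<in> branch s"
    "\<And>a. a \<in> {-4..4} \<Longrightarrow> \<exists>b\<in>{-4..4}. F (a, Y' a, Z' a) = (b, Y b, Z b)"
    using s_graph_pullback[OF s g] by metis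
  have "(F ^^ i) (a, Y' a, Z' a) \<in> branch s" if a: "a \<in> {-4..4}" and i: "i \<le> Suc n" for a i
  proof (cases i)
    case 0 then show ?thesis using g'(2)[OF a] by simp
  next
    case (Suc j)
    obtain b where "b \<in> {-4..4}" "F (a, Y' a, Z' a) = (b, Y b, Z b)" using g'(3)[OF a] by blast
    then show ?thesis using orb[of b j] i Suc by (simp add: funpow_swap1)
  qed
  then show ?case using g'(1) by blast
qed

text \<open>Iterated pull-backs give points over \<open>a\<close> with arbitrarily long orbits in the branch; a limit point
  has an infinite one since the branch is compact.\<close>

lemma trapped_exists:
  assumes s: "s = 1 \<or> s = -1" and a: "a \<in> {-4..4}"
  obtains p where "p \<in> trapped s" "xc p = a"
proof -
  have "\<forall>n. \<exists>p. xc p = a \<and> (\<forall>i\<le>n. (F ^^ i) p \<in> branch s)"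
    using long_orbits_in_branch[OF s] a by (metis fst_conv)
  then obtain q where q: "\<And>n. xc (q n) = a" "\<And>n i. i \<le> n \<Longrightarrow> (F ^^ i) (q n) \<in> branch s" by metis
  have "\<forall>n. q n \<in> \<Delta>" using q(2)[of 0] by (auto simp: branch_def)
  then obtain p r where r: "strict_mono (r :: nat \<Rightarrow> nat)" "(q \<circ> r) \<longlonglongrightarrow> p"
    using compact_Delta unfolding compact_def by metis
  have lim: "(\<lambda>n. (F ^^ i) (q (r n))) \<longlonglongrightarrow> (F ^^ i) p \<and> (F ^^ i) p \<in> branch s" for i
  proof (induction i)
    case 0
    have "(\<lambda>n. q (r n)) \<longlonglongrightarrow> p" using r(2) by (simp add: o_def)
    moreover have "q (r n) \<in> branch s" for n using q(2)[of 0 "r n"] by simp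
    ultimately show ?case using closed_sequentially[OF closed_branch[OF s], of "\<lambda>n. q (r n)" p] by auto
  next
    case (Suc i)
    have ev: "\<forall>\<^sub>F n in sequentially. (F ^^ j) (q (r n)) \<in> branch s" for j
    proof (rule eventually_sequentiallyI[of j])
      fix n assume "j \<le> n"
      then have "j \<le> r n" using seq_suble[OF r(1), of n] by simp
      then show "(F ^^ j) (q (r n)) \<in> branch s" by (rule q(2))
    qed
    have "(\<lambda>n. F ((F ^^ i) (q (r n)))) \<longlonglongrightarrow> F ((F ^^ i) p)"
    proof (rule continuous_on_tendsto_compose[OF continuous_F])
      show "(\<lambda>n. (F ^^ i) (q (r n))) \<longlonglongrightarrow> (F ^^ i) p" "(F ^^ i) p \<in> \<Delta>"
        using Suc by (auto simp: branch_def)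
      show "\<forall>\<^sub>F n in sequentially. (F ^^ i) (q (r n)) \<in> \<Delta>"
        using ev[of i] by eventually_elim (simp add: branch_def)
    qed
    then have l: "(\<lambda>n. (F ^^ Suc i) (q (r n))) \<longlonglongrightarrow> (F ^^ Suc i) p" by simp
    moreover have "(F ^^ Suc i) p \<in> branch s"
      using Lim_in_closed_set[OF closed_branch[OF s] ev _ l] by simp
    ultimately show ?case by blast
  qed
  then have "p \<in> trapped s" by (simp add: trapped_def)
  moreover have "xc p = a"
  proof -
    have "(\<lambda>n. xc (q (r n))) \<longlonglongrightarrow> xc p" using lim[of 0] by (auto intro: tendsto_fst)
    then show ?thesis unfolding q(1) by (simp add: LIMSEQ_const_iff)
  qed
  ultimately show thesis by (rule that)
qed

text \<open>The point over \<open>a\<close> of the trapped set, which is unique by \<open>trapped_flat\<close>.\<close>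

definition wpt :: "real \<Rightarrow> real \<Rightarrow> r3" where "wpt s a = (SOME p. p \<in> trapped s \<and> xc p = a)"

abbreviation wY :: "real \<Rightarrow> real \<Rightarrow> real" where "wY s a \<equiv> yc (wpt s a)"
abbreviation wZ :: "real \<Rightarrow> real \<Rightarrow> real" where "wZ s a \<equiv> zc (wpt s a)"

lemma wpt:
  assumes "s = 1 \<or> s = -1" "a \<in> {-4..4}"
  shows "wpt s a \<in> trapped s" "xc (wpt s a) = a"
  using someI_ex[of "\<lambda>p. p \<in> trapped s \<and> xc p = a"] trapped_exists[OF assms]
  unfolding wpt_def by blast+

lemma trapped_x: "p \<in> trapped s \<Longrightarrow> xc p \<in> {-4..4}"
  using trapped_branch[of p s] by (auto simp: branch_def Delta_iff)

lemma trapped_eq_wpt: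
  assumes s: "s = 1 \<or> s = -1" and p: "p \<in> trapped s"
  shows "p = wpt s (xc p)"
proof -
  note w = wpt[OF s trapped_x[OF p]]
  have "vert (p - wpt s (xc p)) \<le> 0" using trapped_flat[OF s p w(1)] w(2) by simp
  then show ?thesis using w(2) by (auto intro!: r3_eqI simp: vert_def)
qed

lemma trapped_image_wpt:
  assumes s: "s = 1 \<or> s = -1"
  shows "trapped s = wpt s ` {-4..4}"
proof
  show "trapped s \<subseteq> wpt s ` {-4..4}"
    using trapped_eq_wpt[OF s] trapped_x by blast
  show "wpt s ` {-4..4} \<subseteq> trapped s"
    using wpt(1)[OF s] by blast
qed

lemma s_graph_trapped:
  assumes s: "s = 1 \<or> s = -1"
  shows "s_graph (wY s) (wZ s)"
  unfolding s_graph_def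
proof (intro conjI ballI)
  fix a :: real assume a: "a \<in> {-4..4}"
  show "wY s a \<in> {-4..4}" "wZ s a \<in> {-40..22}"
    using trapped_branch[OF wpt(1)[OF s a]] by (auto simp: branch_def Delta_iff)
  fix b :: real assume b: "b \<in> {-4..4}"
  show "\<bar>wY s a - wY s b\<bar> + \<bar>wZ s a - wZ s b\<bar> \<le> \<bar>a - b\<bar> / 100"
    using trapped_flat[OF s wpt(1)[OF s a] wpt(1)[OF s b]] wpt(2)[OF s] a b by (simp add: vert_def)
qed

lemma wpt_coords:
  assumes "s = 1 \<or> s = -1" "a \<in> {-4..4}"
  shows "wpt s a = (a, wY s a, wZ s a)"
  using wpt(2)[OF assms] by (simp add: prod_eq_iff)

lemma continuous_wpt:
  assumes s: "s = 1 \<or> s = -1"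
  shows "continuous_on {-4..4} (wpt s)"
proof -
  have "continuous_on {-4..4} (\<lambda>a. (a, wY s a, wZ s a))"
    by (intro continuous_on_Pair continuous_on_id s_graph_continuous[OF s_graph_trapped[OF s]])
  then show ?thesis by (rule continuous_on_eq) (rule wpt_coords[OF s, symmetric])
qed

lemma trapped_compact_connected:
  assumes s: "s = 1 \<or> s = -1"
  shows "compact (trapped s)" "connected (trapped s)"
  unfolding trapped_image_wpt[OF s]
  using continuous_wpt[OF s] by (auto intro: compact_continuous_image connected_continuous_image)

lemma trapped_contraction:
  assumes s: "s = 1 \<or> s = -1" and pq: "p \<in> trapped s" "q \<in> trapped s"
  shows "dist (F p) (F q) \<le> 3/4 * dist p q"
proof -
  have b: "p \<in> band s" "q \<in> band s" using pq trapped_branch branch_band[OF s] by blast+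
  have "vert (p - q) \<le> \<bar>xc p - xc q\<bar> / 100" by (rule trapped_flat[OF s pq])
  then have "\<bar>yc (p - q)\<bar> \<le> \<bar>xc (p - q)\<bar> / 20" "\<bar>zc (p - q)\<bar> \<le> \<bar>xc (p - q)\<bar> / 20"
    using abs_ge_zero[of "yc (p - q)"] abs_ge_zero[of "zc (p - q)"] unfolding vert_def fst_diff snd_diff by linarith+
  then have "l1 (F p - F q) \<le> 3/4 * \<bar>xc (p - q)\<bar>"
    by (rule near_step_contracts[OF difference_near_step[OF b[THEN band_DeltaD]] band_slope[OF s b] \<xi>])
  then show ?thesis
    unfolding dist_norm using norm_le_l1[of "F p - F q"] comp_le_norm(1)[of "p - q"] by linarith
qed

lemma trapped_fixed_point:
  assumes s: "s = 1 \<or> s = -1"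
  shows "\<exists>!R. R \<in> trapped s \<and> F R = R"
proof -
  have "trapped s \<noteq> {}" using trapped_exists[OF s, of 0] by auto
  then show ?thesis
    using trapped_compact_connected(1)[OF s] trapped_image trapped_contraction[OF s]
    by (intro Banach_fix[of _ "3/4"]) (auto intro: compact_imp_complete)
qed

text \<open>The reference saddles are \<open>P = saddle (-1)\<close> and \<open>Q = saddle 1\<close>.\<close>

definition saddle :: "real \<Rightarrow> r3" where "saddle s = (THE R. R \<in> trapped s \<and> F R = R)"

lemma saddle:
  assumes s: "s = 1 \<or> s = -1"
  shows "saddle s \<in> trapped s" "F (saddle s) = saddle s"
  using theI'[OF trapped_fixed_point[OF s]] unfolding saddle_def by auto

lemma trapped_converges:
  assumes s: "s = 1 \<or> s = -1" and p: "p \<in> trapped s"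
  shows "(\<lambda>n. (F ^^ n) p) \<longlonglongrightarrow> saddle s"
proof -
  have "dist ((F ^^ n) p) (saddle s) \<le> (3/4) ^ n * dist p (saddle s)" for n
  proof (induction n)
    case (Suc n)
    have "dist ((F ^^ Suc n) p) (saddle s) \<le> 3/4 * dist ((F ^^ n) p) (saddle s)"
      using trapped_contraction[OF s trapped_iter[OF p] saddle(1)[OF s], of n] saddle(2)[OF s] by simp
    then show ?case using Suc by simp
  qed simp
  moreover have "(\<lambda>n. (3/4) ^ n * dist p (saddle s)) \<longlonglongrightarrow> 0"
    by (intro tendsto_mult_left_zero LIMSEQ_realpow_zero) auto
  ultimately have "(\<lambda>n. dist ((F ^^ n) p) (saddle s)) \<longlonglongrightarrow> 0"
    by (rule_tac tendsto_sandwich[OF always_eventually always_eventually tendsto_const[of 0]]) simp_all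
  then show ?thesis by (rule tendsto_dist_iff[THEN iffD2])
qed

text \<open>All iterates of the component \<open>C\<close> of the saddle in its stable set are connected, contain the
  saddle and lie in the union of the two branches, which are disjoint and closed. So they never leave
  the branch of the saddle, that is, \<open>C\<close> is trapped.\<close>

lemma Ws_loc_saddle:
  assumes s: "s = 1 \<or> s = -1"
  shows "Ws_loc henon_cube F (saddle s) = trapped s"
proof
  let ?S = "stable_set henon_cube F (saddle s) \<inter> \<Delta>"
  have inD: "p \<in> \<Delta>" if "p \<in> trapped s" for p
    using trapped_branch[OF that] by (simp add: branch_def)
  have sub: "trapped s \<subseteq> ?S"
  proof
    fix p assume p: "p \<in> trapped s"
    then show "p \<in> ?S"
      unfolding stable_set_def using inD[OF p] inD[OF trapped_iter[OF p]] trapped_converges[OF s p] by simp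
  qed
  then show "trapped s \<subseteq> Ws_loc henon_cube F (saddle s)"
    unfolding Ws_loc_def
    by (intro connected_component_maximal saddle[OF s] trapped_compact_connected[OF s])
  define C where "C = Ws_loc henon_cube F (saddle s)"
  have conn: "connected C" unfolding C_def Ws_loc_def by simp
  have R: "saddle s \<in> C"
    unfolding C_def Ws_loc_def using subsetD[OF sub saddle(1)[OF s]] by simp
  have CS: "C \<subseteq> ?S" unfolding C_def Ws_loc_def by (rule connected_component_subset)
  have D: "(F ^^ n) p \<in> \<Delta>" if "p \<in> C" for p n using CS that by (auto simp: stable_set_def)
  have fixed: "(F ^^ n) (saddle s) = saddle s" for n by (induction n) (auto simp: saddle[OF s])
  have "connected ((F ^^ n) ` C)" for n
  proof (induction n)
    case (Suc n)
    have "continuous_on ((F ^^ n) ` C) F"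
      using continuous_on_subset[OF continuous_F] D by blast
    from connected_continuous_image[OF this Suc] show ?case by (simp add: image_comp)
  qed (simp add: conn)
  moreover have cover: "(F ^^ n) ` C \<subseteq> branch 1 \<union> branch (-1)" for n
  proof (rule image_subsetI)
    fix p assume p: "p \<in> C"
    show "(F ^^ n) p \<in> branch 1 \<union> branch (-1)"
      using in_branch_if_image_in_strip[of "(F ^^ n) p"] D[OF p, of n] D[OF p, of "Suc n"]
      by (auto simp: Delta_iff)
  qed
  ultimately have "branch 1 \<inter> (F ^^ n) ` C = {} \<or> branch (-1) \<inter> (F ^^ n) ` C = {}" for n
    using branch_disjoint closed_branch[of 1] closed_branch[of "-1"]
    by (intro connected_closedD) auto
  moreover have "saddle s \<in> branch s \<inter> (F ^^ n) ` C" for n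
    using trapped_branch[OF saddle(1)[OF s]] imageI[OF R, of "F ^^ n"] fixed[of n] by simp
  ultimately have "(F ^^ n) ` C \<subseteq> branch s" for n
    using s cover[of n] by blast
  then show "Ws_loc henon_cube F (saddle s) \<subseteq> trapped s"
    unfolding C_def[symmetric] trapped_def by blast
qed

end

section \<open>Smoothness of the stable curves\<close>

lemma vert_triangle: "vert (v + w) \<le> vert v + vert w" "vert (v - w) \<le> vert v + vert w"
  by (auto simp: vert_def)

lemma vert_scale: "vert (c *\<^sub>R v) = \<bar>c\<bar> * vert v"
  by (simp add: vert_def abs_mult algebra_simps)

lemma vert_le_norm: "vert v \<le> 2 * norm v"
  using comp_le_norm(2,3)[of v] unfolding vert_def by linarith

lemma norm_le_vert: "xc v = 0 \<Longrightarrow> norm v \<le> vert v"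
  using norm_le_l1[of v] by (simp add: l1_def vert_def)

lemma interval_no_isolated_point:
  fixes x :: real
  assumes "x \<in> {-4..4}" "0 < d"
  obtains a where "a \<in> {-4..4}" "a \<noteq> x" "\<bar>a - x\<bar> < d"
proof (cases "x \<le> 0")
  case True
  then show thesis using assms that[of "x + min (d/2) 1"] by (auto simp: min_def)
next
  case False
  then show thesis using assms that[of "x - min (d/2) 1"] by (auto simp: min_def)
qed

context near_henon
begin

text \<open>Continuity of the derivative controls increments between any two points near \<open>p0\<close>, not only those
  starting in \<open>p0\<close>. This is what makes slopes of chords comparable with tangents below.\<close>

lemma strict_derivative:
  assumes p0: "p0 \<in> \<Delta>" and e: "0 < e"
  obtains d where "0 < d" "\<And>p q. \<lbrakk>p \<in> \<Delta>; q \<in> \<Delta>; dist p p0 < d; dist q p0 < d\<rbrakk> \<Longrightarrow>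
     norm (F p - F q - DF henon_cube F p0 (p - q)) \<le> e * norm (p - q)"
proof -
  obtain D :: "r3 \<Rightarrow> r3 \<Rightarrow>\<^sub>L r3" where D: "continuous_on \<Delta> D"
    "\<And>p. p \<in> \<Delta> \<Longrightarrow> DF henon_cube F p = blinfun_apply (D p)" by (rule DF_blinfun) blast
  obtain d where d: "0 < d" "\<And>x. x \<in> \<Delta> \<Longrightarrow> dist x p0 < d \<Longrightarrow> dist (D x) (D p0) < e"
    using D(1) p0 e unfolding continuous_on_iff by metis
  let ?S = "\<Delta> \<inter> ball p0 d"
  have "norm ((F p - D p0 p) - (F q - D p0 q)) \<le> e * norm (p - q)"
    if "p \<in> ?S" "q \<in> ?S" for p q
  proof (rule differentiable_bound[OF _ _ _ that])
    show "convex ?S" using convex_Delta by (simp add: convex_Int)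
    fix x assume x: "x \<in> ?S"
    have "(F has_derivative D x) (at x within ?S)"
      using has_DF[of x] D(2)[of x] x by (auto intro: has_derivative_subset)
    then show "((\<lambda>x. F x - D p0 x) has_derivative (D x - D p0)) (at x within ?S)"
      unfolding minus_blinfun.rep_eq by (auto intro!: derivative_eq_intros blinfun.bounded_linear_right)
    show "onorm (D x - D p0) \<le> e"
      using d(2)[of x] x by (auto simp: norm_blinfun.rep_eq[symmetric] dist_norm norm_minus_commute)
  qed
  moreover have "(F p - D p0 p) - (F q - D p0 q) = F p - F q - DF henon_cube F p0 (p - q)" for p q
    unfolding D(2)[OF p0] by (simp add: blinfun.diff_right)
  ultimately show thesis using d(1) that[of d] by (auto simp: dist_commute)
qed

lemma linear_DF: "p \<in> \<Delta> \<Longrightarrow> linear (DF henon_cube F p)"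
  using has_DF has_derivative_linear by blast

lemma trapped_next:
  assumes s: "s = 1 \<or> s = -1" and a: "a \<in> {-4..4}"
  shows "xc (F (wpt s a)) \<in> {-4..4}" "F (wpt s a) = wpt s (xc (F (wpt s a)))"
  using trapped_eq_wpt[OF s] trapped_x trapped_image[OF wpt(1)[OF s a]] by blast+

text \<open>The chord slopes of the trapped curve near \<open>x\<close> differ by at most \<open>r\<close>. The denominators are
  multiplied out because \<open>F\<close> may collapse a chord to a point, and then the chord of the images has
  no slope.\<close>

definition osc_le :: "real \<Rightarrow> real \<Rightarrow> real \<Rightarrow> bool" where
  "osc_le s x r \<longleftrightarrow> (\<exists>d>0. \<forall>a\<in>{-4..4}. \<forall>b\<in>{-4..4}. \<forall>a'\<in>{-4..4}. \<forall>b'\<in>{-4..4}.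
     \<bar>a - x\<bar> < d \<longrightarrow> \<bar>b - x\<bar> < d \<longrightarrow> \<bar>a' - x\<bar> < d \<longrightarrow> \<bar>b' - x\<bar> < d \<longrightarrow>
     vert ((a' - b') *\<^sub>R (wpt s a - wpt s b) - (a - b) *\<^sub>R (wpt s a' - wpt s b'))
       \<le> r * (\<bar>a - b\<bar> * \<bar>a' - b'\<bar>))"

lemma wpt_diff:
  assumes s: "s = 1 \<or> s = -1" and ab: "a \<in> {-4..4}" "b \<in> {-4..4}"
  shows "vert (wpt s a - wpt s b) \<le> \<bar>a - b\<bar> / 100" "xc (wpt s a - wpt s b) = a - b"
    "norm (wpt s a - wpt s b) \<le> 2 * \<bar>a - b\<bar>"
    "\<bar>xc (F (wpt s a) - F (wpt s b))\<bar> \<le> \<bar>a - b\<bar> / 50"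
proof -
  show v: "vert (wpt s a - wpt s b) \<le> \<bar>a - b\<bar> / 100"
    using trapped_flat[OF s wpt(1)[OF s ab(1)] wpt(1)[OF s ab(2)]] wpt(2)[OF s] ab by simp
  show x: "xc (wpt s a - wpt s b) = a - b" using wpt(2)[OF s] ab by simp
  have l: "l1 (wpt s a - wpt s b) = \<bar>a - b\<bar> + vert (wpt s a - wpt s b)"
    using x by (simp add: l1_def vert_def)
  show "norm (wpt s a - wpt s b) \<le> 2 * \<bar>a - b\<bar>"
  proof -
    have "n \<le> l \<Longrightarrow> u \<le> t / 100 \<Longrightarrow> l = t + u \<Longrightarrow> 0 \<le> t \<Longrightarrow> n \<le> 2 * t" for n l u t :: real
      by linarith
    then show ?thesis using norm_le_l1[of "wpt s a - wpt s b"] v l abs_ge_zero[of "a - b"] by blast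
  qed
  have b: "wpt s a \<in> band s" "wpt s b \<in> band s"
    using trapped_branch[OF wpt(1)[OF s]] branch_band[OF s] ab by blast+
  note near_step_bounds(1)[OF difference_near_step[OF b[THEN band_DeltaD]] band_slope[OF s b] \<xi>]
  moreover have "\<bar>yc (wpt s a - wpt s b)\<bar> \<le> vert (wpt s a - wpt s b)" by (simp add: vert_def)
  moreover have "tol * l1 (wpt s a - wpt s b) = tol * \<bar>a - b\<bar> + tol * vert (wpt s a - wpt s b)"
    unfolding l by (rule distrib_left)
  ultimately show "\<bar>xc (F (wpt s a) - F (wpt s b))\<bar> \<le> \<bar>a - b\<bar> / 50"
    using v abs_ge_zero[of "a - b"] by linarith
qed

text \<open>Let \<open>v\<close> be the difference of two chord vectors near \<open>x\<close>, scaled to equal width. It is vertical, so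
  \<open>DF\<close> stretches it by at least \<open>11/10\<close>. On the other hand \<open>DF v\<close> is, up to the error in the strict
  derivative, the corresponding difference for the image chords, whose widths are at most \<open>1/50\<close> of
  the original ones. So the oscillation at \<open>x\<close> is much smaller than the one at the image point.\<close>

lemma osc_le_half:
  assumes s: "s = 1 \<or> s = -1" and r: "0 < r" and osc: "\<And>y. y \<in> {-4..4} \<Longrightarrow> osc_le s y r"
    and x: "x \<in> {-4..4}"
  shows "osc_le s x (r / 2)"
proof -
  let ?p = "wpt s x" and ?w = "wpt s" and ?\<phi> = "\<lambda>a. xc (F (wpt s a))"
  have pD: "?w a \<in> \<Delta>" if "a \<in> {-4..4}" for a
    using trapped_branch[OF wpt(1)[OF s that]] by (simp add: branch_def)
  define M where "M = DF henon_cube F ?p"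
  have lin: "linear M" unfolding M_def by (rule linear_DF[OF pD[OF x]])
  \<comment> \<open>The admitted linearisation error, negligible against the gain from \<open>r\<close> to \<open>r / 2\<close>.\<close>
  define e where "e = r / 1000"
  have e: "0 < e" using r by (simp add: e_def)
  obtain d1 where d1: "0 < d1" "\<And>a b a' b'. \<lbrakk>a \<in> {-4..4}; b \<in> {-4..4}; a' \<in> {-4..4}; b' \<in> {-4..4};
     \<bar>a - ?\<phi> x\<bar> < d1; \<bar>b - ?\<phi> x\<bar> < d1; \<bar>a' - ?\<phi> x\<bar> < d1; \<bar>b' - ?\<phi> x\<bar> < d1\<rbrakk> \<Longrightarrow>
     vert ((a' - b') *\<^sub>R (?w a - ?w b) - (a - b) *\<^sub>R (?w a' - ?w b')) \<le> r * (\<bar>a - b\<bar> * \<bar>a' - b'\<bar>)"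
    using osc[OF trapped_next(1)[OF s x]] unfolding osc_le_def by metis
  obtain d2 where d2: "0 < d2" "\<And>p q. \<lbrakk>p \<in> \<Delta>; q \<in> \<Delta>; dist p ?p < d2; dist q ?p < d2\<rbrakk> \<Longrightarrow>
     norm (F p - F q - M (p - q)) \<le> e * norm (p - q)"
    using strict_derivative[OF pD[OF x] e] unfolding M_def by metis
  define d where "d = min d1 (d2 / 2)"
  have d: "0 < d" using d1(1) d2(1) by (simp add: d_def)
  have near: "\<bar>?\<phi> a - ?\<phi> x\<bar> < d1 \<and> dist (?w a) ?p < d2" if "a \<in> {-4..4}" "\<bar>a - x\<bar> < d" for a
  proof -
    have "\<bar>?\<phi> a - ?\<phi> x\<bar> \<le> \<bar>a - x\<bar> / 50" "norm (?w a - ?p) \<le> 2 * \<bar>a - x\<bar>"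
      using wpt_diff(3,4)[OF s that(1) x] by simp_all
    moreover have "t < min d1 (d2 / 2) \<Longrightarrow> 0 \<le> t \<Longrightarrow> u \<le> t / 50 \<Longrightarrow> w \<le> 2 * t \<Longrightarrow> u < d1 \<and> w < d2" for t u w
      by (intro conjI; linarith)
    ultimately show ?thesis using abs_ge_zero[of "a - x"] that(2) unfolding dist_norm d_def by blast
  qed
  have "vert ((a' - b') *\<^sub>R (?w a - ?w b) - (a - b) *\<^sub>R (?w a' - ?w b')) \<le> r / 2 * (\<bar>a - b\<bar> * \<bar>a' - b'\<bar>)"
    if I: "a \<in> {-4..4}" "b \<in> {-4..4}" "a' \<in> {-4..4}" "b' \<in> {-4..4}"
      and c: "\<bar>a - x\<bar> < d" "\<bar>b - x\<bar> < d" "\<bar>a' - x\<bar> < d" "\<bar>b' - x\<bar> < d" for a b a' b'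
  proof -
    define h h' P P' Q Q' k k' where defs: "h = a - b" "h' = a' - b'"
      "P = ?w a - ?w b" "P' = ?w a' - ?w b'"
      "Q = F (?w a) - F (?w b)" "Q' = F (?w a') - F (?w b')" "k = xc Q" "k' = xc Q'"
    define v where "v = h' *\<^sub>R P - h *\<^sub>R P'"
    define H V where "H = \<bar>h\<bar> * \<bar>h'\<bar>" and "V = vert v"
    have H: "0 \<le> H" by (simp add: H_def)
    have xcv: "xc v = 0"
      using wpt_diff(2)[OF s I(1,2)] wpt_diff(2)[OF s I(3,4)] unfolding v_def defs by simp
    have mb: "4 \<le> \<bar>2 * yc ?p\<bar>" "\<bar>2 * yc ?p\<bar> \<le> 8"
      using branch_bounds[OF s trapped_branch[OF wpt(1)[OF s x]]] s by auto
    have "near_step \<xi> (2 * yc ?p) v (M v)" unfolding M_def by (rule DF_near_step[OF pD[OF x]])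
    from vert_grows[OF this mb \<xi>] have gr: "(11/10) * V \<le> vert (M v)" "\<bar>xc (M v)\<bar> \<le> 2 * V"
      using xcv by (simp_all add: V_def vert_def)
    have E: "norm (Q - M P) \<le> 2 * e * \<bar>h\<bar>"
    proof -
      have "norm (Q - M P) \<le> e * norm P" unfolding defs using d2(2) pD I near c by blast
      also have "\<dots> \<le> e * (2 * \<bar>h\<bar>)"
        using wpt_diff(3)[OF s I(1,2)] e unfolding defs by (intro mult_left_mono) auto
      finally show ?thesis by simp
    qed
    have E': "norm (Q' - M P') \<le> 2 * e * \<bar>h'\<bar>"
    proof -
      have "norm (Q' - M P') \<le> e * norm P'" unfolding defs using d2(2) pD I near c by blast
      also have "\<dots> \<le> e * (2 * \<bar>h'\<bar>)"
        using wpt_diff(3)[OF s I(3,4)] e unfolding defs by (intro mult_left_mono) auto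
      finally show ?thesis by simp
    qed
    define R where "R = h' *\<^sub>R Q - h *\<^sub>R Q'"
    have "R - M v = h' *\<^sub>R (Q - M P) - h *\<^sub>R (Q' - M P')"
      unfolding R_def v_def using lin by (simp add: linear_diff linear_scale algebra_simps)
    then have "norm (R - M v) \<le> \<bar>h'\<bar> * norm (Q - M P) + \<bar>h\<bar> * norm (Q' - M P')"
      using norm_triangle_ineq4[of "h' *\<^sub>R (Q - M P)" "h *\<^sub>R (Q' - M P')"] by simp
    also have "\<dots> \<le> \<bar>h'\<bar> * (2 * e * \<bar>h\<bar>) + \<bar>h\<bar> * (2 * e * \<bar>h'\<bar>)"
      by (intro add_mono mult_left_mono E E') auto
    also have "\<dots> = 4 * (e * H)" by (simp add: H_def)
    finally have RM: "norm (R - M v) \<le> 4 * (e * H)" .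
    have "\<bar>xc R\<bar> \<le> \<bar>xc (M v)\<bar> + norm (R - M v)"
      using comp_le_norm(1)[of "R - M v"] by simp
    then have xR: "\<bar>xc R\<bar> \<le> 2 * V + 4 * (e * H)" using gr(2) RM by linarith
    have vR: "vert (M v) \<le> vert R + 8 * (e * H)"
      using vert_triangle(2)[of R "R - M v"] vert_le_norm[of "R - M v"] RM by simp
    have FQ: "Q = ?w (?\<phi> a) - ?w (?\<phi> b)" "Q' = ?w (?\<phi> a') - ?w (?\<phi> b')"
      unfolding defs using trapped_next(2)[OF s] I by metis+
    have kk: "k = ?\<phi> a - ?\<phi> b" "k' = ?\<phi> a' - ?\<phi> b'" unfolding defs by simp_all
    note J = trapped_next(1)[OF s I(1)] trapped_next(1)[OF s I(2)]
      trapped_next(1)[OF s I(3)] trapped_next(1)[OF s I(4)]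
    have flatQ: "vert Q \<le> \<bar>k\<bar> / 100" "vert Q' \<le> \<bar>k'\<bar> / 100"
      unfolding FQ kk using wpt_diff(1)[OF s] J by blast+
    have "vert R \<le> \<bar>h'\<bar> * (r * \<bar>k\<bar>) + \<bar>xc R\<bar> / 100"
    proof (cases "k' = 0")
      case True
      then have "vert Q' = 0" using flatQ(2) vert_nonneg[of Q'] by simp
      then have "vert R \<le> \<bar>h'\<bar> * vert Q"
        using vert_triangle(2)[of "h' *\<^sub>R Q" "h *\<^sub>R Q'"] unfolding R_def vert_scale by simp
      also have "\<dots> \<le> \<bar>h'\<bar> * (\<bar>k\<bar> / 100)" by (intro mult_left_mono flatQ) auto
      also have "\<dots> = \<bar>xc R\<bar> / 100" using True by (simp add: R_def defs abs_mult)
      finally show ?thesis using r by (smt (verit) mult_nonneg_nonneg abs_ge_zero)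
    next
      case False
      have o: "vert (k' *\<^sub>R Q - k *\<^sub>R Q') \<le> r * (\<bar>k\<bar> * \<bar>k'\<bar>)"
        unfolding FQ kk using d1(2)[OF J] near I c by blast
      \<comment> \<open>\<open>k' (h' Q - h Q') = h' (k' Q - k Q') + (h' k - h k') Q'\<close>, and \<open>h' k - h k'\<close> is the \<open>x\<close>-coordinate of \<open>R\<close>.\<close>
      have "R = (h' / k') *\<^sub>R (k' *\<^sub>R Q - k *\<^sub>R Q') + (xc R / k') *\<^sub>R Q'"
        using False unfolding R_def by (simp add: defs(7,8)[symmetric] scaleR_diff_right
            algebra_simps diff_divide_distrib scaleR_diff_left)
      then have "vert R \<le> \<bar>h' / k'\<bar> * vert (k' *\<^sub>R Q - k *\<^sub>R Q') + \<bar>xc R / k'\<bar> * vert Q'"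
        using vert_triangle(1) unfolding vert_scale[symmetric] by metis
      also have "\<dots> \<le> \<bar>h' / k'\<bar> * (r * (\<bar>k\<bar> * \<bar>k'\<bar>)) + \<bar>xc R / k'\<bar> * (\<bar>k'\<bar> / 100)"
        by (intro add_mono mult_left_mono o flatQ) auto
      also have "\<dots> = \<bar>h'\<bar> * (r * \<bar>k\<bar>) + \<bar>xc R\<bar> / 100" using False by (simp add: field_simps)
      finally show ?thesis .
    qed
    moreover have "\<bar>h'\<bar> * (r * \<bar>k\<bar>) \<le> \<bar>h'\<bar> * (r * (\<bar>h\<bar> / 50))"
      using wpt_diff(4)[OF s I(1,2)] r by (intro mult_left_mono) (auto simp: defs)
    moreover have "\<bar>h'\<bar> * (r * (\<bar>h\<bar> / 50)) = (r * H) / 50" by (simp add: H_def)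
    moreover have "e * H = (r * H) / 1000" by (simp add: e_def)
    moreover have "0 \<le> r * H" using H r by simp
    ultimately have "V \<le> (r * H) / 2"
      using gr(1) xR vR by linarith
    then show ?thesis unfolding V_def v_def H_def defs by (simp add: mult.assoc)
  qed
  then show ?thesis unfolding osc_le_def using d by blast
qed

lemma osc_le_small:
  assumes s: "s = 1 \<or> s = -1" and x: "x \<in> {-4..4}" and r: "0 < r"
  shows "osc_le s x r"
proof -
  have base: "osc_le s x 1" if "x \<in> {-4..4}" for x
    unfolding osc_le_def
  proof (intro exI[of _ 1] conjI ballI impI)
    fix a b a' b' :: real
    assume I: "a \<in> {-4..4}" "b \<in> {-4..4}" "a' \<in> {-4..4}" "b' \<in> {-4..4}"
    have "vert ((a' - b') *\<^sub>R (wpt s a - wpt s b) - (a - b) *\<^sub>R (wpt s a' - wpt s b'))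
      \<le> \<bar>a' - b'\<bar> * vert (wpt s a - wpt s b) + \<bar>a - b\<bar> * vert (wpt s a' - wpt s b')"
      using vert_triangle(2) unfolding vert_scale[symmetric] by metis
    also have "\<dots> \<le> \<bar>a' - b'\<bar> * (\<bar>a - b\<bar> / 100) + \<bar>a - b\<bar> * (\<bar>a' - b'\<bar> / 100)"
      by (intro add_mono mult_left_mono wpt_diff(1)[OF s] I) auto
    also have "\<dots> \<le> 1 * (\<bar>a - b\<bar> * \<bar>a' - b'\<bar>)"
      using mult_nonneg_nonneg[OF abs_ge_zero[of "a - b"] abs_ge_zero[of "a' - b'"]]
      by (simp add: mult.commute)
    finally show "vert ((a' - b') *\<^sub>R (wpt s a - wpt s b) - (a - b) *\<^sub>R (wpt s a' - wpt s b'))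
      \<le> 1 * (\<bar>a - b\<bar> * \<bar>a' - b'\<bar>)" .
  qed simp
  have pow: "\<forall>x\<in>{-4..4}. osc_le s x ((1/2) ^ n)" for n
  proof (induction n)
    case 0 then show ?case using base by simp
  next
    case (Suc n)
    then show ?case using osc_le_half[OF s, of "(1/2) ^ n"] by simp
  qed
  obtain n where "(1/2) ^ n < r" using real_arch_pow_inv[of r "1/2"] r by auto
  then have n: "(1/2) ^ n \<le> r" by simp
  obtain d where "d > 0" and *: "\<forall>a\<in>{-4..4}. \<forall>b\<in>{-4..4}. \<forall>a'\<in>{-4..4}. \<forall>b'\<in>{-4..4}.
     \<bar>a - x\<bar> < d \<longrightarrow> \<bar>b - x\<bar> < d \<longrightarrow> \<bar>a' - x\<bar> < d \<longrightarrow> \<bar>b' - x\<bar> < d \<longrightarrow>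
     vert ((a' - b') *\<^sub>R (wpt s a - wpt s b) - (a - b) *\<^sub>R (wpt s a' - wpt s b'))
       \<le> (1/2) ^ n * (\<bar>a - b\<bar> * \<bar>a' - b'\<bar>)"
    using pow[of n] x unfolding osc_le_def by blast
  have "(1/2) ^ n * (\<bar>a - b\<bar> * \<bar>a' - b'\<bar>) \<le> r * (\<bar>a - b\<bar> * \<bar>a' - b'\<bar>)" for a b a' b' :: real
    using n by (intro mult_right_mono) auto
  then show ?thesis using * \<open>d > 0\<close> order_trans unfolding osc_le_def by meson
qed

end

text \<open>A coordinate that takes only the values \<open>-4\<close> and \<open>4\<close> on \<open>S\<close> separates components.\<close>

lemma joins_componentsI:
  fixes f :: "r3 \<Rightarrow> real"
  assumes "pathstart \<gamma> \<in> S" "pathfinish \<gamma> \<in> S" "continuous_on S f" "\<And>p. p \<in> S \<Longrightarrow> f p = -4 \<or> f p = 4"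
    and "f (pathstart \<gamma>) \<noteq> f (pathfinish \<gamma>)"
  shows "joins_components S \<gamma>"
proof -
  let ?C = "connected_component_set S (pathstart \<gamma>)" and ?C' = "connected_component_set S (pathfinish \<gamma>)"
  have in': "pathstart \<gamma> \<in> ?C" "pathfinish \<gamma> \<in> ?C'" using assms by auto
  have "?C \<noteq> ?C'"
  proof
    assume eq: "?C = ?C'"
    have "connected (f ` ?C)"
      by (intro connected_continuous_image continuous_on_subset[OF assms(3)] connected_component_subset)
        simp
    moreover have "{f (pathstart \<gamma>), f (pathfinish \<gamma>)} \<subseteq> f ` ?C" using in' eq by blast
    moreover have "{f (pathstart \<gamma>), f (pathfinish \<gamma>)} = {-4, 4}"
      using assms(4)[OF assms(1)] assms(4)[OF assms(2)] assms(5) by auto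
    ultimately have "-4 \<in> f ` ?C" "4 \<in> f ` ?C" "connected (f ` ?C)" by auto
    then have "0 \<in> f ` ?C" using connectedD_interval[of "f ` ?C" "-4" 4 0] by simp
    then obtain p where "p \<in> ?C" "f p = 0" by force
    then show False using assms(4)[of p] connected_component_subset[of S "pathstart \<gamma>"] by auto
  qed
  moreover have "?C \<in> components S" "?C' \<in> components S" using assms by (auto intro: componentsI)
  ultimately show ?thesis
    unfolding joins_components_def by (intro bexI[of _ ?C] bexI[of _ ?C'] conjI in')
qed

lemma frontier_Ix_Iy:
  "frontier (Ix henon_cube) = {-4, 4}" "frontier (Iy henon_cube) = {-4, 4}"
  "frontier (Iz henon_cube) = {-40, 22}"
  by (auto simp: henon_cube_intervals frontier_def)

context near_henon
begin

text \<open>The chord slopes at \<open>x\<close> form a Cauchy sequence. The limit approximates all chords near \<open>x\<close>, also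
  those that do not start in \<open>x\<close>; this gives the continuity of the tangent in the next lemma.\<close>

lemma tangent_exists:
  assumes s: "s = 1 \<or> s = -1" and x: "x \<in> {-4..4}"
  shows "\<exists>\<tau>. xc \<tau> = 1 \<and> (\<forall>r>0. \<exists>d>0. \<forall>a\<in>{-4..4}. \<forall>b\<in>{-4..4}. \<bar>a - x\<bar> < d \<longrightarrow> \<bar>b - x\<bar> < d \<longrightarrow>
     norm (wpt s a - wpt s b - (a - b) *\<^sub>R \<tau>) \<le> r * \<bar>a - b\<bar>)"
proof -
  have "\<forall>n::nat. \<exists>a\<in>{-4..4}. a \<noteq> x \<and> \<bar>a - x\<bar> < inverse (real (Suc n))"
    using interval_no_isolated_point[OF x] by (metis inverse_positive_iff_positive of_nat_0_less_iff zero_less_Suc)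
  then obtain c where c: "\<And>n. c n \<in> {-4..4}" "\<And>n. c n \<noteq> x" "\<And>n. \<bar>c n - x\<bar> < inverse (real (Suc n))"
    by metis
  have small: "\<exists>N. \<forall>n\<ge>N. \<bar>c n - x\<bar> < d" if d: "0 < d" for d
  proof -
    obtain N where N: "inverse (real (Suc N)) < d" using reals_Archimedean[OF d] by blast
    have "\<bar>c n - x\<bar> < d" if "n \<ge> N" for n
    proof -
      have "inverse (real (Suc n)) \<le> inverse (real (Suc N))" using that by (intro le_imp_inverse_le) auto
      then show ?thesis using c(3)[of n] N by linarith
    qed
    then show ?thesis by blast
  qed
  define q where "q n = (1 / (c n - x)) *\<^sub>R (wpt s (c n) - wpt s x)" for n
  have xq: "xc (q n) = 1" for n using wpt_diff(2)[OF s c(1) x, of n] c(2)[of n] by (simp add: q_def)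
  have wq: "wpt s (c n) - wpt s x = (c n - x) *\<^sub>R q n" for n using c(2)[of n] by (simp add: q_def)
  have near: "\<exists>d>0. \<exists>N. \<forall>n\<ge>N. \<forall>a\<in>{-4..4}. \<forall>b\<in>{-4..4}. \<bar>a - x\<bar> < d \<longrightarrow> \<bar>b - x\<bar> < d \<longrightarrow>
     norm (wpt s a - wpt s b - (a - b) *\<^sub>R q n) \<le> r * \<bar>a - b\<bar>" if r: "0 < r" for r
  proof -
    obtain d where d: "0 < d" "\<And>a b a' b'. \<lbrakk>a \<in> {-4..4}; b \<in> {-4..4}; a' \<in> {-4..4}; b' \<in> {-4..4};
      \<bar>a - x\<bar> < d; \<bar>b - x\<bar> < d; \<bar>a' - x\<bar> < d; \<bar>b' - x\<bar> < d\<rbrakk> \<Longrightarrow>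
      vert ((a' - b') *\<^sub>R (wpt s a - wpt s b) - (a - b) *\<^sub>R (wpt s a' - wpt s b')) \<le> r * (\<bar>a - b\<bar> * \<bar>a' - b'\<bar>)"
      using osc_le_small[OF s x r] unfolding osc_le_def by metis
    obtain N where N: "\<forall>n\<ge>N. \<bar>c n - x\<bar> < d" using small[OF d(1)] by blast
    have "norm (wpt s a - wpt s b - (a - b) *\<^sub>R q n) \<le> r * \<bar>a - b\<bar>"
      if n: "n \<ge> N" and I: "a \<in> {-4..4}" "b \<in> {-4..4}" "\<bar>a - x\<bar> < d" "\<bar>b - x\<bar> < d" for n a b
    proof -
      let ?v = "wpt s a - wpt s b - (a - b) *\<^sub>R q n"
      have "(c n - x) *\<^sub>R ?v = (c n - x) *\<^sub>R (wpt s a - wpt s b) - (a - b) *\<^sub>R (wpt s (c n) - wpt s x)"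
        unfolding wq by (simp add: scaleR_diff_right mult.commute)
      then have "\<bar>c n - x\<bar> * vert ?v \<le> r * (\<bar>a - b\<bar> * \<bar>c n - x\<bar>)"
        using d(2)[OF I(1,2) c(1)[of n] x I(3,4)] N n d(1) unfolding vert_scale[symmetric] by simp
      then have "vert ?v \<le> r * \<bar>a - b\<bar>" using c(2)[of n] by (simp add: field_simps)
      moreover have "xc ?v = 0" using wpt_diff(2)[OF s I(1,2)] xq[of n] by simp
      ultimately show ?thesis using norm_le_vert[of ?v] by linarith
    qed
    then show ?thesis using d(1) by blast
  qed
  have "Cauchy q"
  proof (rule metric_CauchyI)
    fix e :: real assume "0 < e"
    then obtain d N where dN: "0 < d" "\<forall>n\<ge>N. \<forall>a\<in>{-4..4}. \<forall>b\<in>{-4..4}. \<bar>a - x\<bar> < d \<longrightarrow> \<bar>b - x\<bar> < d \<longrightarrow>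
      norm (wpt s a - wpt s b - (a - b) *\<^sub>R q n) \<le> e / 2 * \<bar>a - b\<bar>" using near[of "e/2"] by auto
    obtain N' where N': "\<forall>n\<ge>N'. \<bar>c n - x\<bar> < d" using small[OF dN(1)] by blast
    have "dist (q m) (q n) < e" if mn: "m \<ge> max N N'" "n \<ge> max N N'" for m n
    proof -
      have "norm (wpt s (c m) - wpt s x - (c m - x) *\<^sub>R q n) \<le> e / 2 * \<bar>c m - x\<bar>"
        using dN(2) mn c(1)[of m] x N' dN(1) by auto
      then have "norm ((c m - x) *\<^sub>R (q m - q n)) \<le> e / 2 * \<bar>c m - x\<bar>"
        unfolding wq by (simp add: scaleR_diff_right)
      then have "\<bar>c m - x\<bar> * norm (q m - q n) \<le> \<bar>c m - x\<bar> * (e / 2)"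
        unfolding norm_scaleR by (simp only: mult.commute)
      moreover have "0 < \<bar>c m - x\<bar>" using c(2)[of m] by simp
      ultimately have "norm (q m - q n) \<le> e / 2" by (simp only: mult_le_cancel_left_pos)
      then show ?thesis using \<open>0 < e\<close> by (simp add: dist_norm)
    qed
    then show "\<exists>M. \<forall>m\<ge>M. \<forall>n\<ge>M. dist (q m) (q n) < e" by blast
  qed
  then obtain \<tau> where \<tau>: "q \<longlonglongrightarrow> \<tau>" using Cauchy_convergent convergent_def by blast
  have "xc \<tau> = 1"
  proof -
    have "(\<lambda>n. xc (q n)) \<longlonglongrightarrow> xc \<tau>" using \<tau> by (rule tendsto_fst)
    then show ?thesis unfolding xq by (simp add: LIMSEQ_const_iff)
  qed
  moreover have "\<exists>d>0. \<forall>a\<in>{-4..4}. \<forall>b\<in>{-4..4}. \<bar>a - x\<bar> < d \<longrightarrow> \<bar>b - x\<bar> < d \<longrightarrow>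
     norm (wpt s a - wpt s b - (a - b) *\<^sub>R \<tau>) \<le> r * \<bar>a - b\<bar>" if r: "0 < r" for r
  proof -
    obtain d N where dN: "0 < d" "\<forall>n\<ge>N. \<forall>a\<in>{-4..4}. \<forall>b\<in>{-4..4}. \<bar>a - x\<bar> < d \<longrightarrow> \<bar>b - x\<bar> < d \<longrightarrow>
      norm (wpt s a - wpt s b - (a - b) *\<^sub>R q n) \<le> r * \<bar>a - b\<bar>" using near[OF r] by auto
    have "norm (wpt s a - wpt s b - (a - b) *\<^sub>R \<tau>) \<le> r * \<bar>a - b\<bar>"
      if I: "a \<in> {-4..4}" "b \<in> {-4..4}" "\<bar>a - x\<bar> < d" "\<bar>b - x\<bar> < d" for a b
    proof (rule Lim_bounded)
      show "(\<lambda>n. norm (wpt s a - wpt s b - (a - b) *\<^sub>R q n)) \<longlonglongrightarrow> norm (wpt s a - wpt s b - (a - b) *\<^sub>R \<tau>)"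
        by (intro tendsto_intros \<tau>)
      show "\<forall>n\<ge>N. norm (wpt s a - wpt s b - (a - b) *\<^sub>R q n) \<le> r * \<bar>a - b\<bar>" using dN(2) I by blast
    qed
    then show ?thesis using dN(1) by blast
  qed
  ultimately show ?thesis by blast
qed

lemma trapped_curve_C1:
  assumes s: "s = 1 \<or> s = -1"
  obtains T where "continuous_on {-4..4} T"
    "\<And>x. x \<in> {-4..4} \<Longrightarrow> (wpt s has_vector_derivative T x) (at x within {-4..4})"
    "\<And>x. x \<in> {-4..4} \<Longrightarrow> xc (T x) = 1" "\<And>x. x \<in> {-4..4} \<Longrightarrow> vert (T x) < 1/20"
proof -
  obtain T where T: "\<And>x. x \<in> {-4..4} \<Longrightarrow> xc (T x) = 1"
    "\<And>x r. x \<in> {-4..4} \<Longrightarrow> 0 < r \<Longrightarrow> \<exists>d>0. \<forall>a\<in>{-4..4}. \<forall>b\<in>{-4..4}. \<bar>a - x\<bar> < d \<longrightarrow> \<bar>b - x\<bar> < d \<longrightarrow>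
     norm (wpt s a - wpt s b - (a - b) *\<^sub>R T x) \<le> r * \<bar>a - b\<bar>"
    using tangent_exists[OF s] by metis
  show thesis
  proof (rule that)
    fix x :: real assume x: "x \<in> {-4..4}"
    show "xc (T x) = 1" by (rule T(1)[OF x])
    show "(wpt s has_vector_derivative T x) (at x within {-4..4})"
      unfolding has_vector_derivative_def has_derivative_within_alt
    proof (intro conjI allI impI)
      show "bounded_linear (\<lambda>h. h *\<^sub>R T x)" by (rule bounded_linear_scaleR_left)
      fix e :: real assume e: "0 < e"
      obtain d where "0 < d" "\<forall>a\<in>{-4..4}. \<forall>b\<in>{-4..4}. \<bar>a - x\<bar> < d \<longrightarrow> \<bar>b - x\<bar> < d \<longrightarrow>
        norm (wpt s a - wpt s b - (a - b) *\<^sub>R T x) \<le> e * \<bar>a - b\<bar>" using T(2)[OF x e] by blast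
      then show "\<exists>d>0. \<forall>y\<in>{-4..4}. norm (y - x) < d \<longrightarrow>
        norm (wpt s y - wpt s x - (y - x) *\<^sub>R T x) \<le> e * norm (y - x)"
        using x by (intro exI[of _ d]) auto
    qed
    obtain d where d: "0 < d" "\<forall>a\<in>{-4..4}. \<forall>b\<in>{-4..4}. \<bar>a - x\<bar> < d \<longrightarrow> \<bar>b - x\<bar> < d \<longrightarrow>
        norm (wpt s a - wpt s b - (a - b) *\<^sub>R T x) \<le> 1/100 * \<bar>a - b\<bar>" using T(2)[OF x, of "1/100"] by auto
    obtain a where a: "a \<in> {-4..4}" "a \<noteq> x" "\<bar>a - x\<bar> < d" using interval_no_isolated_point[OF x d(1)] .
    let ?e = "wpt s a - wpt s x - (a - x) *\<^sub>R T x"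
    have "\<bar>a - x\<bar> * vert (T x) = vert ((wpt s a - wpt s x) - ?e)" by (simp add: vert_scale)
    also have "\<dots> \<le> vert (wpt s a - wpt s x) + vert ?e" by (rule vert_triangle)
    also have "vert ?e \<le> 2 * norm ?e" by (rule vert_le_norm)
    also have "norm ?e \<le> 1/100 * \<bar>a - x\<bar>" using d a x by auto
    also have "vert (wpt s a - wpt s x) \<le> \<bar>a - x\<bar> / 100" by (rule wpt_diff(1)[OF s a(1) x])
    finally have "\<bar>a - x\<bar> * vert (T x) \<le> \<bar>a - x\<bar> * (3/100)" by simp
    moreover have "0 < \<bar>a - x\<bar>" using a(2) by simp
    ultimately have "vert (T x) \<le> 3/100" by (simp only: mult_le_cancel_left_pos)
    then show "vert (T x) < 1/20" by simp
  next
    show "continuous_on {-4..4} T"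
      unfolding continuous_on_iff
    proof (intro ballI allI impI)
      fix x e :: real assume x: "x \<in> {-4..4}" and e: "0 < e"
      obtain d where d: "0 < d" "\<forall>a\<in>{-4..4}. \<forall>b\<in>{-4..4}. \<bar>a - x\<bar> < d \<longrightarrow> \<bar>b - x\<bar> < d \<longrightarrow>
        norm (wpt s a - wpt s b - (a - b) *\<^sub>R T x) \<le> e/4 * \<bar>a - b\<bar>" using T(2)[OF x, of "e/4"] e by auto
      have "dist (T y) (T x) < e" if y: "y \<in> {-4..4}" "dist y x < d" for y
      proof -
        obtain d' where d': "0 < d'" "\<forall>a\<in>{-4..4}. \<forall>b\<in>{-4..4}. \<bar>a - y\<bar> < d' \<longrightarrow> \<bar>b - y\<bar> < d' \<longrightarrow>
          norm (wpt s a - wpt s b - (a - b) *\<^sub>R T y) \<le> e/4 * \<bar>a - b\<bar>" using T(2)[OF y(1), of "e/4"] e by auto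
        define m where "m = min d' (d - dist y x)"
        have "0 < m" using d'(1) y(2) by (simp add: m_def)
        from interval_no_isolated_point[OF y(1) this] obtain a
          where a: "a \<in> {-4..4}" "a \<noteq> y" "\<bar>a - y\<bar> < m" .
        have ax: "\<bar>a - x\<bar> < d" "\<bar>y - x\<bar> < d" "\<bar>a - y\<bar> < d'" using a(3) y(2) by (auto simp: m_def dist_real_def)
        let ?e1 = "wpt s a - wpt s y - (a - y) *\<^sub>R T y" and ?e2 = "wpt s a - wpt s y - (a - y) *\<^sub>R T x"
        have "\<bar>a - y\<bar> * norm (T y - T x) = norm (?e2 - ?e1)"
          unfolding norm_scaleR[symmetric] by (simp add: scaleR_diff_right)
        also have "\<dots> \<le> norm ?e2 + norm ?e1" by (rule norm_triangle_ineq4)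
        also have "\<dots> \<le> e/4 * \<bar>a - y\<bar> + e/4 * \<bar>a - y\<bar>"
          using d(2) d'(2) a(1) y(1) ax d'(1) by (intro add_mono) auto
        also have "\<dots> = \<bar>a - y\<bar> * (e/2)" by simp
        finally have "\<bar>a - y\<bar> * norm (T y - T x) \<le> \<bar>a - y\<bar> * (e/2)" .
        moreover have "0 < \<bar>a - y\<bar>" using a(2) by simp
        ultimately have "norm (T y - T x) \<le> e/2" by (simp only: mult_le_cancel_left_pos)
        then show ?thesis using e by (simp add: dist_norm)
      qed
      then show "\<exists>d>0. \<forall>y\<in>{-4..4}. dist y x < d \<longrightarrow> dist (T y) (T x) < e" using d(1) by blast
    qed
  qed
qed

lemma trapped_in_Delta: "p \<in> trapped s \<Longrightarrow> p \<in> \<Delta>"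
  using trapped_branch[of p s] by (simp add: branch_def)

lemma trapped_interior:
  assumes "p \<in> trapped s"
  shows "-4 < yc p" "yc p < 4" "-40 < zc p" "zc p < 22"
  using return_interior[OF trapped_in_Delta trapped_in_Delta] assms trapped_image by blast+

lemma trapped_inner_s_disc:
  assumes s: "s = 1 \<or> s = -1"
  shows "inner_s_disc henon_cube (1/20) (trapped s)"
proof -
  obtain T where T: "continuous_on {-4..4} T"
    "\<And>x. x \<in> {-4..4} \<Longrightarrow> (wpt s has_vector_derivative T x) (at x within {-4..4})"
    "\<And>x. x \<in> {-4..4} \<Longrightarrow> xc (T x) = 1" "\<And>x. x \<in> {-4..4} \<Longrightarrow> vert (T x) < 1/20"
    by (rule trapped_curve_C1[OF s]) blast
  define g :: "real \<Rightarrow> real" where "g t = 8 * t - 4" for t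
  have gI: "g ` {0..1} = {-4..4}"
  proof -
    have "x \<in> g ` {0..1}" if "x \<in> {-4..4}" for x
      using that by (intro image_eqI[of _ _ "(x + 4) / 8"]) (auto simp: g_def field_simps)
    then show ?thesis by (auto simp: g_def)
  qed
  then have gI': "g t \<in> {-4..4}" if "t \<in> {0..1}" for t using that by blast
  define \<gamma> where "\<gamma> = wpt s \<circ> g"
  have xg: "xc (\<gamma> t) = g t" if "t \<in> {0..1}" for t using wpt(2)[OF s gI'[OF that]] by (simp add: \<gamma>_def)
  have im: "path_image \<gamma> = trapped s"
    unfolding path_image_def \<gamma>_def image_comp[symmetric] gI trapped_image_wpt[OF s] ..
  have cg: "continuous_on {0..1} g" unfolding g_def by (intro continuous_intros)
  have "path \<gamma>"
    unfolding path_def \<gamma>_def using cg gI continuous_wpt[OF s] by (intro continuous_on_compose) auto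
  moreover have "inj_on \<gamma> {0..1}"
    by (rule inj_onI) (metis xg g_def add_diff_cancel_left' diff_add_cancel mult_cancel_left zero_neq_numeral)
  ultimately have arc: "arc \<gamma>" by (simp add: arc_def)
  have der: "(\<gamma> has_vector_derivative 8 *\<^sub>R T (g t)) (at t within {0..1})" if t: "t \<in> {0..1}" for t
  proof -
    have "(g has_vector_derivative 8) (at t within {0..1})"
      unfolding g_def by (auto intro!: derivative_eq_intros simp: has_real_derivative_iff_has_vector_derivative[symmetric])
    from vector_diff_chain_within[OF this, of "wpt s" "T (g t)"] T(2)[OF gI'[OF t]]
    show ?thesis unfolding \<gamma>_def gI by simp
  qed
  have "8 *\<^sub>R T (g t) \<in> cone_s (1/20)" if t: "t \<in> {0..1}" for t
    using T(3,4)[OF gI'[OF t]] by (intro cone_sI) (simp add: vert_scale)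
  moreover have "8 *\<^sub>R T (g t) \<noteq> 0" if t: "t \<in> {0..1}" for t
    using T(3)[OF gI'[OF t]] by (metis fst_zero scaleR_eq_0_iff zero_neq_numeral zero_neq_one)
  moreover have "continuous_on {0..1} (\<lambda>t. 8 *\<^sub>R T (g t))"
    by (rule continuous_on_scaleR[OF continuous_on_const continuous_on_compose2[OF T(1) cg]]) (use gI in simp)
  ultimately have reg: "regular_arc_tangent (cone_s (1/20)) \<gamma>"
    unfolding regular_arc_tangent_def using arc der by blast
  have ends: "xc (pathstart \<gamma>) = -4" "xc (pathfinish \<gamma>) = 4"
    using xg[of 0] xg[of 1] by (auto simp: pathstart_def pathfinish_def g_def)
  have endin: "pathstart \<gamma> \<in> trapped s" "pathfinish \<gamma> \<in> trapped s" unfolding im[symmetric] by auto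
  have bd: "p \<in> bd_s henon_cube" if "p \<in> trapped s" "xc p = -4 \<or> xc p = 4" for p
    using trapped_interior[OF that(1)] that(2) unfolding bd_s_def frontier_Ix_Iy
    by (cases p; cases "snd p") (auto simp: henon_cube_intervals)
  have "joins_components (bd_s henon_cube) \<gamma>"
  proof (rule joins_componentsI[where f = xc])
    show "continuous_on (bd_s henon_cube) xc" by (intro continuous_intros)
    show "xc p = -4 \<or> xc p = 4" if "p \<in> bd_s henon_cube" for p
      using that unfolding bd_s_def frontier_Ix_Iy by auto
  qed (use bd endin ends in auto)
  moreover have "path_image \<gamma> \<subseteq> \<Delta>" unfolding im using trapped_in_Delta by blast
  moreover have "trapped s - {pathstart \<gamma>, pathfinish \<gamma>} \<subseteq> interior \<Delta>"
  proof
    fix p assume p: "p \<in> trapped s - {pathstart \<gamma>, pathfinish \<gamma>}"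
    have eq: "p = q" if "q \<in> trapped s" "xc p = xc q" for q
      using trapped_eq_wpt[OF s] p that by (metis Diff_iff)
    have "xc p \<noteq> -4" "xc p \<noteq> 4" using eq[OF endin(1)] eq[OF endin(2)] p ends by auto
    then show "p \<in> interior \<Delta>"
      using p trapped_x[of p s] trapped_interior[of p s] unfolding interior_Delta by auto
  qed
  ultimately show ?thesis unfolding inner_s_disc_def s_arc_def using reg im by blast
qed

lemma cone_u_vertical: "xc v = 0 \<Longrightarrow> v \<noteq> 0 \<Longrightarrow> v \<in> cone_u (1/2)"
  by (cases v; cases "snd v") (auto simp: cone_u_def sum_power2_gt_zero_iff zero_prod_def)

section \<open>The reference saddles\<close>

text \<open>\<open>F\<close> maps the trapped curve into itself and fixes the saddle, so by the chain rule \<open>DF\<close> maps its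
  tangent there to a multiple of itself.\<close>

lemma saddle_eigenvector:
  assumes s: "s = 1 \<or> s = -1"
  obtains \<tau> k where "xc \<tau> = 1" "vert \<tau> < 1/20" "DF henon_cube F (saddle s) \<tau> = k *\<^sub>R \<tau>"
proof -
  let ?x = "xc (saddle s)" and ?M = "DF henon_cube F (saddle s)" and ?I = "{-4..4::real}"
  have x: "?x \<in> ?I" by (rule trapped_x[OF saddle(1)[OF s]])
  have w: "wpt s ?x = saddle s" using trapped_eq_wpt[OF s saddle(1)[OF s]] by simp
  obtain T where T: "(wpt s has_vector_derivative T ?x) (at ?x within ?I)" "xc (T ?x) = 1" "vert (T ?x) < 1/20"
    by (rule trapped_curve_C1[OF s]) (use x in blast)
  define \<tau> where "\<tau> = T ?x"
  define \<phi> where "\<phi> a = xc (F (wpt s a))" for a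
  have D: "wpt s ` ?I \<subseteq> \<Delta>" using wpt(1)[OF s] trapped_in_Delta by blast
  have "(F has_derivative ?M) (at (wpt s ?x) within wpt s ` ?I)"
    unfolding w using has_DF[OF trapped_in_Delta[OF saddle(1)[OF s]]] D by (rule has_derivative_subset)
  from has_derivative_in_compose[OF T(1)[unfolded has_vector_derivative_def] this]
  have "((\<lambda>a. F (wpt s a)) has_derivative (\<lambda>h. ?M (h *\<^sub>R \<tau>))) (at ?x within ?I)" by (simp add: \<tau>_def)
  moreover have "?M (h *\<^sub>R \<tau>) = h *\<^sub>R ?M \<tau>" for h
    using linear_DF[OF trapped_in_Delta[OF saddle(1)[OF s]]] by (rule linear_scale)
  ultimately have dF: "((\<lambda>a. F (wpt s a)) has_vector_derivative ?M \<tau>) (at ?x within ?I)"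
    unfolding has_vector_derivative_def by simp
  then have d\<phi>: "(\<phi> has_vector_derivative xc (?M \<tau>)) (at ?x within ?I)"
    unfolding \<phi>_def has_vector_derivative_def by (auto dest!: has_derivative_fst)
  have \<phi>x: "\<phi> ?x = ?x" unfolding \<phi>_def w saddle(2)[OF s] ..
  have \<phi>I: "\<phi> ` ?I \<subseteq> ?I" using trapped_next(1)[OF s] unfolding \<phi>_def by blast
  have "(wpt s has_vector_derivative \<tau>) (at (\<phi> ?x) within \<phi> ` ?I)"
    unfolding \<phi>x \<tau>_def using T(1) \<phi>I by (rule has_vector_derivative_within_subset)
  from vector_diff_chain_within[OF d\<phi> this]
  have "(wpt s \<circ> \<phi> has_vector_derivative xc (?M \<tau>) *\<^sub>R \<tau>) (at ?x within ?I)" .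
  then have "((\<lambda>a. F (wpt s a)) has_vector_derivative xc (?M \<tau>) *\<^sub>R \<tau>) (at ?x within ?I)"
    using x trapped_next(2)[OF s] by (rule_tac has_vector_derivative_transform) (auto simp: \<phi>_def)
  then have "?M \<tau> = xc (?M \<tau>) *\<^sub>R \<tau>"
    using vector_derivative_unique_within_closed_interval[of "-4" 4 ?x, OF _ _ _ _] dF x
    by (metis cbox_interval numeral_less_real_of_nat_iff neg_less_pos vector_derivative_unique_within_closed_interval zero_less_numeral)
  then show thesis using that T(2,3) unfolding \<tau>_def by blast
qed

text \<open>Let \<open>M\<close> be the derivative at the saddle, \<open>\<tau>\<close> the stable eigenvector with eigenvalue \<open>k\<close>, and
  \<open>N = M - k\<close>. Vertical vectors lie in the unstable cone and grow under \<open>M\<close>, whereas \<open>\<tau>\<close> shrinks. The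
  unstable space is the image of the vertical plane under \<open>N\<close>: it is invariant because \<open>N\<close> commutes
  with \<open>M\<close> and annihilates \<open>\<tau>\<close>, it inherits the growth since \<open>\<bar>N u\<bar> \<ge> (c - \<bar>k\<bar>) \<bar>u\<bar>\<close> on the unstable
  cone, and it is complementary to \<open>\<tau>\<close>, because \<open>N w\<close> being a multiple of \<open>\<tau>\<close> would make the growing
  orbit of \<open>N w\<close> bounded. As \<open>M\<close> may be singular, its inverse is avoided throughout.\<close>

lemma saddle_fixed_saddle:
  assumes s: "s = 1 \<or> s = -1"
  shows "fixed_saddle henon_cube F (saddle s)"
proof -
  let ?R = "saddle s" and ?c = "101/100 :: real"
  define M where "M = DF henon_cube F ?R"
  have R: "?R \<in> \<Delta>" by (rule trapped_in_Delta[OF saddle(1)[OF s]])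
  obtain \<tau> k where \<tau>: "xc \<tau> = 1" "vert \<tau> < 1/20" "M \<tau> = k *\<^sub>R \<tau>"
    using saddle_eigenvector[OF s] unfolding M_def by metis
  have lin: "linear M" unfolding M_def by (rule linear_DF[OF R])
  then have linn: "linear (M ^^ n)" for n
    by (induction n) (auto intro: linear_compose[unfolded o_def] simp: linear_id[unfolded id_def] id_def o_def)
  have mb: "4 \<le> \<bar>2 * yc ?R\<bar>" "\<bar>2 * yc ?R\<bar> \<le> 8"
    using branch_bounds[OF s trapped_branch[OF saddle(1)[OF s]]] s by auto
  have st: "near_step \<xi> (2 * yc ?R) v (M v)" for v unfolding M_def by (rule DF_near_step[OF R])
  have \<tau>0: "\<tau> \<noteq> 0" using \<tau>(1) by auto
  have "\<tau> \<in> cone_s (1/20)" using \<tau>(1,2) by (intro cone_sI) simp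
  then have "norm (M \<tau>) \<le> inverse ?c * norm \<tau>" by (rule near_step_cone_s(2)[OF st mb \<xi>])
  then have k: "\<bar>k\<bar> \<le> inverse ?c" using \<tau>0 unfolding \<tau>(3) by simp
  then have k1: "0 < ?c - \<bar>k\<bar>" by simp
  have iter\<tau>: "(M ^^ n) (a *\<^sub>R \<tau>) = (k ^ n * a) *\<^sub>R \<tau>" for n a
    using lin by (induction n) (auto simp: linear_scale \<tau>(3))
  define N where "N v = M v - k *\<^sub>R v" for v
  have linN: "linear N" unfolding N_def using lin by (intro linear_compose_sub linear_scale_self) auto
  have N\<tau>: "N (a *\<^sub>R \<tau>) = 0" for a using lin by (simp add: N_def linear_scale \<tau>(3))
  have comm: "(M ^^ n) (N v) = N ((M ^^ n) v)" for n v
    using lin by (induction n) (auto simp: N_def linear_diff linear_scale)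
  have grow: "?c ^ n * norm w \<le> norm ((M ^^ n) w) \<and> (w \<noteq> 0 \<longrightarrow> (M ^^ n) w \<in> cone_u (1/2))" if w: "xc w = 0" for n w
  proof (induction n)
    case 0 then show ?case using cone_u_vertical[OF w] by simp
  next
    case (Suc n)
    show ?case
    proof (cases "w = 0")
      case True then show ?thesis by simp
    next
      case False
      then have c: "(M ^^ n) w \<in> cone_u (1/2)" using Suc by blast
      have "?c ^ Suc n * norm w = ?c * (?c ^ n * norm w)" by simp
      also have "\<dots> \<le> ?c * norm ((M ^^ n) w)" using Suc by (intro mult_left_mono) auto
      also have "\<dots> \<le> norm (M ((M ^^ n) w))" by (rule near_step_cone_u(2)[OF st mb \<xi> c])
      finally show ?thesis using near_step_cone_u(1)[OF st mb \<xi> c] by simp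
    qed
  qed
  have growN: "(?c - \<bar>k\<bar>) * (?c ^ n * norm w) \<le> norm ((M ^^ n) (N w))" if w: "xc w = 0" for n w
  proof (cases "w = 0")
    case True then show ?thesis by simp
  next
    case False
    let ?u = "(M ^^ n) w"
    have c: "?u \<in> cone_u (1/2)" using grow[OF w] False by blast
    have "(?c - \<bar>k\<bar>) * (?c ^ n * norm w) \<le> (?c - \<bar>k\<bar>) * norm ?u"
      using grow[OF w, of n] k1 by (intro mult_left_mono) auto
    also have "\<dots> = ?c * norm ?u - norm (k *\<^sub>R ?u)" by (simp add: left_diff_distrib)
    also have "\<dots> \<le> norm (M ?u) - norm (k *\<^sub>R ?u)" using near_step_cone_u(2)[OF st mb \<xi> c] by simp
    also have "\<dots> \<le> norm (N ?u)" unfolding N_def by (rule norm_triangle_ineq2)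
    finally show ?thesis unfolding comm .
  qed
  have indep: "u = 0 \<and> w = 0" if w: "xc w = 0" and eq: "u *\<^sub>R \<tau> + N w = 0" for u w
  proof -
    have Nw: "N w = (- u) *\<^sub>R \<tau>" using eq by (simp add: add_eq_0_iff)
    have "w = 0"
    proof (rule ccontr)
      assume w0: "w \<noteq> 0"
      define K where "K = (?c - \<bar>k\<bar>) * norm w"
      have K: "0 < K" using k1 w0 by (simp add: K_def)
      have "?c ^ n * K \<le> \<bar>u\<bar> * norm \<tau>" for n
      proof -
        have "\<bar>k\<bar> ^ n \<le> 1" using k by (intro power_le_one) auto
        then have "\<bar>k\<bar> ^ n * (\<bar>u\<bar> * norm \<tau>) \<le> 1 * (\<bar>u\<bar> * norm \<tau>)" by (intro mult_right_mono) auto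
        then show ?thesis
          using growN[OF w, of n] unfolding Nw iter\<tau> K_def by (simp add: abs_mult power_abs mult.assoc mult.left_commute)
      qed
      moreover obtain n where "\<bar>u\<bar> * norm \<tau> / K < ?c ^ n"
        using real_arch_pow[of ?c] by auto
      then have "\<bar>u\<bar> * norm \<tau> < ?c ^ n * K" by (simp only: pos_divide_less_eq[OF K])
      ultimately show False by (meson not_le)
    qed
    moreover from this have "u *\<^sub>R \<tau> = 0" using eq linN by (simp add: linear_0)
    ultimately show ?thesis using \<tau>0 by simp
  qed
  define Es where "Es = span {\<tau>}"
  define V where "V = {v :: r3. xc v = 0}"
  define Eu where "Eu = N ` V"
  have V: "subspace V" by (auto simp: V_def subspace_def)
  have Es: "v \<in> Es \<longleftrightarrow> (\<exists>a. v = a *\<^sub>R \<tau>)" for v by (auto simp: Es_def span_singleton)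
  \<comment> \<open>\<open>L\<close> combines the two spaces; it is onto because it is injective in dimension three.\<close>
  define L where "L v = xc v *\<^sub>R \<tau> + N (0, snd v)" for v
  have linL: "linear L"
  proof (rule linearI)
    fix v w :: r3 and a :: real
    have eq: "(0 :: real, snd (v + w)) = (0, snd v) + (0, snd w)"
      "(0 :: real, snd (a *\<^sub>R v)) = a *\<^sub>R (0, snd v)"
      by (simp_all add: prod_eq_iff)
    have "N (0, snd (v + w)) = N (0, snd v) + N (0, snd w)" "N (0, snd (a *\<^sub>R v)) = a *\<^sub>R N (0, snd v)"
      unfolding eq using linN by (rule linear_add linear_scale)+
    then show "L (v + w) = L v + L w" "L (a *\<^sub>R v) = a *\<^sub>R L v"
      unfolding L_def by (simp_all only: fst_add fst_scaleR scaleR_add_left scaleR_add_right scaleR_scaleR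
          real_scaleR_def add_ac)
  qed
  have "inj L"
  proof (rule linear_injective_0[OF linL, THEN iffD2], intro allI impI)
    fix v assume "L v = 0"
    then have "xc v = 0 \<and> (0, snd v) = (0 :: r3)" unfolding L_def by (intro indep) auto
    then show "v = 0" by (simp add: prod_eq_iff)
  qed
  then have surj: "surj L" by (rule linear_inj_imp_surj[OF linL])
  have sum: "{a + b | a b. a \<in> Es \<and> b \<in> Eu} = UNIV"
  proof -
    have "v \<in> {a + b | a b. a \<in> Es \<and> b \<in> Eu}" for v
    proof -
      obtain w where "v = L w" using surj by (metis surjD)
      then have "v = xc w *\<^sub>R \<tau> + N (0, snd w)" by (simp add: L_def)
      moreover have "xc w *\<^sub>R \<tau> \<in> Es" "N (0, snd w) \<in> Eu" by (auto simp: Es Eu_def V_def)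
      ultimately show ?thesis by blast
    qed
    then show ?thesis by blast
  qed
  have "Es \<inter> Eu = {0}"
  proof -
    have "v = 0" if "v \<in> Es" "v \<in> Eu" for v
    proof -
      obtain a w where "v = a *\<^sub>R \<tau>" "v = N w" "xc w = 0" using \<open>v \<in> Es\<close> \<open>v \<in> Eu\<close> by (auto simp: Es Eu_def V_def)
      then have "(- a) *\<^sub>R \<tau> + N w = 0" by (metis add.left_inverse scaleR_minus_left)
      from indep[OF \<open>xc w = 0\<close> this] show ?thesis using \<open>v = a *\<^sub>R \<tau>\<close> by simp
    qed
    moreover have "subspace Eu" unfolding Eu_def by (rule linear_subspace_image[OF linN V])
    ultimately show ?thesis using subspace_0 by (auto simp: Es_def span_0)
  qed
  moreover have "subspace Es" "subspace Eu"
    unfolding Es_def Eu_def by (auto intro: linear_subspace_image[OF linN V])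
  moreover have "Es \<noteq> {0}" using \<tau>0 Es[of \<tau>] by (metis scaleR_one singletonD)
  moreover have "Eu \<noteq> {0}"
  proof
    assume "Eu = {0}"
    then have "N (0, 1, 0) = 0" by (auto simp: Eu_def V_def)
    with indep[of "(0, 1, 0)" 0] show False by (simp add: zero_prod_def)
  qed
  moreover have "M ` Es \<subseteq> Es" using iter\<tau>[of 1] by (auto simp: Es)
  moreover have "M ` Eu \<subseteq> Eu"
  proof
    fix v assume "v \<in> M ` Eu"
    then obtain w where w: "xc w = 0" "v = M (N w)" by (auto simp: Eu_def V_def)
    have "v = N (M w - xc (M w) *\<^sub>R \<tau>)"
      using comm[of 1 w] linN N\<tau> by (simp add: w(2) linear_diff)
    moreover have "xc (M w - xc (M w) *\<^sub>R \<tau>) = 0" using \<tau>(1) by simp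
    ultimately show "v \<in> Eu" by (auto simp: Eu_def V_def)
  qed
  moreover have "\<exists>C>0. \<exists>r. 0 < r \<and> r < 1 \<and>
           (\<forall>n. \<forall>v\<in>Es. norm ((M ^^ n) v) \<le> C * r ^ n * norm v) \<and>
           (\<forall>n. \<forall>v\<in>Eu. norm v \<le> C * r ^ n * norm ((M ^^ n) v))"
  proof -
    obtain B where B: "0 < B" "\<And>v. norm (N v) \<le> B * norm v" using linear_bounded_pos[OF linN] by blast
    define C where "C = max 1 (B / (?c - \<bar>k\<bar>))"
    have "norm ((M ^^ n) v) \<le> C * inverse ?c ^ n * norm v" if vE: "v \<in> Es" for n v
    proof -
      obtain a where a: "v = a *\<^sub>R \<tau>" using vE by (auto simp: Es)
      have "norm ((M ^^ n) v) = \<bar>k\<bar> ^ n * norm v" unfolding a iter\<tau> by (simp add: abs_mult power_abs mult.assoc)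
      also have "\<dots> \<le> inverse ?c ^ n * norm v" using k by (intro mult_right_mono power_mono) auto
      also have "\<dots> \<le> C * (inverse ?c ^ n * norm v)"
        by (rule mult_right_mono[of 1 C, unfolded mult_1_left]) (auto simp: C_def)
      finally show ?thesis by (simp add: mult.assoc)
    qed
    moreover have "norm v \<le> C * inverse ?c ^ n * norm ((M ^^ n) v)" if vE: "v \<in> Eu" for n v
    proof -
      obtain w where w: "xc w = 0" "v = N w" using vE by (auto simp: Eu_def V_def)
      have "norm v \<le> B * norm w" unfolding w by (rule B(2))
      also have "\<dots> = B / (?c - \<bar>k\<bar>) * (inverse ?c ^ n * ((?c - \<bar>k\<bar>) * (?c ^ n * norm w)))"
      proof -
        have "inverse ?c ^ n * ?c ^ n = 1" by (simp flip: power_mult_distrib)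
        moreover have "B / (?c - \<bar>k\<bar>) * (i * ((?c - \<bar>k\<bar>) * (j * m))) = B * m * (i * j)" for i j m :: real
          using k1 by simp
        ultimately show ?thesis by simp
      qed
      also have "\<dots> \<le> B / (?c - \<bar>k\<bar>) * (inverse ?c ^ n * norm ((M ^^ n) v))"
        using growN[OF w(1), of n] B(1) k1 unfolding w(2) by (intro mult_left_mono) auto
      also have "\<dots> \<le> C * (inverse ?c ^ n * norm ((M ^^ n) v))"
        by (intro mult_right_mono) (auto simp: C_def)
      finally show ?thesis by (simp add: mult.assoc)
    qed
    moreover have "0 < C" by (simp add: C_def)
    ultimately show ?thesis by (intro exI[of _ C] conjI exI[of _ "inverse ?c"]) auto
  qed
  ultimately show ?thesis
    unfolding fixed_saddle_def M_def[symmetric] using R saddle(2)[OF s] sum by blast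
qed

end

section \<open>Discs in the strong unstable direction\<close>

lemma increasing_within_if_derivative_pos:
  fixes f f' :: "real \<Rightarrow> real"
  assumes der: "\<And>t. t \<in> {0..1} \<Longrightarrow> (f has_real_derivative f' t) (at t within {0..1})"
    and ab: "a \<in> {0..1}" "b \<in> {0..1}" "a < b"
  shows "(\<And>t. t \<in> {0..1} \<Longrightarrow> 0 \<le> f' t) \<Longrightarrow> f a \<le> f b"
    and "(\<And>t. t \<in> {0..1} \<Longrightarrow> 0 < f' t) \<Longrightarrow> f a < f b"
proof -
  have "\<exists>x\<in>{a<..<b}. f b - f a = f' x * (b - a)"
  proof (rule mvt_simple[OF ab(3)])
    fix x assume "a \<le> x" "x \<le> b"
    then have "(f has_real_derivative f' x) (at x within {a..b})"
      using der[of x] ab by (auto intro: DERIV_subset)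
    then show "(f has_derivative (*) (f' x)) (at x within {a..b})"
      by (simp add: has_field_derivative_def)
  qed
  then obtain x where x': "x \<in> {a<..<b}" and x2: "f b - f a = f' x * (b - a)" by blast
  then have x: "x \<in> {0..1}" "f b - f a = f' x * (b - a)" using ab by auto
  show "f a \<le> f b" if "\<And>t. t \<in> {0..1} \<Longrightarrow> 0 \<le> f' t"
    using mult_nonneg_nonneg[OF that[OF x(1)], of "b - a"] x(2) ab(3) by simp
  show "f a < f b" if "\<And>t. t \<in> {0..1} \<Longrightarrow> 0 < f' t"
    using mult_pos_pos[OF that[OF x(1)], of "b - a"] x(2) ab(3) by simp
qed

lemma cone_uu_bounds:
  assumes "v \<in> cone_uu (1/2)"
  shows "2 * \<bar>xc v\<bar> \<le> \<bar>yc v\<bar>" "2 * \<bar>zc v\<bar> \<le> \<bar>yc v\<bar>" "yc v \<noteq> 0"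
proof -
  have "sqrt ((xc v)\<^sup>2 + (zc v)\<^sup>2) < 1/2 * \<bar>yc v\<bar>" using assms by (auto simp: cone_uu_def)
  moreover have "\<bar>xc v\<bar> \<le> sqrt ((xc v)\<^sup>2 + (zc v)\<^sup>2)" "\<bar>zc v\<bar> \<le> sqrt ((xc v)\<^sup>2 + (zc v)\<^sup>2)"
    by (auto intro!: real_le_rsqrt)
  moreover have "0 \<le> sqrt ((xc v)\<^sup>2 + (zc v)\<^sup>2)" by simp
  ultimately show "2 * \<bar>xc v\<bar> \<le> \<bar>yc v\<bar>" "2 * \<bar>zc v\<bar> \<le> \<bar>yc v\<bar>" "yc v \<noteq> 0" by linarith+
qed

lemma has_vector_derivative_coords:
  assumes "(\<gamma> has_vector_derivative v) F"
  shows "((\<lambda>t. xc (\<gamma> t)) has_real_derivative xc v) F"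
    "((\<lambda>t. yc (\<gamma> t)) has_real_derivative yc v) F"
    "((\<lambda>t. zc (\<gamma> t)) has_real_derivative zc v) F"
proof -
  note d = assms[unfolded has_vector_derivative_def]
  show "((\<lambda>t. xc (\<gamma> t)) has_real_derivative xc v) F"
    using has_derivative_fst[OF d]
    unfolding has_real_derivative_iff_has_vector_derivative has_vector_derivative_def by simp
  show "((\<lambda>t. yc (\<gamma> t)) has_real_derivative yc v) F"
    using has_derivative_fst[OF has_derivative_snd[OF d]]
    unfolding has_real_derivative_iff_has_vector_derivative has_vector_derivative_def by simp
  show "((\<lambda>t. zc (\<gamma> t)) has_real_derivative zc v) F"
    using has_derivative_snd[OF has_derivative_snd[OF d]]
    unfolding has_real_derivative_iff_has_vector_derivative has_vector_derivative_def by simp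
qed

text \<open>The derivative of \<open>y\<close> never vanishes, so \<open>y\<close> is strictly monotone, and the cone condition makes
  \<open>y \<plusminus> 2 x\<close> and \<open>y \<plusminus> 2 z\<close> monotone in the same direction.\<close>

lemma cone_uu_curve_monotone:
  assumes der: "\<And>t. t \<in> {0..1} \<Longrightarrow> (\<gamma> has_vector_derivative \<gamma>' t) (at t within {0..1})"
    and cont: "continuous_on {0..1} \<gamma>'" and cone: "\<And>t. t \<in> {0..1} \<Longrightarrow> \<gamma>' t \<in> cone_uu (1/2)"
  obtains \<sigma> :: real where "\<sigma> = 1 \<or> \<sigma> = -1"
    "\<And>a b. \<lbrakk>a \<in> {0..1}; b \<in> {0..1}; a < b\<rbrakk> \<Longrightarrow> \<sigma> * yc (\<gamma> a) < \<sigma> * yc (\<gamma> b)"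
    "\<And>a b. \<lbrakk>a \<in> {0..1}; b \<in> {0..1}\<rbrakk> \<Longrightarrow>
       2 * \<bar>xc (\<gamma> a) - xc (\<gamma> b)\<bar> \<le> \<bar>yc (\<gamma> a) - yc (\<gamma> b)\<bar> \<and>
       2 * \<bar>zc (\<gamma> a) - zc (\<gamma> b)\<bar> \<le> \<bar>yc (\<gamma> a) - yc (\<gamma> b)\<bar>"
proof -
  note b = cone_uu_bounds[OF cone]
  have "connected ((\<lambda>t. yc (\<gamma>' t)) ` {0..1})"
    by (intro connected_continuous_image continuous_intros cont) simp
  moreover have "0 \<notin> (\<lambda>t. yc (\<gamma>' t)) ` {0..1}" using b(3) by force
  ultimately have "(\<forall>t\<in>{0..1}. 0 < yc (\<gamma>' t)) \<or> (\<forall>t\<in>{0..1}. yc (\<gamma>' t) < 0)"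
    using connectedD_interval[of "(\<lambda>t. yc (\<gamma>' t)) ` {0..1}" _ _ 0]
    by (metis (no_types, lifting) imageI linorder_le_cases order_le_less)
  then obtain \<sigma> :: real where \<sigma>: "\<sigma> = 1 \<or> \<sigma> = -1" "\<And>t. t \<in> {0..1} \<Longrightarrow> 0 < \<sigma> * yc (\<gamma>' t)"
    by (metis mult_1 mult_minus1 neg_0_less_iff_less)
  have ab\<sigma>: "\<bar>yc (\<gamma>' t)\<bar> = \<sigma> * yc (\<gamma>' t)" if "t \<in> {0..1}" for t
    using \<sigma>(1) \<sigma>(2)[OF that] by auto
  have inc: "\<sigma> * yc (\<gamma> a) < \<sigma> * yc (\<gamma> b)" if "a \<in> {0..1}" "b \<in> {0..1}" "a < b" for a b
    by (rule increasing_within_if_derivative_pos(2)[where f' = "\<lambda>t. \<sigma> * yc (\<gamma>' t)", OF _ that \<sigma>(2)])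
      (intro DERIV_cmult has_vector_derivative_coords der)
  have slope: "2 * \<bar>xc (\<gamma> a) - xc (\<gamma> b)\<bar> \<le> \<sigma> * yc (\<gamma> b) - \<sigma> * yc (\<gamma> a) \<and>
       2 * \<bar>zc (\<gamma> a) - zc (\<gamma> b)\<bar> \<le> \<sigma> * yc (\<gamma> b) - \<sigma> * yc (\<gamma> a)" if "a \<in> {0..1}" "b \<in> {0..1}" "a < b" for a b
  proof -
    have *: "2 * \<bar>f a - f b\<bar> \<le> \<sigma> * yc (\<gamma> b) - \<sigma> * yc (\<gamma> a)"
      if f: "\<And>t. t \<in> {0..1} \<Longrightarrow> (f has_real_derivative f' t) (at t within {0..1})"
        and f': "\<And>t. t \<in> {0..1} \<Longrightarrow> 2 * \<bar>f' t\<bar> \<le> \<bar>yc (\<gamma>' t)\<bar>" for f f' :: "real \<Rightarrow> real"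
    proof -
      have "\<sigma> * yc (\<gamma> a) + 2 * f a \<le> \<sigma> * yc (\<gamma> b) + 2 * f b"
      proof (rule increasing_within_if_derivative_pos(1)[where f' = "\<lambda>t. \<sigma> * yc (\<gamma>' t) + 2 * f' t", OF _ \<open>a \<in> _\<close> \<open>b \<in> _\<close> \<open>a < b\<close>])
        show "((\<lambda>t. \<sigma> * yc (\<gamma> t) + 2 * f t) has_real_derivative \<sigma> * yc (\<gamma>' t) + 2 * f' t) (at t within {0..1})"
          if "t \<in> {0..1}" for t
          by (intro DERIV_add DERIV_cmult has_vector_derivative_coords der f that)
        show "0 \<le> \<sigma> * yc (\<gamma>' t) + 2 * f' t" if "t \<in> {0..1}" for t
          using f'[OF that] ab\<sigma>[OF that] by linarith
      qed
      moreover have "\<sigma> * yc (\<gamma> a) - 2 * f a \<le> \<sigma> * yc (\<gamma> b) - 2 * f b"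
      proof (rule increasing_within_if_derivative_pos(1)[where f' = "\<lambda>t. \<sigma> * yc (\<gamma>' t) - 2 * f' t", OF _ \<open>a \<in> _\<close> \<open>b \<in> _\<close> \<open>a < b\<close>])
        show "((\<lambda>t. \<sigma> * yc (\<gamma> t) - 2 * f t) has_real_derivative \<sigma> * yc (\<gamma>' t) - 2 * f' t) (at t within {0..1})"
          if "t \<in> {0..1}" for t
          by (intro DERIV_diff DERIV_cmult has_vector_derivative_coords der f that)
        show "0 \<le> \<sigma> * yc (\<gamma>' t) - 2 * f' t" if "t \<in> {0..1}" for t
          using f'[OF that] ab\<sigma>[OF that] by linarith
      qed
      ultimately show ?thesis by (auto simp: abs_if)
    qed
    show ?thesis
      using *[OF has_vector_derivative_coords(1)[OF der] b(1)] *[OF has_vector_derivative_coords(3)[OF der] b(2)] by blast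
  qed
  have slope': "2 * \<bar>xc (\<gamma> a) - xc (\<gamma> b)\<bar> \<le> \<bar>yc (\<gamma> a) - yc (\<gamma> b)\<bar> \<and>
       2 * \<bar>zc (\<gamma> a) - zc (\<gamma> b)\<bar> \<le> \<bar>yc (\<gamma> a) - yc (\<gamma> b)\<bar>" if ab: "a \<in> {0..1}" "b \<in> {0..1}" for a b
  proof -
    have le: "\<sigma> * u - \<sigma> * v \<le> \<bar>u - v\<bar>" "\<sigma> * u - \<sigma> * v \<le> \<bar>v - u\<bar>" for u v using \<sigma>(1) by auto
    consider "a < b" | "b < a" | "a = b" by linarith
    then show ?thesis
    proof cases
      case 1 then show ?thesis using slope[OF ab 1] le(2)[of "yc (\<gamma> b)" "yc (\<gamma> a)"] by (meson order_trans)
    next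
      case 2
      then have "2 * \<bar>xc (\<gamma> b) - xc (\<gamma> a)\<bar> \<le> \<bar>yc (\<gamma> a) - yc (\<gamma> b)\<bar> \<and>
        2 * \<bar>zc (\<gamma> b) - zc (\<gamma> a)\<bar> \<le> \<bar>yc (\<gamma> a) - yc (\<gamma> b)\<bar>"
        using slope[OF ab(2,1) 2] le(1)[of "yc (\<gamma> a)" "yc (\<gamma> b)"] by (meson order_trans)
      then show ?thesis by (simp add: abs_minus_commute)
    next
      case 3 then show ?thesis by simp
    qed
  qed
  show thesis by (rule that[OF \<sigma>(1) inc slope'])
qed

lemma uu_arcI:
  assumes der: "\<And>t. t \<in> {0..1} \<Longrightarrow> (\<gamma> has_vector_derivative \<gamma>' t) (at t within {0..1})"
    and cont: "continuous_on {0..1} \<gamma>'" and cone: "\<And>t. t \<in> {0..1} \<Longrightarrow> \<gamma>' t \<in> cone_uu (1/2)"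
    and strip: "\<And>t. t \<in> {0..1} \<Longrightarrow> yc (\<gamma> t) \<in> {-4..4}"
    and ends: "yc (\<gamma> 0) \<in> {-4, 4}" "yc (\<gamma> 1) \<in> {-4, 4}" "yc (\<gamma> 0) \<noteq> yc (\<gamma> 1)"
  shows "uu_arc henon_cube (1/2) \<gamma>"
proof -
  obtain \<sigma> :: real where \<sigma>: "\<And>a b. \<lbrakk>a \<in> {0..1}; b \<in> {0..1}; a < b\<rbrakk> \<Longrightarrow> \<sigma> * yc (\<gamma> a) < \<sigma> * yc (\<gamma> b)"
    using cone_uu_curve_monotone[OF der cont cone] by metis
  have "inj_on \<gamma> {0..1}"
    by (rule linorder_inj_onI) (use \<sigma> in \<open>fastforce+\<close>)
  moreover have "continuous_on {0..1} \<gamma>"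
    by (rule has_derivative_continuous_on[OF der[unfolded has_vector_derivative_def]])
  ultimately have "arc \<gamma>" by (simp add: arc_def path_def)
  moreover have "\<gamma>' t \<noteq> 0" if "t \<in> {0..1}" for t using cone_uu_bounds(3)[OF cone[OF that]] by auto
  ultimately have "regular_arc_tangent (cone_uu (1/2)) \<gamma>"
    unfolding regular_arc_tangent_def using der cont cone by blast
  moreover have "path_image \<gamma> \<subseteq> strip henon_cube"
    unfolding path_image_def strip_def henon_cube_intervals
    by (rule image_subsetI) (use strip in \<open>simp add: mem_Times_iff\<close>)
  moreover have "joins_components (UNIV \<times> frontier (Iy henon_cube) \<times> UNIV) \<gamma>"
  proof (rule joins_componentsI[where f = yc])
    show "continuous_on (UNIV \<times> frontier (Iy henon_cube) \<times> UNIV) yc" by (intro continuous_intros)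
    show "yc p = -4 \<or> yc p = 4" if "p \<in> UNIV \<times> frontier (Iy henon_cube) \<times> UNIV" for p
      using that unfolding frontier_Ix_Iy by auto
  qed (use ends in \<open>auto simp: pathstart_def pathfinish_def frontier_Ix_Iy mem_Times_iff\<close>)
  ultimately show ?thesis unfolding uu_arc_def by blast
qed

text \<open>The monotone parametrisation of a uu-disc; \<open>\<sigma>\<close> is its direction.\<close>

lemma uu_arcE:
  assumes "uu_arc henon_cube (1/2) \<gamma>"
  obtains \<gamma>' \<sigma> where
    "\<And>t. t \<in> {0..1} \<Longrightarrow> (\<gamma> has_vector_derivative \<gamma>' t) (at t within {0..1})"
    "continuous_on {0..1} \<gamma>'" "\<And>t. t \<in> {0..1} \<Longrightarrow> \<gamma>' t \<in> cone_uu (1/2)"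
    "\<sigma> = 1 \<or> \<sigma> = (-1 :: real)"
    "\<And>a b. \<lbrakk>a \<in> {0..1}; b \<in> {0..1}; a < b\<rbrakk> \<Longrightarrow> \<sigma> * yc (\<gamma> a) < \<sigma> * yc (\<gamma> b)"
    "\<And>a b. \<lbrakk>a \<in> {0..1}; b \<in> {0..1}\<rbrakk> \<Longrightarrow>
       2 * \<bar>xc (\<gamma> a) - xc (\<gamma> b)\<bar> \<le> \<bar>yc (\<gamma> a) - yc (\<gamma> b)\<bar> \<and>
       2 * \<bar>zc (\<gamma> a) - zc (\<gamma> b)\<bar> \<le> \<bar>yc (\<gamma> a) - yc (\<gamma> b)\<bar>"
    "\<sigma> * yc (\<gamma> 0) = -4" "\<sigma> * yc (\<gamma> 1) = 4"
    "\<And>t. t \<in> {0..1} \<Longrightarrow> yc (\<gamma> t) \<in> {-4..4}" "continuous_on {0..1} \<gamma>"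
proof -
  obtain \<gamma>' where g: "continuous_on {0..1} \<gamma>'" "\<And>t. t \<in> {0..1} \<Longrightarrow> (\<gamma> has_vector_derivative \<gamma>' t) (at t within {0..1})"
    "\<And>t. t \<in> {0..1} \<Longrightarrow> \<gamma>' t \<in> cone_uu (1/2)"
    using assms unfolding uu_arc_def regular_arc_tangent_def by blast
  obtain \<sigma> :: real where \<sigma>: "\<sigma> = 1 \<or> \<sigma> = -1"
    "\<And>a b. \<lbrakk>a \<in> {0..1}; b \<in> {0..1}; a < b\<rbrakk> \<Longrightarrow> \<sigma> * yc (\<gamma> a) < \<sigma> * yc (\<gamma> b)"
    "\<And>a b. \<lbrakk>a \<in> {0..1}; b \<in> {0..1}\<rbrakk> \<Longrightarrow>
       2 * \<bar>xc (\<gamma> a) - xc (\<gamma> b)\<bar> \<le> \<bar>yc (\<gamma> a) - yc (\<gamma> b)\<bar> \<and>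
       2 * \<bar>zc (\<gamma> a) - zc (\<gamma> b)\<bar> \<le> \<bar>yc (\<gamma> a) - yc (\<gamma> b)\<bar>"
    by (rule cone_uu_curve_monotone[OF g(2) g(1) g(3)], (assumption | rule that)+)
  let ?S = "UNIV \<times> {-4, 4} \<times> UNIV :: r3 set"
  obtain C C' where C: "C \<in> components ?S" "C' \<in> components ?S" "C \<noteq> C'" "\<gamma> 0 \<in> C" "\<gamma> 1 \<in> C'"
    using assms unfolding uu_arc_def joins_components_def frontier_Ix_Iy pathstart_def pathfinish_def by blast
  have S: "\<gamma> 0 \<in> ?S" "\<gamma> 1 \<in> ?S" using C in_components_subset by blast+
  have "yc (\<gamma> 0) \<noteq> yc (\<gamma> 1)"
  proof
    assume eq: "yc (\<gamma> 0) = yc (\<gamma> 1)"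
    let ?T = "UNIV \<times> {yc (\<gamma> 0)} \<times> UNIV :: r3 set"
    have T: "\<gamma> 0 \<in> ?T" "\<gamma> 1 \<in> ?T" using eq by (auto simp: mem_Times_iff)
    have "?T \<subseteq> C"
    proof (rule components_maximal[OF C(1)])
      show "connected ?T" by (intro connected_Times) auto
      show "?T \<subseteq> ?S" using S(1) by (auto simp: mem_Times_iff)
      show "C \<inter> ?T \<noteq> {}" using IntI[OF C(4) T(1)] by (metis empty_iff)
    qed
    from subsetD[OF this T(2)] have "C \<inter> C' \<noteq> {}" using C(5) by (metis IntI empty_iff)
    then show False using components_nonoverlap[OF C(1,2)] C(3) by simp
  qed
  moreover have "yc (\<gamma> 0) \<in> {-4, 4}" "yc (\<gamma> 1) \<in> {-4, 4}" using S by (auto simp: mem_Times_iff)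
  ultimately have e: "\<sigma> * yc (\<gamma> 0) = -4" "\<sigma> * yc (\<gamma> 1) = 4"
    using \<sigma>(1) \<sigma>(2)[of 0 1] by auto
  have rng: "yc (\<gamma> t) \<in> {-4..4}" if "t \<in> {0..1}" for t
  proof -
    have "\<gamma> t \<in> strip henon_cube" using assms that unfolding uu_arc_def path_image_def by blast
    then show ?thesis unfolding strip_def henon_cube_intervals by (auto simp: mem_Times_iff)
  qed
  have cg: "continuous_on {0..1} \<gamma>"
    by (rule has_derivative_continuous_on[OF g(2)[unfolded has_vector_derivative_def]])
  show thesis by (rule that[of \<gamma>' \<sigma>]) (fact g \<sigma> e rng cg)+
qed

lemma uu_arc_onto:
  assumes "uu_arc henon_cube (1/2) \<gamma>"
  shows "(\<lambda>t. yc (\<gamma> t)) ` {0..1} = {-4..4}"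
proof -
  obtain \<gamma>' \<sigma> where g: "\<sigma> = 1 \<or> \<sigma> = (-1 :: real)" "\<sigma> * yc (\<gamma> 0) = -4" "\<sigma> * yc (\<gamma> 1) = 4"
    "\<And>t. t \<in> {0..1} \<Longrightarrow> yc (\<gamma> t) \<in> {-4..4}" "continuous_on {0..1} \<gamma>"
    by (rule uu_arcE[OF assms]) blast
  have "connected ((\<lambda>t. yc (\<gamma> t)) ` {0..1})"
    by (intro connected_continuous_image continuous_intros g(5)) simp
  moreover have "-4 \<in> (\<lambda>t. yc (\<gamma> t)) ` {0..1}" "4 \<in> (\<lambda>t. yc (\<gamma> t)) ` {0..1}"
    using g(1-3) by (auto intro: image_eqI[of _ _ 0] image_eqI[of _ _ 1])
  ultimately have "{-4..4} \<subseteq> (\<lambda>t. yc (\<gamma> t)) ` {0..1}"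
    using connectedD_interval[of "(\<lambda>t. yc (\<gamma> t)) ` {0..1}" "-4" 4] by auto
  then show ?thesis using g(4) by auto
qed

text \<open>A uu-disc is the graph of a function of \<open>y\<close>, defined on the whole interval and with slope at most \<open>1/2\<close>
  in both other coordinates.\<close>

lemma uu_disc_coords:
  assumes "uu_disc henon_cube (1/2) L"
  shows "p \<in> L \<Longrightarrow> q \<in> L \<Longrightarrow> 2 * \<bar>xc p - xc q\<bar> \<le> \<bar>yc p - yc q\<bar>"
    "p \<in> L \<Longrightarrow> q \<in> L \<Longrightarrow> 2 * \<bar>zc p - zc q\<bar> \<le> \<bar>yc p - yc q\<bar>"
    "p \<in> L \<Longrightarrow> yc p \<in> {-4..4}" "y \<in> {-4..4} \<Longrightarrow> \<exists>p\<in>L. yc p = y"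
    "connected L" "compact L"
proof -
  obtain \<gamma> where \<gamma>: "uu_arc henon_cube (1/2) \<gamma>" "L = \<gamma> ` {0..1}"
    using assms unfolding uu_disc_def path_image_def by blast
  obtain \<gamma>' \<sigma> where g: "\<And>a b. \<lbrakk>a \<in> {0..1}; b \<in> {0..1}\<rbrakk> \<Longrightarrow>
       2 * \<bar>xc (\<gamma> a) - xc (\<gamma> b)\<bar> \<le> \<bar>yc (\<gamma> a) - yc (\<gamma> b)\<bar> \<and>
       2 * \<bar>zc (\<gamma> a) - zc (\<gamma> b)\<bar> \<le> \<bar>yc (\<gamma> a) - yc (\<gamma> b)\<bar>"
    "\<And>t. t \<in> {0..1} \<Longrightarrow> yc (\<gamma> t) \<in> {-4..4}" "continuous_on {0..1} \<gamma>"
    by (rule uu_arcE[OF \<gamma>(1)]) blast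
  show "p \<in> L \<Longrightarrow> q \<in> L \<Longrightarrow> 2 * \<bar>xc p - xc q\<bar> \<le> \<bar>yc p - yc q\<bar>"
    "p \<in> L \<Longrightarrow> q \<in> L \<Longrightarrow> 2 * \<bar>zc p - zc q\<bar> \<le> \<bar>yc p - yc q\<bar>" "p \<in> L \<Longrightarrow> yc p \<in> {-4..4}"
    using g(1,2) unfolding \<gamma>(2) by blast+
  show "\<exists>p\<in>L. yc p = y" if "y \<in> {-4..4}"
  proof -
    have "y \<in> (\<lambda>t. yc (\<gamma> t)) ` {0..1}" unfolding uu_arc_onto[OF \<gamma>(1)] by (rule that)
    then show ?thesis unfolding \<gamma>(2) by blast
  qed
  show "connected L" "compact L" unfolding \<gamma>(2)
    using g(3) by (auto intro: connected_continuous_image compact_continuous_image)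
qed

text \<open>The slopes \<open>1/100\<close> of the wall over \<open>x\<close> and \<open>1/2\<close> of the disc over \<open>y\<close> have a product below \<open>1\<close>.\<close>

lemma wall_crossing_unique:
  assumes L: "uu_disc henon_cube (1/2) L" and g: "s_graph Y Z"
    and pq: "p \<in> L" "q \<in> L" "xc p \<in> {-4..4}" "xc q \<in> {-4..4}" "yc p = Y (xc p)" "yc q = Y (xc q)"
  shows "p = q"
proof -
  have y: "\<bar>yc p - yc q\<bar> \<le> \<bar>xc p - xc q\<bar> / 100"
    using s_graphD(4)[OF g pq(3,4)] pq(5,6) by simp
  moreover have "2 * \<bar>xc p - xc q\<bar> \<le> \<bar>yc p - yc q\<bar>" "2 * \<bar>zc p - zc q\<bar> \<le> \<bar>yc p - yc q\<bar>"
    using uu_disc_coords(1,2)[OF L pq(1,2)] by blast+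
  moreover have "y \<le> x / 100 \<Longrightarrow> 2 * x \<le> y \<Longrightarrow> 2 * z \<le> y \<Longrightarrow> 0 \<le> x \<Longrightarrow> 0 \<le> y \<Longrightarrow> 0 \<le> z \<Longrightarrow> x = 0 \<and> y = 0 \<and> z = 0" for x y z :: real
    by (intro conjI; linarith)
  ultimately have "\<bar>xc p - xc q\<bar> = 0 \<and> \<bar>yc p - yc q\<bar> = 0 \<and> \<bar>zc p - zc q\<bar> = 0"
    using abs_ge_zero by blast
  then show ?thesis by (intro r3_eqI) auto
qed

lemma wall_crossing_exists:
  assumes L: "uu_disc henon_cube (1/2) L" "\<And>p. p \<in> L \<Longrightarrow> xc p \<in> {-4..4}" and g: "s_graph Y Z"
  obtains p where "p \<in> L" "yc p = Y (xc p)"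
proof -
  let ?f = "\<lambda>p. yc p - Y (xc p)"
  have "continuous_on L (\<lambda>p. Y (xc p))"
    by (rule continuous_on_compose2[OF s_graph_continuous(1)[OF g]]) (use L(2) in \<open>auto intro!: continuous_intros\<close>)
  then have "connected (?f ` L)"
    by (intro connected_continuous_image uu_disc_coords(5)[OF L(1)] continuous_intros)
  moreover obtain p q where "p \<in> L" "yc p = -4" "q \<in> L" "yc q = 4"
    using uu_disc_coords(4)[OF L(1), of "-4"] uu_disc_coords(4)[OF L(1), of 4] by auto
  moreover have "?f p \<le> 0" "0 \<le> ?f q"
    using s_graphD(1)[OF g L(2)[OF \<open>p \<in> L\<close>]] s_graphD(1)[OF g L(2)[OF \<open>q \<in> L\<close>]] \<open>yc p = -4\<close> \<open>yc q = 4\<close> by auto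
  ultimately have "0 \<in> ?f ` L" using connectedD_interval[of "?f ` L" "?f p" "?f q" 0] by blast
  then show thesis using that by auto
qed

text \<open>These are the moves from which homotopies of uu-discs are built. They respect the cone since it is
  convex in \<open>(x, z)\<close> for fixed \<open>y\<close>.\<close>

lemma uu_arc_shear:
  assumes \<gamma>: "uu_arc henon_cube (1/2) \<gamma>" and a: "a \<in> {0..1}"
  shows "uu_arc henon_cube (1/2) (\<lambda>t. (a * xc (\<gamma> t), yc (\<gamma> t), a * zc (\<gamma> t) + b))"
proof -
  obtain \<gamma>' \<sigma> where g: "\<And>t. t \<in> {0..1} \<Longrightarrow> (\<gamma> has_vector_derivative \<gamma>' t) (at t within {0..1})"
    "continuous_on {0..1} \<gamma>'" "\<And>t. t \<in> {0..1} \<Longrightarrow> \<gamma>' t \<in> cone_uu (1/2)"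
    "\<sigma> = 1 \<or> \<sigma> = (-1 :: real)" "\<sigma> * yc (\<gamma> 0) = -4" "\<sigma> * yc (\<gamma> 1) = 4"
    "\<And>t. t \<in> {0..1} \<Longrightarrow> yc (\<gamma> t) \<in> {-4..4}"
    by (rule uu_arcE[OF \<gamma>]) blast
  show ?thesis
  proof (rule uu_arcI)
    show "((\<lambda>t. (a * xc (\<gamma> t), yc (\<gamma> t), a * zc (\<gamma> t) + b)) has_vector_derivative
        (a * xc (\<gamma>' t), yc (\<gamma>' t), a * zc (\<gamma>' t))) (at t within {0..1})" if "t \<in> {0..1}" for t
    proof -
      note d = has_vector_derivative_coords[OF g(1)[OF that], unfolded has_real_derivative_iff_has_vector_derivative]
      have "((\<lambda>t. a * zc (\<gamma> t) + b) has_vector_derivative a * zc (\<gamma>' t) + 0) (at t within {0..1})"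
        by (intro has_vector_derivative_add has_vector_derivative_mult_right d has_vector_derivative_const)
      then show ?thesis
        by (intro has_vector_derivative_Pair has_vector_derivative_mult_right d) simp
    qed
    show "continuous_on {0..1} (\<lambda>t. (a * xc (\<gamma>' t), yc (\<gamma>' t), a * zc (\<gamma>' t)))"
      by (intro continuous_intros g(2))
    show "(a * xc (\<gamma>' t), yc (\<gamma>' t), a * zc (\<gamma>' t)) \<in> cone_uu (1/2)" if "t \<in> {0..1}" for t
    proof -
      have "sqrt ((xc (\<gamma>' t))\<^sup>2 + (zc (\<gamma>' t))\<^sup>2) < 1/2 * \<bar>yc (\<gamma>' t)\<bar>"
        using g(3)[OF that] by (auto simp: cone_uu_def)
      moreover have "a\<^sup>2 \<le> 1" using a by (simp add: power_le_one)
      then have "(a * xc (\<gamma>' t))\<^sup>2 + (a * zc (\<gamma>' t))\<^sup>2 \<le> (xc (\<gamma>' t))\<^sup>2 + (zc (\<gamma>' t))\<^sup>2"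
        unfolding power_mult_distrib by (intro add_mono mult_left_le_one_le) auto
      then have "sqrt ((a * xc (\<gamma>' t))\<^sup>2 + (a * zc (\<gamma>' t))\<^sup>2) \<le> sqrt ((xc (\<gamma>' t))\<^sup>2 + (zc (\<gamma>' t))\<^sup>2)"
        by simp
      ultimately have "sqrt ((a * xc (\<gamma>' t))\<^sup>2 + (a * zc (\<gamma>' t))\<^sup>2) < 1/2 * \<bar>yc (\<gamma>' t)\<bar>" by linarith
      then show ?thesis by (simp add: cone_uu_def)
    qed
    show "yc (a * xc (\<gamma> t), yc (\<gamma> t), a * zc (\<gamma> t) + b) \<in> {-4..4}" if "t \<in> {0..1}" for t
      using g(7)[OF that] by simp
  qed (use g(4-6) in auto)
qed

lemma horizontal_uu_arc: "uu_arc henon_cube (1/2) (\<lambda>t. (0, 8 * t - 4, c))"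
  by (rule uu_arcI[where \<gamma>' = "\<lambda>_. (0, 8, 0)"])
    (auto intro!: has_vector_derivative_Pair derivative_eq_intros
      simp: cone_uu_def has_real_derivative_iff_has_vector_derivative[symmetric])

lemma horizontal_uu_disc: "uu_disc henon_cube (1/2) ({0} \<times> {-4..4} \<times> {c})"
proof -
  have "(0, y, c) \<in> (\<lambda>t::real. (0::real, 8 * t - 4, c)) ` {0..1}" if "y \<in> {-4..4}" for y
    using that by (intro image_eqI[of _ _ "(y + 4) / 8"]) (auto simp: field_simps)
  then have "(\<lambda>t::real. (0::real, 8 * t - 4, c)) ` {0..1} = {0} \<times> {-4..4} \<times> {c}" by auto
  then show ?thesis
    unfolding uu_disc_def path_image_def using horizontal_uu_arc[of c] by blast
qed

section \<open>Right and left classes\<close>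

lemma shear_homotopy:
  fixes \<alpha> \<beta> :: "real \<Rightarrow> real"
  assumes \<gamma>: "uu_arc henon_cube (1/2) \<gamma>" and x: "\<And>t. t \<in> {0..1} \<Longrightarrow> xc (\<gamma> t) \<in> {-4..4}"
    and \<alpha>: "continuous_on {0..1} \<alpha>" "\<And>u. u \<in> {0..1} \<Longrightarrow> \<alpha> u \<in> {0..1}" and \<beta>: "continuous_on {0..1} \<beta>"
    and avoid: "\<And>u t. \<lbrakk>u \<in> {0..1}; t \<in> {0..1}\<rbrakk> \<Longrightarrow>
      (\<alpha> u * xc (\<gamma> t), yc (\<gamma> t), \<alpha> u * zc (\<gamma> t) + \<beta> u) \<notin> W"
  shows "homotopic_with_canon (\<lambda>\<delta>. uu_arc henon_cube (1/2) \<delta> \<and> path_image \<delta> \<inter> W = {})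
      {0..1} (Ix henon_cube \<times> Iy henon_cube \<times> UNIV)
      (\<lambda>t. (\<alpha> 0 * xc (\<gamma> t), yc (\<gamma> t), \<alpha> 0 * zc (\<gamma> t) + \<beta> 0))
      (\<lambda>t. (\<alpha> 1 * xc (\<gamma> t), yc (\<gamma> t), \<alpha> 1 * zc (\<gamma> t) + \<beta> 1))"
proof -
  obtain \<gamma>' \<sigma> where g: "\<sigma> = 1 \<or> \<sigma> = (-1 :: real)" "\<And>t. t \<in> {0..1} \<Longrightarrow> yc (\<gamma> t) \<in> {-4..4}"
    "continuous_on {0..1} \<gamma>" by (rule uu_arcE[OF \<gamma>]) blast
  define h :: "real \<times> real \<Rightarrow> r3" where
    "h = (\<lambda>p. (\<alpha> (fst p) * xc (\<gamma> (snd p)), yc (\<gamma> (snd p)), \<alpha> (fst p) * zc (\<gamma> (snd p)) + \<beta> (fst p)))"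
  have c\<gamma>: "continuous_on ({0..1} \<times> {0..1}) (\<lambda>p :: real \<times> real. \<gamma> (snd p))"
    by (rule continuous_on_compose2[OF g(3)]) (auto intro!: continuous_intros)
  have c\<alpha>: "continuous_on ({0..1} \<times> {0..1}) (\<lambda>p :: real \<times> real. \<alpha> (fst p))"
    by (rule continuous_on_compose2[OF \<alpha>(1)]) (auto intro!: continuous_intros)
  have c\<beta>: "continuous_on ({0..1} \<times> {0..1}) (\<lambda>p :: real \<times> real. \<beta> (fst p))"
    by (rule continuous_on_compose2[OF \<beta>]) (auto intro!: continuous_intros)
  have "continuous_on ({0..1} \<times> {0..1}) h"
    unfolding h_def by (intro continuous_on_Pair continuous_on_mult continuous_on_add continuous_on_fst
        continuous_on_snd c\<gamma> c\<alpha> c\<beta>)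
  moreover have "h \<in> {0..1} \<times> {0..1} \<rightarrow> Ix henon_cube \<times> Iy henon_cube \<times> UNIV"
  proof
    fix p :: "real \<times> real" assume p: "p \<in> {0..1} \<times> {0..1}"
    have "\<bar>\<alpha> (fst p) * xc (\<gamma> (snd p))\<bar> \<le> 1 * 4"
      unfolding abs_mult using \<alpha>(2)[of "fst p"] x[of "snd p"] p by (intro mult_mono) (auto simp: abs_le_iff)
    then show "h p \<in> Ix henon_cube \<times> Iy henon_cube \<times> UNIV"
      using g(2)[of "snd p"] p by (auto simp: h_def henon_cube_intervals abs_le_iff)
  qed
  ultimately have "continuous_map (prod_topology (top_of_set {0..1}) (top_of_set {0..1}))
      (top_of_set (Ix henon_cube \<times> Iy henon_cube \<times> UNIV)) h"
    by simp
  moreover have "uu_arc henon_cube (1/2) (\<lambda>t. h (u, t)) \<and> path_image (\<lambda>t. h (u, t)) \<inter> W = {}"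
    if "u \<in> {0..1}" for u
    using uu_arc_shear[OF \<gamma> \<alpha>(2)[OF that], of "\<beta> u"] avoid[OF that]
    by (auto simp: h_def path_image_def)
  ultimately show ?thesis
    unfolding homotopic_with_def by (intro exI[of _ h]) (simp add: h_def)
qed

text \<open>The disc passes the curve \<open>x \<mapsto> (x, Y x, Z x)\<close> above (\<open>s = 1\<close>) or below it (\<open>s = -1\<close>): the
  comparison takes place where the disc crosses the wall \<open>y = Y x\<close>.\<close>

definition on_side :: "(real \<Rightarrow> real) \<Rightarrow> (real \<Rightarrow> real) \<Rightarrow> real \<Rightarrow> r3 set \<Rightarrow> bool" where
  "on_side Y Z s L \<longleftrightarrow> uu_disc henon_cube (1/2) L \<and> (\<forall>p\<in>L. xc p \<in> {-4..4}) \<and>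
     (\<exists>p\<in>L. yc p = Y (xc p) \<and> 0 < s * (zc p - Z (xc p)))"

text \<open>Let \<open>e\<close> be the signed height of the crossing over the curve. The parameters of the homotopy with
  \<open>e \<ge> 0\<close> and those with \<open>e \<le> 0\<close> form closed sets, as projections of compact sets. They cover the unit
  interval, since every disc crosses the wall, and they are disjoint, since the crossing is unique
  and not on the curve. The interval is connected, so the sign cannot change.\<close>

lemma on_side_if_homotopic:
  assumes g: "s_graph Y Z" and s: "s = 1 \<or> s = (-1::real)"
    and W: "W = (\<lambda>a. (a, Y a, Z a)) ` {-4..4}"
    and b: "\<And>a. a \<in> {-4..4} \<Longrightarrow> 0 < s * (b - Z a)"
    and hom: "uu_homotopic henon_cube (1/2) W ({0} \<times> Iy henon_cube \<times> {b}) L"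
  shows "on_side Y Z s L"
proof -
  let ?P = "\<lambda>\<delta>. uu_arc henon_cube (1/2) \<delta> \<and> path_image \<delta> \<inter> W = {}"
  obtain \<gamma> \<gamma>' where im: "path_image \<gamma> = {0} \<times> {-4..4} \<times> {b}" "path_image \<gamma>' = L"
    and hw: "homotopic_with_canon ?P {0..1} ({-4..4} \<times> {-4..4} \<times> UNIV) \<gamma> \<gamma>'"
    using hom unfolding uu_homotopic_def henon_cube_intervals by blast
  from hw[unfolded homotopic_with_def] obtain h :: "real \<times> real \<Rightarrow> r3" where
    hh: "continuous_map (prod_topology (top_of_set {0..1}) (top_of_set {0..1}))
      (top_of_set ({-4..4} \<times> {-4..4} \<times> UNIV)) h \<and>
    (\<forall>t. h (0, t) = \<gamma> t) \<and> (\<forall>t. h (1, t) = \<gamma>' t) \<and> (\<forall>u\<in>{0..1}. ?P (\<lambda>t. h (u, t)))" ..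
  note hc = hh[THEN conjunct1] and h0 = hh[THEN conjunct2]
  have hcc: "continuous_on ({0..1} \<times> {0..1}) h \<and> h \<in> {0..1} \<times> {0..1} \<rightarrow> {-4..4} \<times> {-4..4} \<times> UNIV"
    using hc by simp
  note h = conjunct1[OF hcc] conjunct2[OF hcc] conjunct1[OF h0] conjunct1[OF conjunct2[OF h0]]
    conjunct2[OF conjunct2[OF h0]]
  define D where "D u = (\<lambda>t. h (u, t)) ` {0..1}" for u :: real
  have D: "uu_disc henon_cube (1/2) (D u)" "D u \<inter> W = {}" "\<And>p. p \<in> D u \<Longrightarrow> xc p \<in> {-4..4}"
    if u: "u \<in> {0..1}" for u
  proof -
    have P: "?P (\<lambda>t. h (u, t))" using h(5) u by (rule bspec)
    have im: "path_image (\<lambda>t. h (u, t)) = D u" unfolding path_image_def D_def ..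
    show "uu_disc henon_cube (1/2) (D u)" unfolding uu_disc_def using conjunct1[OF P] im by (rule_tac exI conjI)+
    show "D u \<inter> W = {}" using conjunct2[OF P] unfolding im .
    fix p assume "p \<in> D u"
    then obtain t where t: "t \<in> {0..1}" "p = h (u, t)" unfolding D_def by (rule imageE)
    have "(u, t) \<in> {0..1} \<times> {0..1}" using u t(1) by (rule SigmaI)
    then have "h (u, t) \<in> {-4..4} \<times> {-4..4} \<times> UNIV" using h(2) by (rule funcset_mem[rotated])
    then show "xc p \<in> {-4..4}" unfolding t(2) by (simp only: mem_Times_iff)
  qed
  define f where "f p = yc p - Y (xc p)" for p :: r3
  define e where "e p = s * (zc p - Z (xc p))" for p :: r3
  have ce: "continuous_on {p. xc p \<in> {-4..4}} f" "continuous_on {p. xc p \<in> {-4..4}} e"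
    unfolding f_def e_def
    by (intro continuous_intros continuous_on_compose2[OF s_graph_continuous(1)[OF g]]
        continuous_on_compose2[OF s_graph_continuous(2)[OF g]]; auto)+
  have e0: "e p \<noteq> 0" if "u \<in> {0..1}" "p \<in> D u" "f p = 0" for u p
  proof
    assume "e p = 0"
    then have "p = (xc p, Y (xc p), Z (xc p))" using that(3) s unfolding e_def f_def by (auto intro!: r3_eqI)
    then have "p \<in> W" unfolding W using D(3)[OF that(1,2)] by blast
    then show False using D(2)[OF that(1)] that(2) by blast
  qed
  let ?I = "{0..1::real}"
  define A where "A T = fst ` {q \<in> ?I \<times> ?I. f (h q) = 0 \<and> e (h q) \<in> T}" for T :: "real set"
  have memA: "u \<in> A T \<longleftrightarrow> u \<in> ?I \<and> (\<exists>p\<in>D u. f p = 0 \<and> e p \<in> T)" for u T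
  proof
    assume "u \<in> A T"
    then obtain q where "u = fst q" "q \<in> {q \<in> ?I \<times> ?I. f (h q) = 0 \<and> e (h q) \<in> T}" unfolding A_def by (rule imageE)
    then have q: "u = fst q" "fst q \<in> ?I" "snd q \<in> ?I" "f (h q) = 0" "e (h q) \<in> T"
      by (simp_all add: mem_Times_iff)
    then have "h q \<in> D u" unfolding D_def by (intro image_eqI[of _ _ "snd q"]) simp_all
    then show "u \<in> ?I \<and> (\<exists>p\<in>D u. f p = 0 \<and> e p \<in> T)" using q by (intro conjI bexI[of _ "h q"]) simp_all
  next
    assume r: "u \<in> ?I \<and> (\<exists>p\<in>D u. f p = 0 \<and> e p \<in> T)"
    then obtain p where p: "p \<in> D u" "f p = 0" "e p \<in> T" by blast
    obtain t where t: "t \<in> ?I" "p = h (u, t)" using p(1) unfolding D_def by (rule imageE)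
    show "u \<in> A T" unfolding A_def
      by (rule image_eqI[of _ _ "(u, t)"]) (use r p(2,3) t in \<open>simp_all add: mem_Times_iff\<close>)
  qed
  have hx: "h ` (?I \<times> ?I) \<subseteq> {p. xc p \<in> {-4..4}}"
  proof (rule image_subsetI)
    fix q assume "q \<in> ?I \<times> ?I"
    with h(2) have "h q \<in> {-4..4} \<times> {-4..4} \<times> UNIV" by (rule funcset_mem)
    then show "h q \<in> {p. xc p \<in> {-4..4}}" by (simp add: mem_Times_iff)
  qed
  have closedA: "closed (A T)" if "closed T" for T
  proof -
    have fh: "continuous_on (?I \<times> ?I) (\<lambda>q. f (h q))" "continuous_on (?I \<times> ?I) (\<lambda>q. e (h q))"
      by (rule continuous_on_compose2[OF ce(1) h(1)] continuous_on_compose2[OF ce(2) h(1)], rule hx)+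
    have cl: "closed (?I \<times> ?I)" by (intro closed_Times) auto
    let ?S = "((?I \<times> ?I) \<inter> (\<lambda>q. f (h q)) -` {0}) \<inter> ((?I \<times> ?I) \<inter> (\<lambda>q. e (h q)) -` T)"
    have "closed ?S"
      by (intro closed_Int continuous_closed_preimage fh cl that closed_singleton)
    moreover have "compact (?I \<times> ?I)" by (intro compact_Times) auto
    ultimately have "compact ((?I \<times> ?I) \<inter> ?S)" by (rule compact_Int_closed[rotated])
    moreover have "(?I \<times> ?I) \<inter> ?S = {q \<in> ?I \<times> ?I. f (h q) = 0 \<and> e (h q) \<in> T}" by blast
    ultimately have "compact {q \<in> ?I \<times> ?I. f (h q) = 0 \<and> e (h q) \<in> T}" by (simp only:)
    then have "compact (A T)" unfolding A_def by (intro compact_continuous_image continuous_intros)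
    then show ?thesis by (rule compact_imp_closed)
  qed
  define Pos Neg where "Pos = A {0..}" and "Neg = A {..0}"
  have Pos: "u \<in> Pos \<longleftrightarrow> u \<in> ?I \<and> (\<exists>p\<in>D u. f p = 0 \<and> 0 \<le> e p)"
    and Neg: "u \<in> Neg \<longleftrightarrow> u \<in> ?I \<and> (\<exists>p\<in>D u. f p = 0 \<and> e p \<le> 0)" for u
    unfolding Pos_def Neg_def memA by simp_all
  have cl: "closed Pos" "closed Neg" unfolding Pos_def Neg_def by (simp_all add: closedA)
  have cover: "?I \<subseteq> Pos \<union> Neg"
  proof
    fix u assume u: "u \<in> ?I"
    obtain p where p: "p \<in> D u" "yc p = Y (xc p)"
      by (rule wall_crossing_exists[OF D(1)[OF u] D(3)[OF u] g])
    have "f p = 0" unfolding f_def p(2) by simp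
    moreover have "0 \<le> e p \<or> e p \<le> 0" by (rule linear)
    ultimately show "u \<in> Pos \<union> Neg" unfolding Un_iff Pos Neg using u p(1) by blast
  qed
  have disj: "Pos \<inter> Neg \<inter> ?I = {}"
  proof (rule ccontr)
    assume "Pos \<inter> Neg \<inter> ?I \<noteq> {}"
    then obtain u where u: "u \<in> ?I" "u \<in> Pos" "u \<in> Neg" by blast
    obtain p where p: "p \<in> D u" "f p = 0" "0 \<le> e p" using u(2) unfolding Pos by blast
    obtain q where q: "q \<in> D u" "f q = 0" "e q \<le> 0" using u(3) unfolding Neg by blast
    have "p = q"
      by (rule wall_crossing_unique[OF D(1)[OF u(1)] g p(1) q(1) D(3)[OF u(1) p(1)] D(3)[OF u(1) q(1)]])
        (use p(2) q(2) in \<open>simp_all add: f_def\<close>)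
    then show False using e0[OF u(1) p(1,2)] p(3) q(3) by simp
  qed
  have D0: "D 0 = {0} \<times> {-4..4} \<times> {b}" "D 1 = L"
    unfolding D_def im[symmetric] path_image_def using h(3,4) by simp_all
  have "(0, Y 0, b) \<in> D 0" "f (0, Y 0, b) = 0" "0 \<le> e (0, Y 0, b)"
    using s_graphD(1)[OF g, of 0] b[of 0] unfolding D0 f_def e_def by simp_all
  then have "0 \<in> Pos" unfolding Pos by (intro conjI bexI[of _ "(0, Y 0, b)"]) simp_all
  then have ne: "Pos \<inter> ?I \<noteq> {}" by force
  have "Pos \<inter> ?I = {} \<or> Neg \<inter> ?I = {}"
    by (rule connected_closedD[OF _ disj cover cl]) simp
  with ne have "Neg \<inter> ?I = {}" by simp
  moreover have "1 \<in> Pos \<union> Neg" using cover by (rule subsetD) simp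
  moreover have "(1::real) \<in> ?I" by simp
  ultimately have "1 \<in> Pos" by blast
  then obtain p where p: "p \<in> L" "f p = 0" "0 \<le> e p" unfolding Pos D0 by blast
  have "e p \<noteq> 0" using e0[of 1 p] p D0 by simp
  with p(3) have "0 < e p" by simp
  then have "yc p = Y (xc p) \<and> 0 < s * (zc p - Z (xc p))" using p(2) unfolding f_def e_def by simp
  then show ?thesis
    using D(1)[of 1] D(3)[of 1] p(1) unfolding D0 on_side_def by auto
qed

text \<open>A vertical translation does not change where the disc crosses the wall. So the disc can be moved away
  from the curve until it is entirely beyond all heights of the curve, contracted there to a
  segment over \<open>x = 0\<close>, and this segment moved to the height \<open>b\<close>.\<close>

lemma homotopic_if_on_side:
  assumes g: "s_graph Y Z" and s: "s = 1 \<or> s = (-1::real)"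
    and W: "W = (\<lambda>a. (a, Y a, Z a)) ` {-4..4}"
    and b: "\<And>a. a \<in> {-4..4} \<Longrightarrow> 0 < s * (b - Z a)"
    and side: "on_side Y Z s L"
  shows "uu_homotopic henon_cube (1/2) W ({0} \<times> Iy henon_cube \<times> {b}) L"
proof -
  have L: "uu_disc henon_cube (1/2) L" "\<And>p. p \<in> L \<Longrightarrow> xc p \<in> {-4..4}" using side unfolding on_side_def by auto
  obtain p0 where p0: "p0 \<in> L" "yc p0 = Y (xc p0)" "0 < s * (zc p0 - Z (xc p0))"
    using side unfolding on_side_def by blast
  obtain \<gamma> where \<gamma>: "uu_arc henon_cube (1/2) \<gamma>" "path_image \<gamma> = L" using L(1) unfolding uu_disc_def by blast
  have inL: "\<gamma> t \<in> L" if "t \<in> {0..1}" for t using that \<gamma>(2) unfolding path_image_def by blast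
  have x: "xc (\<gamma> t) \<in> {-4..4}" if "t \<in> {0..1}" for t using L(2) inL[OF that] .
  have "bounded L" using uu_disc_coords(6)[OF L(1)] by (rule compact_imp_bounded)
  then obtain B where B: "\<And>p. p \<in> L \<Longrightarrow> norm p \<le> B" "0 < B" unfolding bounded_pos by blast
  \<comment> \<open>\<open>B\<close> bounds \<open>\<bar>z\<bar>\<close> on the disc and \<open>40\<close> bounds it on the curve.\<close>
  define C where "C = B + 41"
  have ss: "s * (s * t) = t" for t using s by auto
  have high: "41 \<le> s * zc (\<gamma> t) + C" if "t \<in> {0..1}" for t
    using B(1)[OF inL[OF that]] comp_le_norm(3)[of "\<gamma> t"] s unfolding C_def by (auto simp: abs_le_iff)
  have low: "s * Z a \<le> 40" if "a \<in> {-4..4}" for a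
    using s_graphD(2)[OF g that] s by auto
  have inW: "yc p = Y (xc p) \<and> zc p = Z (xc p) \<and> xc p \<in> {-4..4}" if "p \<in> W" for p
    using that unfolding W by auto
  let ?P = "\<lambda>\<delta>. uu_arc henon_cube (1/2) \<delta> \<and> path_image \<delta> \<inter> W = {}"
  let ?T = "Ix henon_cube \<times> Iy henon_cube \<times> UNIV"
  let ?\<delta> = "\<lambda>a c t. (a * xc (\<gamma> t), yc (\<gamma> t), a * zc (\<gamma> t) + c)"
  \<comment> \<open>Translation beyond the curve, contraction, translation to the height \<open>b\<close>.\<close>
  have 1: "homotopic_with_canon ?P {0..1} ?T (?\<delta> 1 (0 * (s * C))) (?\<delta> 1 (1 * (s * C)))"
  proof (rule shear_homotopy[OF \<gamma>(1) x, where \<alpha> = "\<lambda>_. 1" and \<beta> = "\<lambda>u. u * (s * C)"])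
    fix u t :: real assume u: "u \<in> {0..1}" and t: "t \<in> {0..1}"
    show "(1 * xc (\<gamma> t), yc (\<gamma> t), 1 * zc (\<gamma> t) + u * (s * C)) \<notin> W"
    proof
      assume "(1 * xc (\<gamma> t), yc (\<gamma> t), 1 * zc (\<gamma> t) + u * (s * C)) \<in> W"
      note w = inW[OF this, simplified]
      have "\<gamma> t = p0"
        by (rule wall_crossing_unique[OF L(1) g inL[OF t] p0(1) x[OF t] L(2)[OF p0(1)] _ p0(2)]) (use w in simp)
      then have "0 < s * (zc (\<gamma> t) - Z (xc (\<gamma> t)))" using p0(3) by simp
      moreover have "zc (\<gamma> t) - Z (xc (\<gamma> t)) = - (s * (u * C))" using w by (simp add: mult.left_commute)
      ultimately have "0 < - (u * C)" by (simp add: ss)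
      moreover have "0 \<le> u * C" using u B(2) by (simp add: C_def)
      ultimately show False by simp
    qed
  qed (auto intro!: continuous_intros)
  have avoid: "(a * xc (\<gamma> t), yc (\<gamma> t), a * zc (\<gamma> t) + c) \<notin> W"
    if a: "a \<in> {0..1}" and t: "t \<in> {0..1}" and pos: "\<And>v. v \<in> {-4..4} \<Longrightarrow> 0 < s * (a * zc (\<gamma> t) + c - Z v)" for a t c
  proof
    assume "(a * xc (\<gamma> t), yc (\<gamma> t), a * zc (\<gamma> t) + c) \<in> W"
    from inW[OF this] have "a * zc (\<gamma> t) + c = Z (a * xc (\<gamma> t))" "a * xc (\<gamma> t) \<in> {-4..4}" by simp_all
    then show False using pos[of "a * xc (\<gamma> t)"] by simp
  qed
  have 2: "homotopic_with_canon ?P {0..1} ?T (?\<delta> (1 - 0) (s * C)) (?\<delta> (1 - 1) (s * C))"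
  proof (rule shear_homotopy[OF \<gamma>(1) x, where \<alpha> = "\<lambda>u. 1 - u" and \<beta> = "\<lambda>_. s * C"])
    fix u t :: real assume u: "u \<in> {0..1}" and t: "t \<in> {0..1}"
    show "((1 - u) * xc (\<gamma> t), yc (\<gamma> t), (1 - u) * zc (\<gamma> t) + s * C) \<notin> W"
    proof (rule avoid)
      fix v :: real assume v: "v \<in> {-4..4}"
      have "(1 - u) * 41 \<le> (1 - u) * (s * zc (\<gamma> t) + C)" using u high[OF t] by (intro mult_left_mono) auto
      moreover have "u * 41 \<le> u * C" using u B(2) by (intro mult_left_mono) (auto simp: C_def)
      moreover have "s * ((1 - u) * zc (\<gamma> t) + s * C - Z v) = (1 - u) * (s * zc (\<gamma> t) + C) + u * C - s * Z v"
        using s by (auto simp: algebra_simps)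
      moreover have "(1 - u) * 41 + u * 41 = 41" by (simp add: algebra_simps)
      ultimately show "0 < s * ((1 - u) * zc (\<gamma> t) + s * C - Z v)" using low[OF v] by linarith
    qed (use u t in auto)
  qed (auto intro!: continuous_intros)
  have 3: "homotopic_with_canon ?P {0..1} ?T (?\<delta> 0 ((1 - 0) * (s * C) + 0 * b)) (?\<delta> 0 ((1 - 1) * (s * C) + 1 * b))"
  proof (rule shear_homotopy[OF \<gamma>(1) x, where \<alpha> = "\<lambda>_. 0" and \<beta> = "\<lambda>u. (1 - u) * (s * C) + u * b"])
    fix u t :: real assume u: "u \<in> {0..1}" and t: "t \<in> {0..1}"
    show "(0 * xc (\<gamma> t), yc (\<gamma> t), 0 * zc (\<gamma> t) + ((1 - u) * (s * C) + u * b)) \<notin> W"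
    proof (rule avoid)
      fix v :: real assume v: "v \<in> {-4..4}"
      have pos: "0 < C - s * Z v" using low[OF v] B(2) by (simp add: C_def)
      have eq: "s * (0 * zc (\<gamma> t) + ((1 - u) * (s * C) + u * b) - Z v)
          = (1 - u) * (C - s * Z v) + u * (s * (b - Z v))"
        using s by (auto simp: algebra_simps)
      show "0 < s * (0 * zc (\<gamma> t) + ((1 - u) * (s * C) + u * b) - Z v)"
      proof (cases "u = 0")
        case True then show ?thesis unfolding eq using pos by simp
      next
        case False
        then have "0 < u * (s * (b - Z v))" using u b[OF v] mult_pos_pos[of u "s * (b - Z v)"] by simp
        moreover have "0 \<le> (1 - u) * (C - s * Z v)" using u pos by (intro mult_nonneg_nonneg) auto
        ultimately show ?thesis unfolding eq by linarith
      qed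
    qed (use t in auto)
  qed (auto intro!: continuous_intros)
  have e1: "0 * (s * C) = 0" "1 * (s * C) = s * C" and e2: "(1::real) - 0 = 1" "(1::real) - 1 = 0"
    and e3: "(1 - 0) * (s * C) + 0 * b = s * C" "(1 - 1) * (s * C) + 1 * b = b" by simp_all
  have "homotopic_with_canon ?P {0..1} ?T (?\<delta> 1 0) (?\<delta> 0 b)"
    by (rule homotopic_with_trans[OF 1[unfolded e1] homotopic_with_trans[OF 2[unfolded e2] 3[unfolded e3]]])
  then have "homotopic_with_canon ?P {0..1} ?T (?\<delta> 0 b) (?\<delta> 1 0)" by (rule homotopic_with_symD)
  moreover have "?\<delta> 1 0 = \<gamma>" by (simp add: fun_eq_iff prod_eq_iff)
  ultimately have "homotopic_with_canon ?P {0..1} ?T (?\<delta> 0 b) \<gamma>" by (simp only:)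
  moreover have "path_image (?\<delta> 0 b) = {0} \<times> Iy henon_cube \<times> {b}"
  proof -
    have "path_image (?\<delta> 0 b) = (\<lambda>y. (0, y, b)) ` (\<lambda>t. yc (\<gamma> t)) ` {0..1}"
      unfolding path_image_def by (simp add: image_image)
    then show ?thesis unfolding uu_arc_onto[OF \<gamma>(1)] henon_cube_intervals by auto
  qed
  ultimately show ?thesis unfolding uu_homotopic_def using \<gamma>(2) by blast
qed

section \<open>Images of uu-discs\<close>

lemma cone_uu_scale: "v \<in> cone_uu \<theta> \<Longrightarrow> c \<noteq> 0 \<Longrightarrow> c *\<^sub>R v \<in> cone_uu \<theta>"
proof -
  assume v: "v \<in> cone_uu \<theta>" and c: "c \<noteq> 0"
  have "sqrt ((c * xc v)\<^sup>2 + (c * zc v)\<^sup>2) = \<bar>c\<bar> * sqrt ((xc v)\<^sup>2 + (zc v)\<^sup>2)"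
    by (simp add: power_mult_distrib real_sqrt_mult flip: distrib_left)
  also have "\<dots> < \<bar>c\<bar> * (\<theta> * \<bar>yc v\<bar>)"
    using v c by (intro mult_strict_left_mono) (auto simp: cone_uu_def)
  finally have "sqrt ((xc (c *\<^sub>R v))\<^sup>2 + (zc (c *\<^sub>R v))\<^sup>2) < \<theta> * \<bar>yc (c *\<^sub>R v)\<bar>"
    by (simp add: abs_mult mult.left_commute)
  then show ?thesis by (cases v; cases "snd v") (auto simp: cone_uu_def)
qed

context near_henon
begin

text \<open>For two points of a uu-disc the \<open>y\<close>-difference dominates, and it is multiplied by \<open>m\<close>, which has the sign of the band.\<close>

lemma disc_image_y_monotone:
  assumes s: "s = 1 \<or> s = -1" and L: "uu_disc henon_cube (1/2) L" and pq: "p \<in> L" "q \<in> L"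
    and b: "p \<in> band s" "q \<in> band s" and lt: "s * yc p < s * yc q"
  shows "yc (F p) < yc (F q)"
proof -
  let ?d = "q - p" and ?m = "yc q + yc p"
  have lip: "2 * \<bar>xc ?d\<bar> \<le> \<bar>yc ?d\<bar>" "2 * \<bar>zc ?d\<bar> \<le> \<bar>yc ?d\<bar>"
    using uu_disc_coords(1,2)[OF L pq(2,1)] by simp_all
  have e: "\<bar>yc (F q - F p) - ?m * yc ?d\<bar> \<le> tol * l1 ?d"
    using difference_near_step[OF band_DeltaD[OF b(2)] band_DeltaD[OF b(1)]] unfolding near_step_def by blast
  have l: "l1 ?d \<le> 2 * \<bar>yc ?d\<bar>" using lip unfolding l1_def by linarith
  have pos: "0 < \<bar>yc ?d\<bar>" using lt by auto
  have "?m * yc ?d = \<bar>?m\<bar> * \<bar>yc ?d\<bar>"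
    using s lt b unfolding band_def by (auto simp: abs_mult[symmetric] mult_nonpos_nonpos)
  moreover have "4 * \<bar>yc ?d\<bar> \<le> \<bar>?m\<bar> * \<bar>yc ?d\<bar>" using band_slope(1)[OF s b(2,1)] by (intro mult_right_mono) auto
  ultimately have m4: "4 * \<bar>yc ?d\<bar> \<le> ?m * yc ?d" by simp
  have "\<bar>x - a\<bar> \<le> tol * l \<Longrightarrow> l \<le> 2 * y \<Longrightarrow> 4 * y \<le> a \<Longrightarrow> 0 < y \<Longrightarrow> 0 < x" for x a l y :: real
    by linarith
  from this[OF e l m4 pos] have "0 < yc (F q - F p)" .
  then show ?thesis by simp
qed

text \<open>On the part of the disc in a band, \<open>y \<circ> F\<close> is strictly monotone, and it is at most \<open>-4\<close> at
  \<open>\<bar>y\<bar> = 2\<close> and at least \<open>4\<close> at \<open>\<bar>y\<bar> = 3.9\<close>. So the part in the branch is a single sub-arc, and its image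
  runs from one boundary of the strip to the other.\<close>

lemma image_uu_disc:
  assumes s: "s = 1 \<or> s = -1" and L: "uu_disc henon_cube (1/2) L" "L \<subseteq> \<Delta>"
  shows "uu_disc henon_cube (1/2) (F ` (L \<inter> branch s))"
    and "p \<in> F ` (L \<inter> branch s) \<Longrightarrow> xc p \<in> {-4..4}"
proof -
  show "xc p \<in> {-4..4}" if "p \<in> F ` (L \<inter> branch s)"
    using that branch_image_x[OF s] by fastforce
  obtain \<gamma> where \<gamma>: "uu_arc henon_cube (1/2) \<gamma>" "path_image \<gamma> = L" using L(1) unfolding uu_disc_def by blast
  obtain \<gamma>' \<sigma> where g: "\<And>t. t \<in> {0..1} \<Longrightarrow> (\<gamma> has_vector_derivative \<gamma>' t) (at t within {0..1})"
    "continuous_on {0..1} \<gamma>'" "\<And>t. t \<in> {0..1} \<Longrightarrow> \<gamma>' t \<in> cone_uu (1/2)" "\<sigma> = 1 \<or> \<sigma> = (-1 :: real)"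
    "\<And>a b. \<lbrakk>a \<in> {0..1}; b \<in> {0..1}; a < b\<rbrakk> \<Longrightarrow> \<sigma> * yc (\<gamma> a) < \<sigma> * yc (\<gamma> b)"
    "continuous_on {0..1} \<gamma>"
    by (rule uu_arcE[OF \<gamma>(1)]) blast
  let ?I = "{0..1::real}"
  have inL: "\<gamma> t \<in> L" if "t \<in> ?I" for t using that \<gamma>(2) unfolding path_image_def by blast
  have inD: "\<gamma> t \<in> \<Delta>" if "t \<in> ?I" for t using inL[OF that] L(2) by blast
  \<comment> \<open>\<open>v\<close> is \<open>\<bar>y\<bar>\<close> in the band; \<open>\<tau>\<close> is the direction in which it changes along the arc.\<close>
  define v where "v t = s * yc (\<gamma> t)" for t
  define \<tau> where "\<tau> = \<sigma> * s"
  have \<tau>: "\<tau> = 1 \<or> \<tau> = -1" using s g(4) unfolding \<tau>_def by auto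
  have mono: "\<tau> * v a < \<tau> * v b" if "a \<in> ?I" "b \<in> ?I" "a < b" for a b
    using g(5)[OF that] s unfolding \<tau>_def v_def by auto
  have bandv: "\<gamma> t \<in> band s \<longleftrightarrow> 2 \<le> v t" if "t \<in> ?I" for t
    using inD[OF that] by (simp add: band_def v_def)
  have onto: "\<exists>t\<in>?I. v t = y" if "y \<in> {-4..4}" for y
  proof -
    have "s * y \<in> (\<lambda>t. yc (\<gamma> t)) ` ?I" unfolding uu_arc_onto[OF \<gamma>(1)] using that s by auto
    then obtain t where "t \<in> ?I" "yc (\<gamma> t) = s * y" by auto
    then show ?thesis using s by (intro bexI[of _ t]) (auto simp: v_def)
  qed
  define G where "G t = yc (F (\<gamma> t))" for t
  have cF: "continuous_on ?I (\<lambda>t. F (\<gamma> t))"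
    by (rule continuous_on_compose2[OF continuous_F g(6)]) (use inD in blast)
  have Gmono: "G a < G b" if "a \<in> ?I" "b \<in> ?I" "2 \<le> v a" "v a < v b" for a b
    unfolding G_def
    by (rule disc_image_y_monotone[OF s L(1) inL[OF that(1)] inL[OF that(2)]])
      (use that bandv in \<open>auto simp: v_def\<close>)
  \<comment> \<open>\<open>c\<close> and \<open>d\<close> bound a part of the arc in the band whose image crosses the whole strip.\<close>
  obtain c where c: "c \<in> ?I" "v c = 2" using onto[of 2] by auto
  obtain d where d: "d \<in> ?I" "v d = 39/10" using onto[of "39/10"] by auto
  have sq: "(yc (\<gamma> t))\<^sup>2 = (v t)\<^sup>2" for t using s by (auto simp: v_def power_mult_distrib)
  have Gc: "G c \<le> -4" using F_approx_bounds(4)[OF inD[OF c(1)]] \<mu> unfolding sq c(2) G_def by simp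
  have Gd: "4 \<le> G d" using F_approx_bounds(3)[OF inD[OF d(1)]] \<mu> unfolding sq d(2) G_def by (simp add: power_divide)
  have seg: "closed_segment a b \<subseteq> ?I" if "a \<in> ?I" "b \<in> ?I" for a b
    using that by (intro closed_segment_subset) auto
  have connG: "connected (G ` closed_segment c d)"
    unfolding G_def
    by (intro connected_continuous_image continuous_on_fst continuous_on_snd continuous_on_subset[OF cF] seg c d) simp
  have val: "\<exists>t\<in>?I. 2 \<le> v t \<and> G t = y" if y: "y \<in> {-4..4}" for y
  proof -
    have "y \<in> G ` closed_segment c d"
      by (rule connectedD_interval[OF connG, of "G c" "G d"]) (use Gc Gd y in auto)
    then obtain t where t: "t \<in> closed_segment c d" "G t = y" by blast
    have tI: "t \<in> ?I" using seg[OF c(1) d(1)] t(1) by blast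
    have "2 \<le> v t"
    proof (cases "t = c")
      case False
      have "t = d \<or> c < t \<and> t < d \<or> d < t \<and> t < c"
        using t(1) False unfolding closed_segment_eq_real_ivl by (auto split: if_splits)
      then show ?thesis
        using mono[OF c(1) tI] mono[OF tI d(1)] mono[OF d(1) tI] mono[OF tI c(1)] \<tau> c(2) d(2) by auto
    qed (simp add: c(2))
    then show ?thesis using tI t(2) by blast
  qed
  obtain t1 where t1: "t1 \<in> ?I" "2 \<le> v t1" "G t1 = -4" using val[of "-4"] by auto
  obtain t2 where t2: "t2 \<in> ?I" "2 \<le> v t2" "G t2 = 4" using val[of 4] by auto
  have v12: "v t1 < v t2"
  proof (rule ccontr)
    assume "\<not> v t1 < v t2"
    then consider "v t2 < v t1" | "v t1 = v t2" by linarith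
    then show False
    proof cases
      case 1 from Gmono[OF t2(1) t1(1) t2(2) 1] show False using t1(3) t2(3) by simp
    next
      case 2
      then have "t1 = t2" using mono[OF t1(1) t2(1)] mono[OF t2(1) t1(1)] by (cases t1 t2 rule: linorder_cases) auto
      then show False using t1(3) t2(3) by simp
    qed
  qed
  have segv: "t \<in> closed_segment t1 t2 \<longleftrightarrow> v t1 \<le> v t \<and> v t \<le> v t2" if t: "t \<in> ?I" for t
  proof -
    have le: "a \<le> b \<longleftrightarrow> \<tau> * v a \<le> \<tau> * v b" if "a \<in> ?I" "b \<in> ?I" for a b
      using mono[OF that] mono[OF that(2,1)] by (cases a b rule: linorder_cases) auto
    show ?thesis
    proof (cases "\<tau> = 1")
      case True
      then have "t1 \<le> t2" using v12 le[OF t1(1) t2(1)] by simp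
      then show ?thesis using True le[OF t1(1) t] le[OF t t2(1)] by (simp add: closed_segment_eq_real_ivl)
    next
      case False
      then have m: "\<tau> = -1" using \<tau> by simp
      then have "\<not> t1 \<le> t2" using v12 le[OF t1(1) t2(1)] by simp
      then show ?thesis using m le[OF t2(1) t] le[OF t t1(1)] by (auto simp: closed_segment_eq_real_ivl)
    qed
  qed
  have branch: "\<gamma> t \<in> branch s \<longleftrightarrow> t \<in> closed_segment t1 t2" if t: "t \<in> ?I" for t
  proof
    assume b: "\<gamma> t \<in> branch s"
    then have vt: "2 \<le> v t" "-4 \<le> G t" "G t \<le> 4"
      using branch_band[OF s] bandv[OF t] unfolding branch_def G_def by auto
    have "\<not> v t < v t1" using Gmono[OF t t1(1) vt(1)] vt(2) t1(3) by auto
    moreover have "\<not> v t2 < v t" using Gmono[OF t2(1) t t2(2)] vt(3) t2(3) by auto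
    ultimately show "t \<in> closed_segment t1 t2" unfolding segv[OF t] by simp
  next
    assume "t \<in> closed_segment t1 t2"
    then have vt: "v t1 \<le> v t" "v t \<le> v t2" unfolding segv[OF t] by simp_all
    have eq: "G a = G b" if "a \<in> ?I" "b \<in> ?I" "v a = v b" for a b
      using mono[OF that(1,2)] mono[OF that(2,1)] that(3) by (cases a b rule: linorder_cases) auto
    have "-4 \<le> G t" using Gmono[OF t1(1) t t1(2)] eq[OF t1(1) t] vt(1) t1(3) by (cases "v t1 = v t") auto
    moreover have "2 \<le> v t" using vt(1) t1(2) by simp
    moreover have "G t \<le> 4" using Gmono[OF t t2(1)] eq[OF t t2(1)] vt(2) t2(3) \<open>2 \<le> v t\<close> by (cases "v t = v t2") auto
    ultimately show "\<gamma> t \<in> branch s" using inD[OF t] unfolding branch_def G_def v_def by simp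
  qed
  define \<phi> where "\<phi> x = (t2 - t1) * x + t1" for x
  have \<phi>seg: "\<phi> ` ?I = closed_segment t1 t2"
    unfolding closed_segment_image_interval by (rule image_cong) (simp_all add: \<phi>_def algebra_simps)
  then have \<phi>I: "\<phi> x \<in> closed_segment t1 t2" "\<phi> x \<in> ?I" if "x \<in> ?I" for x
    using that seg[OF t1(1) t2(1)] by blast+
  have t12: "t2 - t1 \<noteq> 0" using v12 by auto
  define \<delta> where "\<delta> x = F (\<gamma> (\<phi> x))" for x
  have im: "path_image \<delta> = F ` (L \<inter> branch s)"
  proof -
    have "\<gamma> ` closed_segment t1 t2 = L \<inter> branch s"
      using branch seg[OF t1(1) t2(1)] \<gamma>(2) unfolding path_image_def by blast
    moreover have "path_image \<delta> = F ` \<gamma> ` \<phi> ` ?I" unfolding path_image_def \<delta>_def by (simp add: image_image)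
    ultimately show ?thesis unfolding \<phi>seg by simp
  qed
  obtain D :: "r3 \<Rightarrow> r3 \<Rightarrow>\<^sub>L r3" where D: "continuous_on \<Delta> D"
    "\<And>p. p \<in> \<Delta> \<Longrightarrow> DF henon_cube F p = blinfun_apply (D p)" by (rule DF_blinfun) blast
  have c\<phi>: "continuous_on ?I \<phi>" unfolding \<phi>_def by (intro continuous_intros)
  have c\<gamma>: "continuous_on ?I (\<lambda>x. \<gamma> (\<phi> x))" by (rule continuous_on_compose2[OF g(6) c\<phi>]) (use \<phi>I in blast)
  have c\<gamma>': "continuous_on ?I (\<lambda>x. \<gamma>' (\<phi> x))" by (rule continuous_on_compose2[OF g(2) c\<phi>]) (use \<phi>I in blast)
  have cD: "continuous_on ?I (\<lambda>x. D (\<gamma> (\<phi> x)))"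
    by (rule continuous_on_compose2[OF D(1) c\<gamma>]) (use \<phi>I inD in blast)
  have "uu_arc henon_cube (1/2) \<delta>"
  proof (rule uu_arcI)
    show "continuous_on ?I (\<lambda>x. D (\<gamma> (\<phi> x)) ((t2 - t1) *\<^sub>R \<gamma>' (\<phi> x)))"
      by (intro bounded_bilinear.continuous_on[OF bounded_bilinear_blinfun_apply] cD continuous_on_scaleR
          continuous_on_const c\<gamma>')
  next
    fix x assume x: "x \<in> ?I"
    have "(\<phi> has_vector_derivative (t2 - t1)) (at x within ?I)"
      unfolding \<phi>_def by (auto intro!: derivative_eq_intros simp: has_real_derivative_iff_has_vector_derivative[symmetric])
    moreover have "(\<gamma> has_vector_derivative \<gamma>' (\<phi> x)) (at (\<phi> x) within \<phi> ` ?I)"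
      using g(1)[OF \<phi>I(2)[OF x]] by (rule has_vector_derivative_within_subset) (use \<phi>I in blast)
    ultimately have "(\<gamma> \<circ> \<phi> has_vector_derivative (t2 - t1) *\<^sub>R \<gamma>' (\<phi> x)) (at x within ?I)"
      by (rule vector_diff_chain_within)
    then have d1: "((\<lambda>x. \<gamma> (\<phi> x)) has_derivative (\<lambda>h. h *\<^sub>R (t2 - t1) *\<^sub>R \<gamma>' (\<phi> x))) (at x within ?I)"
      unfolding has_vector_derivative_def o_def .
    have "(F has_derivative DF henon_cube F (\<gamma> (\<phi> x))) (at (\<gamma> (\<phi> x)) within (\<lambda>x. \<gamma> (\<phi> x)) ` ?I)"
      by (rule has_derivative_subset[OF has_DF[OF inD[OF \<phi>I(2)[OF x]]]]) (use \<phi>I inD in blast)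
    from has_derivative_in_compose[OF d1 this]
    show "(\<delta> has_vector_derivative D (\<gamma> (\<phi> x)) ((t2 - t1) *\<^sub>R \<gamma>' (\<phi> x))) (at x within ?I)"
      unfolding \<delta>_def has_vector_derivative_def D(2)[OF inD[OF \<phi>I(2)[OF x]]] by (simp add: blinfun.scaleR_right)
    have b: "\<gamma> (\<phi> x) \<in> branch s" using branch[OF \<phi>I(2)[OF x]] \<phi>I(1)[OF x] by simp
    have m: "4 \<le> \<bar>2 * yc (\<gamma> (\<phi> x))\<bar>" "\<bar>2 * yc (\<gamma> (\<phi> x))\<bar> \<le> 8" using branch_bounds[OF s b] s by auto
    show "D (\<gamma> (\<phi> x)) ((t2 - t1) *\<^sub>R \<gamma>' (\<phi> x)) \<in> cone_uu (1/2)"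
      using DF_near_step[OF inD[OF \<phi>I(2)[OF x]]] unfolding D(2)[OF inD[OF \<phi>I(2)[OF x]]]
      by (rule near_step_cone_uu[OF _ m \<xi>]) (rule cone_uu_scale[OF g(3)[OF \<phi>I(2)[OF x]] t12])
    show "yc (\<delta> x) \<in> {-4..4}" using b unfolding branch_def \<delta>_def by simp
  qed (use t1(3) t2(3) in \<open>simp_all add: \<delta>_def \<phi>_def G_def\<close>)
  then show "uu_disc henon_cube (1/2) (F ` (L \<inter> branch s))" unfolding uu_disc_def using im by blast
qed

end

section \<open>Heights over the stable curves\<close>

context near_henon
begin

lemma trapped_graph:
  assumes s: "s = 1 \<or> s = -1"
  shows "trapped s = (\<lambda>a. (a, wY s a, wZ s a)) ` {-4..4}"
  unfolding trapped_image_wpt[OF s] using wpt_coords[OF s] by (intro image_cong) simp_all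

text \<open>The reference discs of the two classes lie at the heights \<open>22\<close> and \<open>-40\<close>, beyond the whole curve.\<close>

lemma class_iff_on_side:
  assumes s: "s = 1 \<or> s = -1"
  shows "L \<in> right_class henon_cube (1/2) (trapped s) \<longleftrightarrow> on_side (wY s) (wZ s) 1 L"
    and "L \<in> left_class henon_cube (1/2) (trapped s) \<longleftrightarrow> on_side (wY s) (wZ s) (-1) L"
proof -
  have z: "zhi henon_cube = 22" "zlo henon_cube = -40" by (simp_all add: henon_cube_def)
  have Z: "-40 < wZ s a" "wZ s a < 22" if "a \<in> {-4..4}" for a
    using trapped_interior(3,4)[OF wpt(1)[OF s that]] .
  have pos: "0 < 1 * (22 - wZ s a)" "0 < (-1) * (-40 - wZ s a)" if "a \<in> {-4..4}" for a
    using Z[OF that] by simp_all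
  note g = s_graph_trapped[OF s]
  show "L \<in> right_class henon_cube (1/2) (trapped s) \<longleftrightarrow> on_side (wY s) (wZ s) 1 L"
    unfolding right_class_def mem_Collect_eq z
    by (rule iffI, rule on_side_if_homotopic[OF g _ trapped_graph[OF s] pos(1)], simp, assumption+,
        rule homotopic_if_on_side[OF g _ trapped_graph[OF s] pos(1)], simp, assumption+)
  show "L \<in> left_class henon_cube (1/2) (trapped s) \<longleftrightarrow> on_side (wY s) (wZ s) (-1) L"
    unfolding left_class_def mem_Collect_eq z
    by (rule iffI, rule on_side_if_homotopic[OF g _ trapped_graph[OF s] pos(2)], simp, assumption+,
        rule homotopic_if_on_side[OF g _ trapped_graph[OF s] pos(2)], simp, assumption+)
qed

definition height :: "real \<Rightarrow> r3 \<Rightarrow> real" where "height s p = zc p - wZ s (xc p)"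

definition on_wall :: "real \<Rightarrow> r3 \<Rightarrow> bool" where "on_wall s p \<longleftrightarrow> yc p = wY s (xc p)"

lemma on_side_height:
  "on_side (wY s) (wZ s) k L \<longleftrightarrow> uu_disc henon_cube (1/2) L \<and> (\<forall>p\<in>L. xc p \<in> {-4..4}) \<and>
     (\<exists>p\<in>L. on_wall s p \<and> 0 < k * height s p)"
  unfolding on_side_def height_def on_wall_def by simp

text \<open>To find the side of the image of a disc it suffices to look at the point of the disc that is mapped
  to the wall.\<close>

lemma crossing_of_image:
  assumes s: "s = 1 \<or> s = -1" and s': "s' = 1 \<or> s' = -1" and L: "uu_disc henon_cube (1/2) L" "L \<subseteq> \<Delta>"
  obtains p where "p \<in> L" "p \<in> branch s" "on_wall s' (F p)"
    "\<And>k. 0 < k * height s' (F p) \<Longrightarrow> on_side (wY s') (wZ s') k (F ` (L \<inter> branch s))"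
proof -
  note D = image_uu_disc[OF s L]
  obtain q where q: "q \<in> F ` (L \<inter> branch s)" "yc q = wY s' (xc q)"
    by (rule wall_crossing_exists[OF D(1) D(2) s_graph_trapped[OF s']])
  then obtain p where p: "p \<in> L" "p \<in> branch s" "q = F p" by blast
  have w: "on_wall s' (F p)" unfolding on_wall_def p(3)[symmetric] by (rule q(2))
  show thesis
  proof (rule that[OF p(1,2) w])
    fix k assume "0 < k * height s' (F p)"
    then show "on_side (wY s') (wZ s') k (F ` (L \<inter> branch s))"
      unfolding on_side_height using D q(1) w p(3) by (intro conjI ballI bexI[of _ q]) simp_all
  qed
qed

text \<open>Let \<open>p\<close> be the point of \<open>L\<close> that \<open>F\<close> maps to the wall. It lies on the preimage of the wall, which
  passes through the curve and is nearly vertical like the wall itself; so \<open>p\<close> is close to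
  the crossing \<open>q\<close> of \<open>L\<close> with the wall, and their heights differ by at most one percent. Along the preimage of the
  wall \<open>F\<close> multiplies the height by about \<open>\<xi>\<close>.\<close>

lemma height_of_image_same_sign:
  assumes s: "s = 1 \<or> s = -1" and L: "uu_disc henon_cube (1/2) L" "L \<subseteq> \<Delta>"
    and p: "p \<in> L" "p \<in> branch s" "on_wall s (F p)" and q: "q \<in> L" "on_wall s q"
    and k: "k = 1 \<or> k = -1" "0 < k * height s q"
  shows "0 < k * height s (F p)"
proof -
  note g = s_graph_trapped[OF s]
  have xp: "xc p \<in> {-4..4}" and xq: "xc q \<in> {-4..4}" using L(2) p(1) q(1) by (auto simp: Delta_iff)
  define w where "w = wpt s (xc p)"
  have w: "w \<in> trapped s" "xc p = xc w" using wpt[OF s xp] by (simp_all add: w_def)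
  have Fw: "F w = wpt s (xc (F w))" by (rule trapped_eq_wpt[OF s trapped_image[OF w(1)]])
  have xF: "xc (F p) \<in> {-4..4}" "xc (F w) \<in> {-4..4}"
    using branch_image_x[OF s p(2)] trapped_x[OF trapped_image[OF w(1)]] by auto
  have b: "p \<in> band s" "w \<in> band s" using p(2) trapped_branch[OF w(1)] branch_band[OF s] by blast+
  define dz where "dz = zc p - zc w"
  have hp: "dz = height s p" unfolding dz_def height_def w_def ..
  have wy: "yc (F p) = wY s (xc (F p))" "yc (F w) = wY s (xc (F w))" using p(3) Fw unfolding on_wall_def by simp_all
  note nv = wall_preimage_nearly_vertical[OF s g b w(2) xF wy, folded dz_def]
  have zF: "\<bar>wZ s (xc (F p)) - wZ s (xc (F w))\<bar> \<le> \<bar>xc (F p) - xc (F w)\<bar> / 100" by (rule s_graphD(5)[OF g xF])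
  have zw: "zc (F w) = wZ s (xc (F w))" using Fw by simp
  have hF: "\<bar>height s (F p) - \<xi> * dz\<bar> \<le> \<bar>dz\<bar> / 100"
  proof -
    have "\<bar>a - b - e\<bar> \<le> m / 500 \<Longrightarrow> \<bar>c - b\<bar> \<le> x / 100 \<Longrightarrow> x \<le> m / 500 \<Longrightarrow> 0 \<le> m \<Longrightarrow> \<bar>(a - c) - e\<bar> \<le> m / 100"
      for a b c e m x :: real by linarith
    from this[OF nv(3)[unfolded zw] zF nv(2) abs_ge_zero] show ?thesis unfolding height_def .
  qed
  have hq: "\<bar>height s q - dz\<bar> \<le> \<bar>dz\<bar> / 100"
  proof -
    have y: "\<bar>wY s (xc q) - wY s (xc p)\<bar> \<le> \<bar>xc q - xc p\<bar> / 100" by (rule s_graphD(4)[OF g xq xp])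
    have z: "\<bar>wZ s (xc q) - wZ s (xc p)\<bar> \<le> \<bar>xc q - xc p\<bar> / 100" by (rule s_graphD(5)[OF g xq xp])
    have yp: "\<bar>yc p - wY s (xc p)\<bar> \<le> \<bar>dz\<bar> / 1000" using nv(1) by (simp add: w_def)
    have "yc q = wY s (xc q)" using q(2) unfolding on_wall_def .
    with y yp have yy: "\<bar>yc q - yc p\<bar> \<le> \<bar>xc q - xc p\<bar> / 100 + \<bar>dz\<bar> / 1000" by linarith
    note l = uu_disc_coords(1,2)[OF L(1) q(1) p(1)]
    have half: "\<bar>zc q - zc p\<bar> \<le> \<bar>yc q - yc p\<bar> / 2" using l(2) by simp
    have "y \<le> x / 100 + m / 1000 \<Longrightarrow> 2 * x \<le> y \<Longrightarrow> \<bar>a - b\<bar> \<le> y / 2 \<Longrightarrow> \<bar>c - d\<bar> \<le> x / 100 \<Longrightarrow> 0 \<le> m \<Longrightarrow> 0 \<le> x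
      \<Longrightarrow> \<bar>(a - c) - (b - d)\<bar> \<le> m / 100" for a b c d x y m :: real by linarith
    from this[OF yy l(1) half z abs_ge_zero abs_ge_zero] show ?thesis unfolding hp height_def .
  qed
  have "\<bar>a - d\<bar> \<le> \<bar>d\<bar> / 100 \<Longrightarrow> 0 < a \<Longrightarrow> 0 < d" "\<bar>a - d\<bar> \<le> \<bar>d\<bar> / 100 \<Longrightarrow> a < 0 \<Longrightarrow> d < 0" for a d :: real
    by linarith+
  from this[OF hq] have kdz: "0 < k * dz" using k by auto
  then have "(59/50) * (k * dz) \<le> \<xi> * (k * dz)" using \<xi> by (intro mult_right_mono) auto
  then have ku: "(59/50) * (k * dz) \<le> k * (\<xi> * dz)" by (simp only: mult.left_commute)
  have "\<bar>h - u\<bar> \<le> \<bar>d\<bar> / 100 \<Longrightarrow> 0 < k * d \<Longrightarrow> (59/50) * (k * d) \<le> k * u \<Longrightarrow> 0 < k * h" for h u d :: real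
  proof -
    have "\<bar>h - u\<bar> \<le> \<bar>d\<bar> / 100 \<Longrightarrow> 0 < d \<Longrightarrow> (59/50) * d \<le> u \<Longrightarrow> 0 < h"
      "\<bar>h - u\<bar> \<le> \<bar>d\<bar> / 100 \<Longrightarrow> d < 0 \<Longrightarrow> u \<le> (59/50) * d \<Longrightarrow> h < 0" by linarith+
    then show "\<bar>h - u\<bar> \<le> \<bar>d\<bar> / 100 \<Longrightarrow> 0 < k * d \<Longrightarrow> (59/50) * (k * d) \<le> k * u \<Longrightarrow> 0 < k * h"
      using k(1) by auto
  qed
  from this[OF hF kdz ku] show ?thesis .
qed

text \<open>The fixed point equations \<open>y = \<mu> + y\<^sup>2\<close> and \<open>(\<xi> - 1) z = -y\<close> up to errors; the bounds for \<open>z\<close> use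
  \<open>0.18 < \<xi> - 1 < 0.19\<close>.\<close>

lemma saddle_coords:
  assumes s: "s = 1 \<or> s = -1"
  shows "22/10 < s * yc (saddle s)" "s * yc (saddle s) < 15/4"
    "\<bar>yc (saddle s) - (\<mu> + (yc (saddle s))\<^sup>2)\<bar> \<le> tol"
    "\<bar>(\<xi> - 1) * (- s * zc (saddle s)) - s * yc (saddle s)\<bar> \<le> tol"
    "11 < - s * zc (saddle s)" "- s * zc (saddle s) < 21"
proof -
  let ?R = "saddle s"
  have R: "?R \<in> \<Delta>" "?R \<in> branch s" "F ?R = ?R"
    using trapped_in_Delta[OF saddle(1)[OF s]] trapped_branch[OF saddle(1)[OF s]] saddle(2)[OF s] .
  show y: "22/10 < s * yc ?R" "s * yc ?R < 15/4" using branch_bounds[OF s R(2)] .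
  show "\<bar>yc ?R - (\<mu> + (yc ?R)\<^sup>2)\<bar> \<le> tol" using F_approx(2)[OF R(1)] R(3) by simp
  have "\<bar>zc ?R - (\<xi> * zc ?R + yc ?R)\<bar> \<le> tol" using F_approx(3)[OF R(1)] R(3) by simp
  moreover have "(\<xi> - 1) * (- s * zc ?R) - s * yc ?R = s * (zc ?R - (\<xi> * zc ?R + yc ?R))"
    by (simp add: algebra_simps)
  moreover have "\<bar>s\<bar> = 1" using s by auto
  ultimately show z: "\<bar>(\<xi> - 1) * (- s * zc ?R) - s * yc ?R\<bar> \<le> tol" by (simp only: abs_mult mult_1_left)
  have gen: "11 < \<zeta> \<and> \<zeta> < 21"
    if "\<bar>(\<xi> - 1) * \<zeta> - \<eta>\<bar> \<le> tol" "22/10 < \<eta>" "\<eta> < 15/4" for \<eta> \<zeta> :: real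
  proof -
    have lo: "219/100 \<le> (\<xi> - 1) * \<zeta>" and hi: "(\<xi> - 1) * \<zeta> \<le> 376/100"
      using that by linarith+
    have "11 < \<zeta>"
    proof (rule ccontr)
      assume "\<not> 11 < \<zeta>"
      then have "(\<xi> - 1) * \<zeta> \<le> (\<xi> - 1) * 11" using \<xi> by (intro mult_left_mono) auto
      also have "\<dots> < 219/100" using \<xi> by simp
      finally show False using lo by simp
    qed
    moreover have "\<zeta> < 21"
    proof (rule ccontr)
      assume "\<not> \<zeta> < 21"
      have "376/100 < (\<xi> - 1) * 21" using \<xi> by simp
      also have "\<dots> \<le> (\<xi> - 1) * \<zeta>" using \<xi> \<open>\<not> \<zeta> < 21\<close> by (intro mult_left_mono) auto
      finally show False using hi by simp
    qed
    ultimately show ?thesis ..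
  qed
  show "11 < - s * zc ?R" "- s * zc ?R < 21" using gen[OF z y] by blast+
qed

text \<open>The bound \<open>21\<close> of the previous lemma would not keep the discs through the stable curve of \<open>P\<close> off the
  face \<open>z = 22\<close>. The negative solution of \<open>y = \<mu> + y\<^sup>2\<close> is smaller than the positive one:
  \<open>\<bar>y\<bar> \<ge> 2.78\<close> would give \<open>y\<^sup>2 + \<bar>y\<bar> > 10.5\<close>.\<close>

lemma saddle_P_height: "zc (saddle (-1)) < 155/10"
proof (rule ccontr)
  assume "\<not> ?thesis"
  then have a: "(\<xi> - 1) * (155/10) \<le> (\<xi> - 1) * zc (saddle (-1))" using \<xi> by (intro mult_left_mono) auto
  note c = saddle_coords[of "-1"]
  define y where "y = - yc (saddle (-1))"
  have "(\<xi> - 1) * zc (saddle (-1)) \<le> y + tol" using abs_le_D1[OF c(4)] by (simp add: y_def)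
  with a \<xi> have "27897/10000 - 2 * tol \<le> y" by simp
  then have y: "278/100 \<le> y" by simp
  then have "(278/100) * (278/100) \<le> y * y" by (intro mult_mono) auto
  moreover have "y * y + y \<le> - \<mu> + tol" using abs_le_D2[OF c(3)] by (simp add: y_def power2_eq_square)
  ultimately show False using y \<mu> by simp
qed

lemma near_saddle:
  assumes s: "s = 1 \<or> s = -1" and a: "a \<in> {-4..4}"
  shows "\<bar>wY s a - yc (saddle s)\<bar> \<le> 8/100" "\<bar>wZ s a - zc (saddle s)\<bar> \<le> 8/100"
proof -
  let ?x = "xc (saddle s)"
  have x: "?x \<in> {-4..4}" by (rule trapped_x[OF saddle(1)[OF s]])
  have R: "wpt s ?x = saddle s" using trapped_eq_wpt[OF s saddle(1)[OF s]] by simp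
  have "\<bar>a - ?x\<bar> \<le> 8" using a x by auto
  then have "\<bar>a - ?x\<bar> / 100 \<le> 8 / 100" by simp
  then show "\<bar>wY s a - yc (saddle s)\<bar> \<le> 8/100" "\<bar>wZ s a - zc (saddle s)\<bar> \<le> 8/100"
    using s_graphD(4,5)[OF s_graph_trapped[OF s] a x] unfolding R by (blast intro: order_trans)+
qed

text \<open>All quantities are multiplied by \<open>\<plusminus>s\<close> to be positive: \<open>\<eta> = \<bar>y\<^sub>R\<bar>\<close> and \<open>\<zeta> = \<bar>z\<^sub>R\<bar>\<close> for the saddle \<open>R\<close>. The
  point \<open>p\<close> that \<open>F\<close> maps to the wall has the same \<open>y\<^sup>2\<close> as \<open>R\<close>, approximately, hence \<open>y \<approx> -y\<^sub>R\<close>. On the way from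
  the crossing \<open>q\<close> to \<open>p\<close>, the \<open>z\<close>-coordinate changes by at most half of \<open>2 \<eta>\<close>. So up to small errors the
  image lies at the distance \<open>\<xi> (\<zeta> - \<eta>) + \<eta> - \<zeta> = (2 - \<xi>) \<eta>\<close> beyond the curve, where
  \<open>(\<xi> - 1) \<zeta> = \<eta>\<close> is the fixed point equation.\<close>

lemma height_of_image_across:
  assumes s: "s = 1 \<or> s = -1" and L: "uu_disc henon_cube (1/2) L" "L \<subseteq> \<Delta>"
    and p: "p \<in> L" "p \<in> branch (- s)" "on_wall s (F p)" and q: "q \<in> L" "on_wall s q" "0 \<le> - s * height s q"
  shows "0 < - s * height s (F p)"
proof -
  have s': "- s = 1 \<or> - s = -1" using s by auto
  have pD: "p \<in> \<Delta>" and xq: "xc q \<in> {-4..4}" using L(2) p(1) q(1) by (auto simp: Delta_iff)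
  have xF: "xc (F p) \<in> {-4..4}" using branch_image_x[OF s' p(2)] by auto
  note R = saddle_coords[OF s]
  define \<eta> \<zeta> v zp zq where defs: "\<eta> = s * yc (saddle s)" "\<zeta> = - s * zc (saddle s)" "v = - s * yc p"
     "zp = - s * zc p" "zq = - s * zc q"
  have vb: "22/10 < v" using branch_bounds[OF s' p(2)] unfolding defs by simp
  have v: "\<bar>v - \<eta>\<bar> \<le> 2/100"
  proof -
    have "v\<^sup>2 = (yc p)\<^sup>2" "\<eta>\<^sup>2 = (yc (saddle s))\<^sup>2" using s unfolding defs by (auto simp: power_mult_distrib)
    moreover have "yc (F p) = wY s (xc (F p))" using p(3) unfolding on_wall_def .
    \<comment> \<open>\<open>8/100\<close> bounds the variation of \<open>Y\<close> along the curve, twice \<open>tol\<close> the two approximations of \<open>y \<circ> F\<close>.\<close>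
    ultimately have sq: "\<bar>v\<^sup>2 - \<eta>\<^sup>2\<bar> \<le> 802/10000"
      using R(3) F_approx(2)[OF pD] near_saddle(1)[OF s xF] by linarith
    have "v\<^sup>2 - \<eta>\<^sup>2 = (v - \<eta>) * (v + \<eta>)" by (simp add: power2_eq_square algebra_simps)
    then have "\<bar>v - \<eta>\<bar> * (v + \<eta>) \<le> 802/10000" using sq vb R(1) unfolding defs(1)[symmetric] by (simp add: abs_mult)
    moreover have "\<bar>v - \<eta>\<bar> * (44/10) \<le> \<bar>v - \<eta>\<bar> * (v + \<eta>)"
      using vb R(1) unfolding defs(1)[symmetric] by (intro mult_left_mono) auto
    moreover have "d * (44/10) \<le> m \<Longrightarrow> m \<le> 802/10000 \<Longrightarrow> d \<le> 2/100" for d m :: real by linarith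
    ultimately show ?thesis by blast
  qed
  have yq: "\<bar>s * yc q - \<eta>\<bar> \<le> 8/100"
  proof -
    have "s * yc q - \<eta> = s * (wY s (xc q) - yc (saddle s))"
      using q(2) unfolding on_wall_def defs by (simp add: algebra_simps)
    moreover have "\<bar>s\<bar> = 1" using s by auto
    ultimately show ?thesis using near_saddle(1)[OF s xq] by (simp only: abs_mult mult_1_left)
  qed
  have zq: "\<zeta> - 8/100 \<le> zq"
    using abs_le_D1[OF near_saddle(2)[OF s xq]] abs_le_D2[OF near_saddle(2)[OF s xq]] q(3) s
    unfolding height_def defs by auto
  have "2 * \<bar>zc p - zc q\<bar> \<le> \<bar>yc p - yc q\<bar>" by (rule uu_disc_coords(2)[OF L(1) p(1) q(1)])
  then have "2 * \<bar>zp - zq\<bar> \<le> \<bar>v + s * yc q\<bar>"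
    using s unfolding defs by (auto simp: abs_minus_commute)
  then have "\<bar>zp - zq\<bar> + \<bar>zp - zq\<bar> \<le> \<bar>v + s * yc q\<bar>" by (simp only: mult_2)
  moreover have "0 < \<eta>" using R(1) unfolding defs by simp
  ultimately have zp: "\<zeta> - \<eta> - 13/100 \<le> zp" using v yq zq by linarith
  have "\<xi> * (\<zeta> - \<eta> - 13/100) \<le> \<xi> * zp" using zp \<xi> by (intro mult_left_mono) auto
  moreover have "\<xi> * (\<zeta> - \<eta> - 13/100) = (\<xi> - 1) * \<zeta> + \<zeta> - \<xi> * \<eta> - \<xi> * (13/100)" by (simp add: algebra_simps)
  moreover have "\<eta> - tol \<le> (\<xi> - 1) * \<zeta>" using R(4) unfolding defs[symmetric] by linarith
  moreover have "\<xi> * \<eta> \<le> (119/100) * \<eta>" using \<xi> R(1) unfolding defs[symmetric] by (intro mult_right_mono) auto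
  moreover have "\<xi> * zp + v - tol \<le> - s * zc (F p)"
    using F_approx_bounds(5,6)[OF pD] s unfolding defs by auto
  moreover have "- s * wZ s (xc (F p)) \<le> \<zeta> + 8/100"
    using abs_le_D1[OF near_saddle(2)[OF s xF]] abs_le_D2[OF near_saddle(2)[OF s xF]] s unfolding defs by auto
  ultimately have "- s * wZ s (xc (F p)) < - s * zc (F p)"
    using v R(1) \<xi> unfolding defs(1)[symmetric] by linarith
  then show ?thesis unfolding height_def by (simp add: algebra_simps)
qed

end

section \<open>The conditions of a blender-horseshoe\<close>

lemma components_two_pieces:
  fixes U V :: "r3 set"
  assumes "closed U" "closed V" "connected U" "connected V" "U \<noteq> {}" "V \<noteq> {}" "U \<inter> V = {}"
  shows "components (U \<union> V) = {U, V}"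
proof -
  have cc: "connected_component_set (U \<union> V) x = U"
    if c: "closed U" "closed V" "connected U" "U \<inter> V = {}" and x: "x \<in> U" for U V :: "r3 set" and x
  proof
    show "U \<subseteq> connected_component_set (U \<union> V) x"
      by (rule connected_component_maximal[OF x c(3)]) simp
    let ?C = "connected_component_set (U \<union> V) x"
    have sub: "?C \<subseteq> U \<union> V" by (rule connected_component_subset)
    have "U \<inter> ?C = {} \<or> V \<inter> ?C = {}"
      by (rule connected_closedD[OF _ _ sub c(1,2)]) (use c(4) in auto)
    moreover have "x \<in> U \<inter> ?C" using x by simp
    ultimately show "?C \<subseteq> U" using sub by blast
  qed
  have 1: "connected_component_set (U \<union> V) x = U" if "x \<in> U" for x by (rule cc) (use assms that in auto)
  have 2: "connected_component_set (U \<union> V) x = V" if "x \<in> V" for x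
    using cc[of V U x] assms that by (simp add: Un_commute Int_commute)
  have "components (U \<union> V) = connected_component_set (U \<union> V) ` U \<union> connected_component_set (U \<union> V) ` V"
    unfolding components_def by blast
  also have "connected_component_set (U \<union> V) ` U = {U}"
    using 1 assms(5) by (metis (no_types, lifting) image_constant_conv image_cong)
  also have "connected_component_set (U \<union> V) ` V = {V}"
    using 2 assms(6) by (metis (no_types, lifting) image_constant_conv image_cong)
  finally show ?thesis by auto
qed

text \<open>The coordinate map \<open>T\<close> has a Lipschitz inverse, so \<open>S\<close> is a continuous image of the cube.\<close>

lemma connected_if_Delta_coordinates:
  fixes T :: "r3 \<Rightarrow> r3"
  assumes onto: "\<And>c. c \<in> \<Delta> \<Longrightarrow> \<exists>p\<in>S. T p = c" and inD: "\<And>p. p \<in> S \<Longrightarrow> T p \<in> \<Delta>"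
    and lip: "\<And>p q. p \<in> S \<Longrightarrow> q \<in> S \<Longrightarrow> l1 (p - q) \<le> 3 * l1 (T p - T q)"
  shows "connected S"
proof -
  obtain g where g: "\<And>c. c \<in> \<Delta> \<Longrightarrow> g c \<in> S \<and> T (g c) = c" using onto by metis
  have "9-lipschitz_on \<Delta> g"
  proof (rule lipschitz_onI)
    fix a b assume ab: "a \<in> \<Delta>" "b \<in> \<Delta>"
    have "l1 (g a - g b) \<le> 3 * l1 (a - b)" using lip[of "g a" "g b"] g[OF ab(1)] g[OF ab(2)] by simp
    then show "dist (g a) (g b) \<le> 9 * dist a b"
      using norm_le_l1[of "g a - g b"] l1_le_norm[of "a - b"] unfolding dist_norm by linarith
  qed simp
  then have "connected (g ` \<Delta>)"
    using convex_connected[OF convex_Delta] by (intro connected_continuous_image lipschitz_on_continuous_on)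
  moreover have "g ` \<Delta> = S"
  proof
    show "g ` \<Delta> \<subseteq> S" using g by blast
    show "S \<subseteq> g ` \<Delta>"
    proof
      fix p assume p: "p \<in> S"
      have "l1 (p - g (T p)) \<le> 0"
        using lip[OF p, of "g (T p)"] g[OF inD[OF p]] by (simp add: l1_def)
      then have "norm (p - g (T p)) \<le> 0" using norm_le_l1 order_trans by blast
      then have "p = g (T p)" by simp
      then show "p \<in> g ` \<Delta>" using inD[OF p] by (rule image_eqI)
    qed
  qed
  ultimately show ?thesis by simp
qed

context near_henon
begin

text \<open>The branch is parametrised by \<open>x\<close>, \<open>z\<close> and the second coordinate of the image.\<close>

lemma connected_branch:
  assumes s: "s = 1 \<or> s = -1"
  shows "connected (branch s)"
proof (rule connected_if_Delta_coordinates[where T = "\<lambda>p. (xc p, yc (F p), zc p)"])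
  fix c assume c: "c \<in> \<Delta>"
  have g: "s_graph (\<lambda>_. yc c) (\<lambda>_. 0)" using c by (simp add: s_graph_def Delta_iff)
  have cI: "xc c \<in> {-4..4}" "zc c \<in> {-40..22}" using c by (auto simp: Delta_iff)
  obtain y where y: "2 \<le> y" "(xc c, s * y, zc c) \<in> \<Delta>" "yc (F (xc c, s * y, zc c)) = yc c"
    by (rule preimage_of_wall_in_column[OF s g cI]) blast
  have "(xc c, s * y, zc c) \<in> branch s"
    using y c s unfolding branch_def by (auto simp: Delta_iff)
  then show "\<exists>p\<in>branch s. (xc p, yc (F p), zc p) = c"
    using y(3) by (intro bexI[of _ "(xc c, s * y, zc c)"]) (simp_all add: prod_eq_iff)
next
  fix p assume "p \<in> branch s"
  then show "(xc p, yc (F p), zc p) \<in> \<Delta>" by (auto simp: branch_def Delta_iff)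
next
  fix p q assume pq: "p \<in> branch s" "q \<in> branch s"
  then have b: "p \<in> band s" "q \<in> band s" using branch_band[OF s] by blast+
  have "\<bar>xc (p - q)\<bar> + \<bar>yc (p - q)\<bar> + \<bar>zc (p - q)\<bar> \<le> 3 * \<bar>xc (p - q)\<bar> + 3 * \<bar>yc (F p - F q)\<bar> + 3 * \<bar>zc (p - q)\<bar>"
    by (rule near_step_cases[OF difference_near_step[OF b[THEN band_DeltaD]] band_slope[OF s b] \<xi>,
        where \<Phi> = "\<lambda>a b c a' b' c'. a + b + c \<le> 3 * a + 3 * b' + 3 * c"]) linarith
  then show "l1 (p - q) \<le> 3 * l1 ((xc p, yc (F p), zc p) - (xc q, yc (F q), zc q))"
    by (simp add: l1_def)
qed

text \<open>Here the parameters are \<open>x\<close> and the last two coordinates of the image.\<close>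

lemma connected_branch_return:
  assumes s: "s = 1 \<or> s = -1"
  shows "connected {p \<in> branch s. F p \<in> \<Delta>}"
proof (rule connected_if_Delta_coordinates[where T = "\<lambda>p. (xc p, yc (F p), zc (F p))"])
  fix c assume c: "c \<in> \<Delta>"
  have g: "s_graph (\<lambda>_. yc c) (\<lambda>_. zc c)" using c by (simp add: s_graph_def Delta_iff)
  have cI: "xc c \<in> {-4..4}" using c by (auto simp: Delta_iff)
  obtain p where p: "p \<in> branch s" "xc p = xc c" "xc (F p) \<in> {-4..4}" "yc (F p) = yc c" "zc (F p) = zc c"
    by (rule preimage_of_s_graph[OF s g cI])
  then have "F p \<in> \<Delta>" using c by (simp add: Delta_iff)
  then show "\<exists>p\<in>{p \<in> branch s. F p \<in> \<Delta>}. (xc p, yc (F p), zc (F p)) = c"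
    using p by (intro bexI[of _ p]) (simp_all add: prod_eq_iff)
next
  fix p assume "p \<in> {p \<in> branch s. F p \<in> \<Delta>}"
  then show "(xc p, yc (F p), zc (F p)) \<in> \<Delta>" by (auto simp: branch_def Delta_iff)
next
  fix p q assume pq: "p \<in> {p \<in> branch s. F p \<in> \<Delta>}" "q \<in> {p \<in> branch s. F p \<in> \<Delta>}"
  then have b: "p \<in> band s" "q \<in> band s" using branch_band[OF s] by blast+
  have "\<bar>xc (p - q)\<bar> + \<bar>yc (p - q)\<bar> + \<bar>zc (p - q)\<bar> \<le> 3 * \<bar>xc (p - q)\<bar> + 3 * \<bar>yc (F p - F q)\<bar> + 3 * \<bar>zc (F p - F q)\<bar>"
    by (rule near_step_cases[OF difference_near_step[OF b[THEN band_DeltaD]] band_slope[OF s b] \<xi>,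
        where \<Phi> = "\<lambda>a b c a' b' c'. a + b + c \<le> 3 * a + 3 * b' + 3 * c'"]) linarith
  then show "l1 (p - q) \<le> 3 * l1 ((xc p, yc (F p), zc (F p)) - (xc q, yc (F q), zc (F q)))"
    by (simp add: l1_def)
qed

lemma branch_image_closed:
  assumes s: "s = 1 \<or> s = -1"
  shows "closed (F ` branch s)" "connected (F ` branch s)"
proof -
  have sub: "branch s \<subseteq> \<Delta>" by (auto simp: branch_def)
  have c: "continuous_on (branch s) F" by (rule continuous_on_subset[OF continuous_F sub])
  have "compact (\<Delta> \<inter> branch s)" by (rule compact_Int_closed[OF compact_Delta closed_branch[OF s]])
  then have "compact (branch s)" using sub by (simp add: Int_absorb1)
  then show "closed (F ` branch s)" by (intro compact_imp_closed compact_continuous_image c)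
  show "connected (F ` branch s)" by (intro connected_continuous_image c connected_branch s)
qed

lemma branch_images_disjoint: "F ` branch (-1) \<inter> F ` branch 1 = {}"
proof -
  have "F p \<noteq> F q" if "p \<in> branch (-1)" "q \<in> branch 1" for p q
  proof
    assume "F p = F q"
    moreover have "2 < -1 * xc (F p)" "2 < 1 * xc (F q)"
      by (rule branch_image_x(3)[OF _ that(1)] branch_image_x(3)[OF _ that(2)], simp)+
    ultimately show False by simp
  qed
  then show ?thesis by blast
qed

lemma henon_cube_bounds:
  "xlo henon_cube = -4" "xhi henon_cube = 4" "ylo henon_cube = -4" "yhi henon_cube = 4"
  "zlo henon_cube = -40" "zhi henon_cube = 22"
  by (simp_all add: henon_cube_def)

lemma strip_iff: "p \<in> strip henon_cube \<longleftrightarrow> yc p \<in> {-4..4}"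
  by (auto simp: strip_def henon_cube_intervals mem_Times_iff)

lemma saddle_in_branch:
  assumes "s = 1 \<or> s = -1"
  shows "saddle s \<in> branch s"
  by (rule trapped_branch[OF saddle(1)[OF assms]])

lemma BH1_holds: "BH1 henon_cube F (branch (-1)) (branch 1)"
proof -
  have img: "F ` \<Delta> \<inter> strip henon_cube = F ` branch (-1) \<union> F ` branch 1"
  proof
    show "F ` \<Delta> \<inter> strip henon_cube \<subseteq> F ` branch (-1) \<union> F ` branch 1"
    proof
      fix q assume "q \<in> F ` \<Delta> \<inter> strip henon_cube"
      then have q: "q \<in> F ` \<Delta>" "yc q \<in> {-4..4}" unfolding Int_iff strip_iff by blast+
      from q(1) obtain p where "q = F p" "p \<in> \<Delta>" by (rule imageE)
      with q(2) have p: "p \<in> \<Delta>" "q = F p" "yc (F p) \<in> {-4..4}" by simp_all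
      then show "q \<in> F ` branch (-1) \<union> F ` branch 1" using in_branch_if_image_in_strip[OF p(1,3)] by blast
    qed
    show "F ` branch (-1) \<union> F ` branch 1 \<subseteq> F ` \<Delta> \<inter> strip henon_cube"
      by (auto simp: branch_def strip_iff)
  qed
  have ne: "F ` branch (-1) \<noteq> {}" "F ` branch 1 \<noteq> {}" using saddle_in_branch by blast+
  have x: "F ` branch s \<subseteq> {xlo henon_cube<..<xhi henon_cube} \<times> Iy henon_cube \<times> UNIV" if s: "s = 1 \<or> s = -1" for s
  proof (rule image_subsetI)
    fix p assume p: "p \<in> branch s"
    then show "F p \<in> {xlo henon_cube<..<xhi henon_cube} \<times> Iy henon_cube \<times> UNIV"
      using branch_image_x[OF s p] unfolding branch_def henon_cube_intervals
      by (simp add: mem_Times_iff henon_cube_def)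
  qed
  have bd: "branch s \<inter> bd_uu henon_cube = {}" if s: "s = 1 \<or> s = -1" for s
  proof -
    have "p \<notin> bd_uu henon_cube" if p: "p \<in> branch s" for p
      using branch_bounds[OF s p] s unfolding bd_uu_def frontier_Ix_Iy by (auto simp: mem_Times_iff)
    then show ?thesis by blast
  qed
  show ?thesis
    unfolding BH1_def
  proof (intro conjI)
    show "components (F ` \<Delta> \<inter> strip henon_cube) = {F ` branch (-1), F ` branch 1}"
      unfolding img using branch_image_closed branch_images_disjoint ne by (intro components_two_pieces) auto
    show "F ` branch (-1) \<noteq> F ` branch 1" using branch_images_disjoint ne by blast
    show "branch (-1) \<inter> branch 1 = {}" using branch_disjoint by blast
    show "(branch (-1) \<union> branch 1) \<inter> bd_uu henon_cube = {}" using bd by blast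
    show "F ` branch (-1) \<union> F ` branch 1 \<subseteq> {xlo henon_cube<..<xhi henon_cube} \<times> Iy henon_cube \<times> UNIV"
      using x[of 1] x[of "-1"] by simp
    show "connected (branch (-1))" "connected (branch 1)" by (rule connected_branch, simp)+
    show "F ` \<Delta> \<inter> strip henon_cube = F ` branch (-1) \<union> F ` branch 1" by (rule img)
  qed (auto simp: branch_def)
qed

lemma BH2_holds: "BH2 henon_cube F (branch (-1)) (branch 1) (1/2) (1/20) 1 (101/100)"
proof -
  have "DF henon_cube F p -` cone_s (1/20) \<subseteq> cone_s (1/20) \<and>
        DF henon_cube F p ` cone_u (1/2) \<subseteq> cone_u (1/2) \<and>
        DF henon_cube F p ` cone_uu (1/2) \<subseteq> cone_uu (1/2) \<and>
        (\<forall>v\<in>cone_s (1/20). norm (DF henon_cube F p v) \<le> inverse (101/100) * norm v) \<and>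
        (\<forall>w\<in>cone_u (1/2). norm (DF henon_cube F p w) \<ge> (101/100) * norm w)"
    if s: "s = 1 \<or> s = -1" and p: "p \<in> branch s" for s p
  proof -
    have pD: "p \<in> \<Delta>" using p by (simp add: branch_def)
    have m: "4 \<le> \<bar>2 * yc p\<bar>" "\<bar>2 * yc p\<bar> \<le> 8" using branch_bounds[OF s p] s by auto
    note st = DF_near_step[OF pD]
    show ?thesis
      using near_step_cone_s[OF st m \<xi>] near_step_cone_u[OF st m \<xi>] near_step_cone_uu[OF st m \<xi>] by blast
  qed
  then have "\<forall>p \<in> (branch (-1) \<union> branch 1) \<inter> dom_iter henon_cube F 1.
        DF_iter henon_cube F 1 p -` cone_s (1/20) \<subseteq> cone_s (1/20) \<and>
        DF_iter henon_cube F 1 p ` cone_u (1/2) \<subseteq> cone_u (1/2) \<and>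
        DF_iter henon_cube F 1 p ` cone_uu (1/2) \<subseteq> cone_uu (1/2) \<and>
        (\<forall>v\<in>cone_s (1/20). norm (DF_iter henon_cube F 1 p v) \<le> inverse (101/100) * norm v) \<and>
        (\<forall>w\<in>cone_u (1/2). norm (DF_iter henon_cube F 1 p w) \<ge> (101/100) * norm w)"
    unfolding One_nat_def DF_iter.simps funpow_0 comp_id by (metis IntD1 UnE)
  then show ?thesis unfolding BH2_def by simp
qed

lemma BH3_holds: "BH3 henon_cube F (branch (-1)) (branch 1)"
proof -
  let ?R = "\<lambda>s. {p \<in> branch s. F p \<in> \<Delta>}"
  have sub: "branch s \<subseteq> \<Delta>" for s by (auto simp: branch_def)
  have inb: "p \<in> branch 1 \<or> p \<in> branch (-1)" if "p \<in> \<Delta>" "F p \<in> \<Delta>" for p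
    using in_branch_if_image_in_strip[OF that(1)] that(2) by (auto simp: Delta_iff)
  have AA: "{p \<in> \<Delta>. F p \<in> F ` branch (-1) \<inter> \<Delta>} = ?R (-1)"
    using inb branch_images_disjoint sub by blast
  have BB: "{p \<in> \<Delta>. F p \<in> F ` branch 1 \<inter> \<Delta>} = ?R 1"
    using inb branch_images_disjoint sub by blast
  have cl: "closed (?R s)" if s: "s = 1 \<or> s = -1" for s
  proof -
    have "closed (branch s \<inter> F -` \<Delta>)"
      by (rule continuous_closed_preimage[OF continuous_on_subset[OF continuous_F sub] closed_branch[OF s]
            compact_imp_closed[OF compact_Delta]])
    moreover have "?R s = branch s \<inter> F -` \<Delta>" by blast
    ultimately show ?thesis by simp
  qed
  have ne: "?R s \<noteq> {}" if s: "s = 1 \<or> s = -1" for s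
  proof -
    have "saddle s \<in> ?R s" using saddle_in_branch[OF s] saddle(2)[OF s] sub by auto
    then show ?thesis by blast
  qed
  have "{p \<in> \<Delta>. F p \<in> \<Delta>} = ?R (-1) \<union> ?R 1" using inb sub by blast
  then have comp: "components {p \<in> \<Delta>. F p \<in> \<Delta>} = {?R (-1), ?R 1}"
    using cl connected_branch_return ne branch_disjoint by (simp, intro components_two_pieces) auto
  have ins: "?R s \<subseteq> Ix henon_cube \<times> {ylo henon_cube<..<yhi henon_cube} \<times> {zlo henon_cube<..<zhi henon_cube}" for s
  proof
    fix p assume "p \<in> ?R s"
    then have p: "p \<in> \<Delta>" "F p \<in> \<Delta>" using sub by auto
    then show "p \<in> Ix henon_cube \<times> {ylo henon_cube<..<yhi henon_cube} \<times> {zlo henon_cube<..<zhi henon_cube}"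
      using return_interior[OF p] p(1) unfolding henon_cube_intervals henon_cube_bounds by (simp add: mem_Times_iff Delta_iff)
  qed
  have "F ` ?R (-1) \<union> F ` ?R 1 \<subseteq> F ` branch (-1) \<union> F ` branch 1" by blast
  also have "\<dots> \<subseteq> {xlo henon_cube<..<xhi henon_cube} \<times> Iy henon_cube \<times> UNIV"
    using BH1_holds unfolding BH1_def by (elim conjE)
  finally show ?thesis unfolding BH3_def Let_def AA BB using comp ins[of "-1"] ins[of 1] by simp
qed

text \<open>The \<open>z\<close>-variation of a uu-disc is at most half of the length \<open>8\<close> of the \<open>y\<close>-interval, and the stable
  curves are farther than \<open>4\<close> from the faces \<open>z = -40\<close> and \<open>z = 22\<close>.\<close>

lemma uu_disc_meeting_trapped_avoids_bd_u:
  assumes s: "s = 1 \<or> s = -1" and L: "uu_disc henon_cube (1/2) L" "L \<inter> trapped s \<noteq> {}"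
  shows "L \<inter> closure (bd_u henon_cube - bd_uu henon_cube) = {}"
proof -
  obtain p where p: "p \<in> L" "p \<in> trapped s" using L(2) by blast
  have "p = wpt s (xc p)" by (rule trapped_eq_wpt[OF s p(2)])
  then have "\<bar>zc p - zc (saddle s)\<bar> \<le> 8/100" using near_saddle(2)[OF s trapped_x[OF p(2)]] by simp
  moreover have "-21 < zc (saddle s)" "zc (saddle s) < 155/10"
    using saddle_coords(5,6)[OF s] saddle_P_height s by auto
  ultimately have zp: "-22 < zc p" "zc p < 16" by linarith+
  have z: "-40 < zc q \<and> zc q < 22" if q: "q \<in> L" for q
  proof -
    have "2 * \<bar>zc q - zc p\<bar> \<le> \<bar>yc q - yc p\<bar>" by (rule uu_disc_coords(2)[OF L(1) q p(1)])
    moreover have "\<bar>yc q - yc p\<bar> \<le> 8"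
      using uu_disc_coords(3)[OF L(1) q] uu_disc_coords(3)[OF L(1) p(1)] by auto
    ultimately have "\<bar>zc q - zc p\<bar> \<le> 4" by simp
    then show ?thesis using zp by auto
  qed
  have "frontier (Iy henon_cube \<times> Iz henon_cube) \<subseteq> (Iy henon_cube \<times> Iz henon_cube) - ({-4<..<4} \<times> {-40<..<22})"
    unfolding frontier_def henon_cube_intervals by (auto simp: interior_Times closure_Times)
  then have fr: "-4 \<le> y \<and> y \<le> 4 \<and> -40 \<le> z \<and> z \<le> 22 \<and> (y = -4 \<or> y = 4 \<or> z = -40 \<or> z = 22)"
    if "(y, z) \<in> frontier (Iy henon_cube \<times> Iz henon_cube)" for y z
    using that unfolding henon_cube_intervals by fastforce
  have "bd_u henon_cube - bd_uu henon_cube \<subseteq> {q. zc q = -40 \<or> zc q = 22}"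
  proof
    fix q assume q: "q \<in> bd_u henon_cube - bd_uu henon_cube"
    then have "xc q \<in> Ix henon_cube" "(yc q, zc q) \<in> frontier (Iy henon_cube \<times> Iz henon_cube)"
      unfolding bd_u_def by (auto simp: mem_Times_iff)
    moreover from this q have "yc q \<noteq> -4 \<and> yc q \<noteq> 4"
      using fr unfolding bd_uu_def frontier_Ix_Iy henon_cube_intervals(3) by (fastforce simp: mem_Times_iff)
    ultimately show "q \<in> {q. zc q = -40 \<or> zc q = 22}" using fr by blast
  qed
  moreover have "closed {q :: r3. zc q = -40 \<or> zc q = 22}"
    by (intro closed_Collect_disj closed_Collect_eq continuous_intros)
  ultimately have "closure (bd_u henon_cube - bd_uu henon_cube) \<subseteq> {q. zc q = -40 \<or> zc q = 22}"
    by (rule closure_minimal)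
  then show ?thesis using z by fastforce
qed

lemma side_invariant:
  assumes s: "s = 1 \<or> s = -1" and L: "uu_disc henon_cube (1/2) L" "L \<subseteq> \<Delta>"
    and k: "k = 1 \<or> k = -1" and side: "on_side (wY s) (wZ s) k L"
  shows "on_side (wY s) (wZ s) k (F ` (L \<inter> branch s))"
proof -
  obtain q where q: "q \<in> L" "on_wall s q" "0 < k * height s q" using side unfolding on_side_height by blast
  obtain p where p: "p \<in> L" "p \<in> branch s" "on_wall s (F p)"
    "0 < k * height s (F p) \<Longrightarrow> on_side (wY s) (wZ s) k (F ` (L \<inter> branch s))"
    using crossing_of_image[OF s s L] by metis
  show ?thesis by (rule p(4)[OF height_of_image_same_sign[OF s L p(1-3) q(1,2) k q(3)]])
qed

lemma side_across:
  assumes s: "s = 1 \<or> s = -1" and L: "uu_disc henon_cube (1/2) L" "L \<subseteq> \<Delta>"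
    and side: "on_side (wY s) (wZ s) (- s) L \<or> L \<inter> trapped s \<noteq> {}"
  shows "on_side (wY s) (wZ s) (- s) (F ` (L \<inter> branch (- s)))"
proof -
  have s': "- s = 1 \<or> - s = -1" using s by auto
  have "\<exists>q\<in>L. on_wall s q \<and> 0 \<le> - s * height s q"
    using side
  proof
    assume "on_side (wY s) (wZ s) (- s) L"
    then show ?thesis unfolding on_side_height by force
  next
    assume "L \<inter> trapped s \<noteq> {}"
    then obtain q where q: "q \<in> L" "q \<in> trapped s" by blast
    have "q = wpt s (xc q)" by (rule trapped_eq_wpt[OF s q(2)])
    then have "on_wall s q" "height s q = 0" unfolding on_wall_def height_def by simp_all
    then show ?thesis using q(1) by (intro bexI[of _ q]) simp_all
  qed
  then obtain q where q: "q \<in> L" "on_wall s q" "0 \<le> - s * height s q" by blast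
  obtain p where p: "p \<in> L" "p \<in> branch (- s)" "on_wall s (F p)"
    "0 < - s * height s (F p) \<Longrightarrow> on_side (wY s) (wZ s) (- s) (F ` (L \<inter> branch (- s)))"
    using crossing_of_image[OF s' s L] by metis
  show ?thesis by (rule p(4)[OF height_of_image_across[OF s L p(1-3) q]])
qed

lemma BH5_holds: "BH5 henon_cube F (branch (-1)) (branch 1) (1/2) (trapped (-1)) (trapped 1)"
proof -
  have P: "(-1::real) = 1 \<or> (-1::real) = -1" and Q: "(1::real) = 1 \<or> (1::real) = -1" by simp_all
  show ?thesis
    unfolding BH5_def class_iff_on_side[OF P] class_iff_on_side[OF Q]
    using side_invariant[OF P _ _ P] side_invariant[OF P _ _ Q] side_invariant[OF Q _ _ P] side_invariant[OF Q _ _ Q]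
      side_across[OF P] side_across[OF Q] by (simp only: minus_minus) blast
qed

text \<open>The image under the first branch stays on the correct side of the curve of \<open>P\<close> and the one under the second
  on the correct side of the curve of \<open>Q\<close>. If both were on the wrong side of the other curve, \<open>L\<close> would contain points with \<open>\<xi> z \<le> -6\<close> and with
  \<open>\<xi> z \<ge> 6\<close>, but its \<open>z\<close>-variation is at most \<open>4\<close>.\<close>

lemma BH6_holds: "BH6 henon_cube F (branch (-1)) (branch 1) (1/2) (trapped (-1)) (trapped 1)"
proof -
  have P: "(-1::real) = 1 \<or> (-1::real) = -1" and Q: "(1::real) = 1 \<or> (1::real) = -1" by simp_all
  have sup: "M \<in> superposition henon_cube (1/2) (trapped (-1)) (trapped 1) \<longleftrightarrow>
     on_side (wY (-1)) (wZ (-1)) (-1) M \<and> on_side (wY 1) (wZ 1) 1 M" for M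
    unfolding superposition_def Int_iff class_iff_on_side[OF P] class_iff_on_side[OF Q] ..
  have "on_side (wY 1) (wZ 1) 1 (F ` (L \<inter> branch (-1))) \<or> on_side (wY (-1)) (wZ (-1)) (-1) (F ` (L \<inter> branch 1))"
    if L: "uu_disc henon_cube (1/2) L" "L \<subseteq> \<Delta>" for L
  proof (rule ccontr)
    assume neg: "\<not> ?thesis"
    obtain p where p: "p \<in> L" "p \<in> branch (-1)"
      "0 < 1 * height 1 (F p) \<Longrightarrow> on_side (wY 1) (wZ 1) 1 (F ` (L \<inter> branch (-1)))"
      using crossing_of_image[OF P Q L] by metis
    obtain q where q: "q \<in> L" "q \<in> branch 1"
      "0 < -1 * height (-1) (F q) \<Longrightarrow> on_side (wY (-1)) (wZ (-1)) (-1) (F ` (L \<inter> branch 1))"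
      using crossing_of_image[OF Q P L] by metis
    have hp: "zc (F p) \<le> wZ 1 (xc (F p))" using p(3) neg unfolding height_def by force
    have hq: "wZ (-1) (xc (F q)) \<le> zc (F q)" using q(3) neg unfolding height_def by force
    have xF: "xc (F p) \<in> {-4..4}" "xc (F q) \<in> {-4..4}"
      using branch_image_x[OF P p(2)] branch_image_x[OF Q q(2)] by auto
    have "wZ 1 (xc (F p)) \<le> -10"
      using abs_le_D1[OF near_saddle(2)[OF Q xF(1)]] saddle_coords(5)[OF Q] by simp
    with hp have hp': "zc (F p) \<le> -10" by simp
    have "10 \<le> wZ (-1) (xc (F q))"
      using abs_le_D2[OF near_saddle(2)[OF P xF(2)]] saddle_coords(5)[OF P] by simp
    with hq have hq': "10 \<le> zc (F q)" by simp
    have D: "p \<in> \<Delta>" "q \<in> \<Delta>" using p(1) q(1) L(2) by auto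
    have y: "- (15/4) < yc p" "yc q < 15/4"
      using branch_bounds[OF P p(2)] branch_bounds[OF Q q(2)] by auto
    have zp: "\<xi> * zc p \<le> -6" using F_approx_bounds(5)[OF D(1)] hp' y by linarith
    have zq: "6 \<le> \<xi> * zc q" using F_approx_bounds(6)[OF D(2)] hq' y by linarith
    have "2 * \<bar>zc q - zc p\<bar> \<le> \<bar>yc q - yc p\<bar>" by (rule uu_disc_coords(2)[OF L(1) q(1) p(1)])
    moreover have "\<bar>yc q - yc p\<bar> \<le> 8" using D by (auto simp: Delta_iff)
    ultimately have "\<bar>zc q - zc p\<bar> \<le> 4" by simp
    then have "zc q - zc p \<le> 4" by (rule abs_le_D1)
    then have "\<xi> * (zc q - zc p) \<le> \<xi> * 4" using \<xi> by (intro mult_left_mono) auto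
    then show False using zp zq \<xi> by (simp add: right_diff_distrib)
  qed
  then show ?thesis
    unfolding BH6_def sup using side_invariant[OF P _ _ P] side_invariant[OF Q _ _ Q] by blast
qed

text \<open>The curves of \<open>P\<close> and \<open>Q\<close> are on different sides of the plane \<open>z = 0\<close>.\<close>

lemma superposition_nonempty: "superposition henon_cube (1/2) (trapped (-1)) (trapped 1) \<noteq> {}"
proof -
  have P: "(-1::real) = 1 \<or> (-1::real) = -1" and Q: "(1::real) = 1 \<or> (1::real) = -1" by simp_all
  let ?L = "{0} \<times> {-4..4} \<times> {0} :: r3 set"
  have side: "on_side (wY s) (wZ s) s ?L" if s: "s = 1 \<or> s = -1" for s
  proof -
    have "0 < s * (0 - wZ s 0)"
      using abs_le_D1[OF near_saddle(2)[OF s, of 0]] abs_le_D2[OF near_saddle(2)[OF s, of 0]]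
        saddle_coords(5)[OF s] s by auto
    moreover have "wY s 0 \<in> {-4..4}" using s_graphD(1)[OF s_graph_trapped[OF s], of 0] by simp
    ultimately show ?thesis unfolding on_side_def using horizontal_uu_disc[of 0]
      by (intro conjI ballI bexI[of _ "(0, wY s 0, 0)"]) auto
  qed
  have "?L \<in> superposition henon_cube (1/2) (trapped (-1)) (trapped 1)"
    unfolding superposition_def Int_iff class_iff_on_side[OF P] class_iff_on_side[OF Q] using side[OF P] side[OF Q] by blast
  then show ?thesis by blast
qed

lemma max_invariant_interior: "max_invariant henon_cube F \<subseteq> interior \<Delta>"
proof
  fix p assume "p \<in> max_invariant henon_cube F"
  then have "p \<in> (F ^^ 1) ` dom_iter henon_cube F 1" "p \<in> {p \<in> dom_iter henon_cube F 1. (F ^^ 1) p \<in> \<Delta>}"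
    unfolding max_invariant_def by blast+
  then have p: "p \<in> \<Delta>" "F p \<in> \<Delta>" and "p \<in> F ` \<Delta>" by (auto simp: dom_iter_def)
  then obtain q where q: "q \<in> \<Delta>" "p = F q" by blast
  have "q \<in> branch 1 \<or> q \<in> branch (-1)"
    using in_branch_if_image_in_strip[OF q(1)] p(1) unfolding q(2) by (auto simp: Delta_iff)
  then have "-4 < xc p" "xc p < 4" using branch_image_x(1,2) unfolding q(2) by blast+
  then show "p \<in> interior \<Delta>" using return_interior[OF p] unfolding interior_Delta by simp
qed

theorem blender_horseshoe_near_henon: "blender_horseshoe henon_cube F"
proof -
  have P: "(-1::real) = 1 \<or> (-1::real) = -1" and Q: "(1::real) = 1 \<or> (1::real) = -1" by simp_all
  have BH4: "BH4 henon_cube (1/2) (trapped (-1)) (trapped 1)"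
    unfolding BH4_def using uu_disc_meeting_trapped_avoids_bd_u[OF P] uu_disc_meeting_trapped_avoids_bd_u[OF Q] by blast
  have zi: "zero_inside henon_cube" by (simp add: zero_inside_def henon_cube_def)
  show ?thesis
    unfolding blender_horseshoe_def
    by (intro conjI exI[of _ "branch (-1)"] exI[of _ "branch 1"] exI[of _ "1/2"] exI[of _ "1/20"]
        exI[of _ "1::nat"] exI[of _ "101/100"] exI[of _ "saddle (-1)"] exI[of _ "saddle 1"];
        (unfold Ws_loc_saddle[OF P] Ws_loc_saddle[OF Q])?;
        rule zi C1 max_invariant_interior BH1_holds BH2_holds saddle_in_branch[OF P] saddle_in_branch[OF Q]
          saddle_fixed_saddle[OF P] saddle_fixed_saddle[OF Q] trapped_inner_s_disc[OF P] trapped_inner_s_disc[OF Q]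
          superposition_nonempty BH3_holds BH4 BH5_holds BH6_holds)
qed

end

section \<open>The family\<close>

lemma henon_cu_C1_on: "C1_on S (henon_cu \<xi> \<mu> \<kappa> \<eta>)"
proof -
  define D where "D p = Blinfun (\<lambda>v :: r3. (yc v, 2 * yc p * yc v + \<kappa> * (yc v * zc p + yc p * zc v)
      + 2 * \<eta> * zc p * zc v, \<xi> * zc v + yc v))" for p :: r3
  have D: "blinfun_apply (D p) = (\<lambda>v. (yc v, 2 * yc p * yc v + \<kappa> * (yc v * zc p + yc p * zc v)
      + 2 * \<eta> * zc p * zc v, \<xi> * zc v + yc v))" for p
    unfolding D_def using has_derivative_bounded_linear[OF henon_cu_has_derivative[of \<xi> _ \<kappa> \<eta> p UNIV]]
    by (rule bounded_linear_Blinfun_apply)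
  have "continuous_on S D"
    by (rule continuous_on_blinfun_componentwise) (unfold D, intro continuous_intros)
  then show ?thesis
    unfolding C1_on_def using henon_cu_has_derivative D by (intro exI[of _ D]) simp
qed

text \<open>On the cube, \<open>\<kappa> y z + \<eta> z\<^sup>2\<close> is at most \<open>1760\<close> times the bound \<open>1/100000000\<close> for the parameters, which is less
  than half of \<open>tol\<close>; the other half is left for the perturbation.\<close>

lemma near_henon_if_C1_close:
  assumes par: "59/50 < \<xi>" "\<xi> < 119/100" "-10 < \<mu>" "\<mu> < -9"
    and small: "\<bar>\<kappa>\<bar> \<le> 1/100000000" "\<bar>\<eta>\<bar> \<le> 1/100000000"
    and F: "C1_on \<Delta> F" "C1_close henon_cube (tol / 2) F (henon_cu \<xi> \<mu> \<kappa> \<eta>)"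
  shows "near_henon F \<xi> \<mu>"
proof
  let ?G = "henon_cu \<xi> \<mu> \<kappa> \<eta>" and ?H = "henon_cu \<xi> \<mu> 0 0"
  fix p assume p: "p \<in> \<Delta>"
  have yz: "\<bar>yc p\<bar> \<le> 4" "\<bar>zc p\<bar> \<le> 40" using p by (auto simp: Delta_iff)
  have "norm (?G p - ?H p) = \<bar>\<kappa> * (yc p * zc p) + \<eta> * (zc p * zc p)\<bar>"
    unfolding henon_cu_coords by (simp add: norm_Pair power2_eq_square mult.assoc)
  also have "\<dots> \<le> \<bar>\<kappa>\<bar> * (\<bar>yc p\<bar> * \<bar>zc p\<bar>) + \<bar>\<eta>\<bar> * (\<bar>zc p\<bar> * \<bar>zc p\<bar>)"
    unfolding abs_mult[symmetric] by (rule abs_triangle_ineq)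
  also have "\<dots> \<le> 1/100000000 * (4 * 40) + 1/100000000 * (40 * 40)"
    using small yz by (intro add_mono mult_mono) auto
  finally have "norm (?G p - ?H p) \<le> tol / 2" by simp
  moreover have "norm (F p - ?G p) \<le> tol / 2" using F(2) p unfolding C1_close_def by (simp add: less_imp_le)
  moreover have "norm (F p - ?H p) \<le> norm (F p - ?G p) + norm (?G p - ?H p)"
    using norm_triangle_ineq[of "F p - ?G p" "?G p - ?H p"] by simp
  ultimately show "norm (F p - ?H p) \<le> tol" by linarith
  fix v :: r3
  let ?DF = "DF henon_cube F p" and ?DG = "DF henon_cube ?G p" and ?DH = "DF henon_cube ?H p"
  have "norm (?DG v - ?DH v) = \<bar>\<kappa> * (yc v * zc p) + \<kappa> * (yc p * zc v) + 2 * \<eta> * (zc p * zc v)\<bar>"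
    unfolding DF_henon[OF p] by (simp add: norm_Pair algebra_simps)
  also have "\<dots> \<le> \<bar>\<kappa> * (yc v * zc p)\<bar> + \<bar>\<kappa> * (yc p * zc v)\<bar> + \<bar>2 * \<eta> * (zc p * zc v)\<bar>"
    by linarith
  also have "\<dots> = \<bar>\<kappa>\<bar> * (\<bar>yc v\<bar> * \<bar>zc p\<bar>) + \<bar>\<kappa>\<bar> * (\<bar>yc p\<bar> * \<bar>zc v\<bar>) + 2 * \<bar>\<eta>\<bar> * (\<bar>zc p\<bar> * \<bar>zc v\<bar>)"
    by (simp add: abs_mult)
  also have "\<dots> \<le> 1/100000000 * (norm v * 40) + 1/100000000 * (4 * norm v) + 2 * (1/100000000) * (40 * norm v)"
  proof -
    have "\<bar>\<kappa>\<bar> * (\<bar>yc v\<bar> * \<bar>zc p\<bar>) \<le> 1/100000000 * (norm v * 40)"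
      by (rule mult_mono[OF small(1) mult_mono[OF comp_le_norm(2) yz(2)]]) simp_all
    moreover have "\<bar>\<kappa>\<bar> * (\<bar>yc p\<bar> * \<bar>zc v\<bar>) \<le> 1/100000000 * (4 * norm v)"
      by (rule mult_mono[OF small(1) mult_mono[OF yz(1) comp_le_norm(3)]]) simp_all
    moreover have "\<bar>\<eta>\<bar> * (\<bar>zc p\<bar> * \<bar>zc v\<bar>) \<le> 1/100000000 * (40 * norm v)"
      by (rule mult_mono[OF small(2) mult_mono[OF yz(2) comp_le_norm(3)]]) simp_all
    ultimately show ?thesis by linarith
  qed
  also have "\<dots> \<le> tol / 2 * norm v" by simp
  finally have GH: "norm (?DG v - ?DH v) \<le> tol / 2 * norm v" .
  obtain D :: "r3 \<Rightarrow> r3 \<Rightarrow>\<^sub>L r3" where "(F has_derivative blinfun_apply (D p)) (at p within \<Delta>)"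
    using F(1) p unfolding C1_on_def by blast
  then have "?DF = blinfun_apply (D p)" by (rule DF_unique[OF p])
  then have blF: "bounded_linear ?DF" by (simp add: blinfun.bounded_linear_right)
  have blG: "bounded_linear ?DG"
    unfolding DF_henon[OF p] by (rule has_derivative_bounded_linear[OF henon_cu_has_derivative])
  have "norm (?DF v - ?DG v) \<le> onorm (\<lambda>v. ?DF v - ?DG v) * norm v"
    by (rule onorm[OF bounded_linear_sub[OF blF blG]])
  also have "\<dots> \<le> tol / 2 * norm v"
    using F(2) p unfolding C1_close_def by (intro mult_right_mono) (auto simp: less_imp_le)
  finally have "norm (?DF v - ?DG v) \<le> tol / 2 * norm v" .
  moreover have "norm (?DF v - ?DH v) \<le> norm (?DF v - ?DG v) + norm (?DG v - ?DH v)"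
    using norm_triangle_ineq[of "?DF v - ?DG v" "?DG v - ?DH v"] by simp
  moreover have "tol / 2 * norm v + tol / 2 * norm v = tol * norm v" by simp
  ultimately show "norm (?DF v - ?DH v) \<le> tol * norm v" using GH by linarith
qed (use par F(1) in auto)

theorem theorem1:
  shows "\<exists>\<epsilon>>0. \<forall>\<xi> \<mu> \<kappa> \<eta> :: real.
    (\<xi>, \<mu>, \<kappa>, \<eta>) \<in> {1.18<..<1.19} \<times> {-10<..<-9} \<times> {-\<epsilon><..<\<epsilon>} \<times> {-\<epsilon><..<\<epsilon>} \<longrightarrow>
      blender_horseshoe henon_cube (henon_cu \<xi> \<mu> \<kappa> \<eta>) \<and>
      (\<exists>\<delta>>0. \<forall>F. C1_on (Delta henon_cube) F \<and> C1_close henon_cube \<delta> F (henon_cu \<xi> \<mu> \<kappa> \<eta>) \<longrightarrow>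
         blender_horseshoe henon_cube F)"
proof (rule exI[of _ "1/100000000"], intro conjI allI impI)
  fix \<xi> \<mu> \<kappa> \<eta> :: real
  let ?e = "1/100000000 :: real" and ?G = "henon_cu \<xi> \<mu> \<kappa> \<eta>"
  assume "(\<xi>, \<mu>, \<kappa>, \<eta>) \<in> {1.18<..<1.19} \<times> {-10<..<-9} \<times> {-?e<..<?e} \<times> {-?e<..<?e}"
  then have par: "59/50 < \<xi>" "\<xi> < 119/100" "-10 < \<mu>" "\<mu> < -9" "\<bar>\<kappa>\<bar> \<le> ?e" "\<bar>\<eta>\<bar> \<le> ?e"
    by auto
  have all: "blender_horseshoe henon_cube F" if "C1_on \<Delta> F" "C1_close henon_cube (tol / 2) F ?G" for F
    using near_henon.blender_horseshoe_near_henon[OF near_henon_if_C1_close[OF par that]] .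
  have "C1_close henon_cube (tol / 2) ?G ?G"
    by (simp add: C1_close_def onorm_zero)
  then show "blender_horseshoe henon_cube ?G" by (rule all[OF henon_cu_C1_on])
  show "\<exists>\<delta>>0. \<forall>F. C1_on \<Delta> F \<and> C1_close henon_cube \<delta> F ?G \<longrightarrow> blender_horseshoe henon_cube F"
    using all by (intro exI[of _ "tol / 2"]) simp
qed simp
end
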